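(* Let $L$ and $R$ denote the sets of left, respectively right, endpoints of the connected components $(q_1,q_2)$ of the open set $(1,\infty)\setminus\mathcal V$. (i) $L=\mathbb N\cup(\mathcal V\setminus\mathcal U)$ and $R=\mathcal V\setminus\overline{\mathcal U}$. Hence $R\subset L$, and $$(1,\infty)\setminus\overline{\mathcal U}=\bigcup\,(q_1,q_2],$$ where the union runs over the connected components $(q_1,q_2)$ of $(1,\infty)\setminus\mathcal V$. (ii) If $q\in\{2,3,\dots\}$, then neither $\mathcal U_q$ nor its closure $\overline{\mathcal U_q}$ is a Cantor set. (iii) If $q\in\overline{\mathcal U}\setminus\mathbb N$, then $\mathcal U_q$ is not a Cantor set, but its closure $\overline{\mathcal U_q}$ is a Cantor set. (iv) If $q\in(q_1,q_2]$, where $(q_1,q_2)$ is a connected component of $(1,\infty)\setminus\mathcal V$, then the closed set $\mathcal U_q$ is a Cantor set if and only if $q_1\in\{3,4,\dots\}\cup(\overline{\mathcal U}\setminus\mathcal U)$. Moreover, if $q_1\in\{1,2\}\cup(\mathcal V\setminus\overline{\mathcal U})$, then the isolated points of $\mathcal U_q$ form a dense subset of $\mathcal U_q$.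
   Context: Let $\mathbb N=\{1,2,\dots\}$. A Cantor set is a nonempty closed set (of real numbers) having neither interior nor isolated points. A sequence is an element of $\{0,1,2,\dots\}^{\mathbb N}$; it is called infinite if it has infinitely many nonzero terms, and finite otherwise. Sequences are compared lexicographically. For a real $q>1$, let $\lceil q\rceil$ be the smallest integer $\ge q$. An expansion of a real number $x$ in base $q$ is a sequence $(c_i)$ of integers with $0\le c_i<q$ for all $i\ge1$ and $x=\sum_{i\ge1}c_iq^{-i}$. Write $(\alpha_i)=(\alpha_i(q))$ for the quasi-greedy expansion of $1$ in base $q$, i.e. the lexicographically largest infinite expansion of $1$ in base $q$ (it exists); one has $\alpha_1=\lceil q\rceil-1$. For a digit $c\in\{0,\dots,\alpha_1\}$ put $\overline c=\alpha_1-c$, and $\overline{c_1c_2\ldots}=\overline{c_1}\,\overline{c_2}\ldots$. $\mathcal U$ is the set of real numbers $q>1$ for which $1$ has exactly one expansion in base $q$, and $\overline{\mathcal U}$ is its topological closure. $\mathcal V$ is the set of real numbers $q>1$ for which $\overline{\alpha_{k+1}(q)\alpha_{k+2}(q)\ldots}\le\alpha_1(q)\alpha_2(q)\ldots$ for all $k\ge1$. One has $\mathcal U\subset\overline{\mathcal U}\subset\mathcal V$, and $\mathcal V$ is closed, so $(1,\infty)\setminus\mathcal V$ is a union of countably many disjoint open intervals $(q_1,q_2)$, its connected components. For $q>1$, $\mathcal U_q$ is the set of real numbers $x$ having exactly one expansion in base $q$. *)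

theory Defs
  imports "HOL-Analysis.Analysis" "HOL-Library.Fun_Lexorder"
begin

text \<open>
  A sequence \<open>c\<^sub>1 c\<^sub>2 \<dots>\<close> is represented by the function \<open>c :: nat \<Rightarrow> nat\<close> with \<open>c i\<close> standing for
  \<open>c\<^sub>i\<^sub>+\<^sub>1\<close>; every function is then a sequence and there is no junk value at index 0.
\<close>

definition expansion :: "real \<Rightarrow> real \<Rightarrow> (nat \<Rightarrow> nat) \<Rightarrow> bool" where
  "expansion q x c \<longleftrightarrow>
     (\<forall>i. real (c i) < q) \<and> (\<lambda>i. real (c i) / q ^ Suc i) sums x"

definition infinite_seq :: "(nat \<Rightarrow> nat) \<Rightarrow> bool" where
  "infinite_seq c \<longleftrightarrow> infinite {i. c i \<noteq> 0}"

definition lex_le :: "(nat \<Rightarrow> nat) \<Rightarrow> (nat \<Rightarrow> nat) \<Rightarrow> bool" where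
  "lex_le c d \<longleftrightarrow> less_fun c d \<or> c = d"

text \<open>
  The sequence \<open>\<alpha>(q)\<close>. It exists for every \<open>q > 1\<close>, and it is unique because the lexicographic
  order is antisymmetric.
\<close>

definition quasi_greedy :: "real \<Rightarrow> nat \<Rightarrow> nat" where
  "quasi_greedy q = (THE a. expansion q 1 a \<and> infinite_seq a \<and>
     (\<forall>c. expansion q 1 c \<and> infinite_seq c \<longrightarrow> lex_le c a))"

text \<open>
  \<open>quasi_greedy q 0\<close> is \<open>\<alpha>\<^sub>1(q) = \<lceil>q\<rceil> - 1\<close>, the largest digit, so on sequences of admissible
  digits the truncated subtraction on \<^typ>\<open>nat\<close> is the true one.
\<close>

definition reflect :: "real \<Rightarrow> (nat \<Rightarrow> nat) \<Rightarrow> nat \<Rightarrow> nat" where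
  "reflect q c = (\<lambda>i. quasi_greedy q 0 - c i)"

definition bases_U :: "real set" where
  "bases_U = {q. q > 1 \<and> (\<exists>!c. expansion q 1 c)}"

definition bases_V :: "real set" where
  "bases_V = {q. q > 1 \<and>
     (\<forall>k\<ge>1. lex_le (reflect q (\<lambda>i. quasi_greedy q (k + i))) (quasi_greedy q))}"

definition univoque_set :: "real \<Rightarrow> real set" where
  "univoque_set q = {x. \<exists>!c. expansion q x c}"

definition cantor_set :: "real set \<Rightarrow> bool" where
  "cantor_set S \<longleftrightarrow> S \<noteq> {} \<and> closed S \<and> interior S = {} \<and> \<not> (\<exists>x. x isolated_in S)"

text \<open>
  Members of \<^const>\<open>components\<close> are nonempty, so \<open>q\<^sub>1 < q\<^sub>2\<close> is implied.
\<close>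

definition component_V :: "real \<Rightarrow> real \<Rightarrow> bool" where
  "component_V q\<^sub>1 q\<^sub>2 \<longleftrightarrow> {q\<^sub>1<..<q\<^sub>2} \<in> components ({1<..} - bases_V)"

definition left_endpoints :: "real set" where
  "left_endpoints = {q\<^sub>1. \<exists>q\<^sub>2. component_V q\<^sub>1 q\<^sub>2}"

definition right_endpoints :: "real set" where
  "right_endpoints = {q\<^sub>2. \<exists>q\<^sub>1. component_V q\<^sub>1 q\<^sub>2}"

end

theory Submission
  imports Defs
begin

text \<open>
  The map \<open>q \<mapsto> \<alpha>(q)\<close> is an order isomorphism from the bases \<open>q > 1\<close> onto the infinite sequences
  \<open>a\<close> all of whose tails are at most \<open>a\<close>, which turns questions about \<open>\<U>\<close>, its closure and \<open>\<V>\<close> into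
  questions about the lexicographic order. A base of \<open>\<V>\<close> lies in the closure of \<open>\<U>\<close> exactly if no
  reflected tail of \<open>a = \<alpha>(q)\<close> equals \<open>a\<close>; then infinitely many words \<open>a\<^sub>1\<dots>a\<^sub>n\<close> can be
  decremented and continued periodically inside \<open>\<V>\<close>, so that \<open>q\<close> is a limit from the left. Otherwise
  \<open>a = (w w')\<^sup>\<infinity>\<close> with \<open>w'\<close> the reflection of a minimal word \<open>w\<close>, and the component of the
  complement of \<open>\<V>\<close> to the left of \<open>q\<close> starts at the base \<open>q\<^sub>1\<close> with \<open>\<alpha>(q\<^sub>1) = (w\<^sup>-)\<^sup>\<infinity>\<close>, where
  \<open>w\<^sup>-\<close> is \<open>w\<close> with its last digit decremented. For \<open>q \<in> (q\<^sub>1, q\<^sub>2]\<close> the unique expansions are those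
  whose constrained tails lie in the closed interval between the reflection of \<open>\<alpha>(q\<^sub>1)\<close> and
  \<open>\<alpha>(q\<^sub>1)\<close>. For \<open>q\<^sub>1 > 1\<close>, expansions ending in \<open>\<alpha>(q\<^sub>1)\<close> or its reflection come arbitrarily
  close to any other one, and they are isolated precisely if some tail of \<open>\<alpha>(q\<^sub>1)\<close> is the
  reflection of \<open>\<alpha>(q\<^sub>1)\<close>.
\<close>

section \<open>Lexicographically ordered sequences\<close>

text \<open>Decrementing a digit raises every reflected tail that covers it, so a strict lower bound
  may degrade to equality exactly there. Cuts are therefore made only at positions \<open>n\<close>
  by which all comparisons of earlier tails are already decided (\<open>dominated\<close>). A
  degraded comparison then reaches precisely the end of the cut word and is settled by the chosen
  continuation.

  Approximation of bases is read off the order: if \<open>y < q\<close>, then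
  \<open>\<alpha>(y)\<close> and \<open>\<alpha>(q)\<close> first differ at some \<open>N\<close>,
  and an admissible sequence below \<open>\<alpha>(q)\<close> sharing more than \<open>N\<close>
  digits with it belongs to a base in \<open>(y, q)\<close>. Topology on the reals is transferred
  from the compact space of digit sequences.

  For \<open>q\<close> in \<open>(q_1, q_2]\<close> the digits are those of \<open>q_2\<close>. If
  \<open>q_1 = m > 1\<close> is an integer, they run up to \<open>m\<close> although
  \<open>\<alpha>(q_1)\<close> is constantly \<open>m - 1\<close>; its reflection is constantly
  \<open>1\<close>, which is \<open>\<alpha>(q_1)\<close> only for \<open>m = 2\<close>. This
  separates \<open>2\<close> from \<open>3, 4, ...\<close>. At \<open>q_1 = 1\<close> the lowered
  word is zero, and only two constant unique expansions remain.\<close>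

notation less_fun (infix "\<sqsubset>" 50)
notation lex_le (infix "\<sqsubseteq>" 50)

lemma lex_neq_cases:
  fixes a b :: "nat \<Rightarrow> nat"
  assumes "a \<noteq> b"
  shows "a \<sqsubset> b \<or> b \<sqsubset> a"
proof -
  define i where "i = (LEAST i. a i \<noteq> b i)"
  have ne: "a i \<noteq> b i"
    unfolding i_def by (rule LeastI_ex) (use assms in \<open>auto simp: fun_eq_iff\<close>)
  have eq: "\<forall>j<i. a j = b j"
    unfolding i_def using not_less_Least by blast
  show ?thesis
    unfolding less_fun_def using ne eq by (metis linorder_neqE_nat)
qed

interpretation lex: linorder "lex_le" "less_fun :: (nat \<Rightarrow> nat) \<Rightarrow> _"
  by unfold_locales
    (auto simp: lex_le_def intro: less_fun_trans dest: less_fun_asym lex_neq_cases simp: less_fun_irrefl)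

lemma lex_lessI: "\<lbrakk>a i < b i; \<And>j. j < i \<Longrightarrow> a j = b j\<rbrakk> \<Longrightarrow> (a :: nat \<Rightarrow> nat) \<sqsubset> b"
  unfolding less_fun_def by blast

lemma lex_lessE:
  assumes "(a :: nat \<Rightarrow> nat) \<sqsubset> b"
  obtains i where "a i < b i" "\<forall>j<i. a j = b j"
  using assms unfolding less_fun_def by blast

lemma lex_le_next:
  assumes "(a :: nat \<Rightarrow> nat) \<sqsubseteq> b" "\<And>j. j < i \<Longrightarrow> a j = b j"
  shows "a i \<le> b i"
proof (rule ccontr)
  assume "\<not> a i \<le> b i"
  then have "b \<sqsubset> a" using assms(2) by (intro lex_lessI[of _ i]) auto
  then show False using assms(1) by (simp flip: lex.not_less)
qed

text \<open>A first deviation of \<open>v\<close> before \<open>n\<close> would be the same place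
  for both bounds, upwards from \<open>b\<close> and downwards from \<open>a\<close>, although these
  agree there.\<close>

lemma lex_sandwich:
  assumes "(b :: nat \<Rightarrow> nat) \<sqsubset> v" "v \<sqsubset> a" "\<And>j. j < n \<Longrightarrow> b j = a j" "j < n"
  shows "v j = a j"
proof -
  from assms(1) obtain i where i: "b i < v i" "\<forall>j<i. b j = v j" by (rule lex_lessE)
  from assms(2) obtain i' where i': "v i' < a i'" "\<forall>j<i'. v j = a j" by (rule lex_lessE)
  have "n \<le> i \<or> n \<le> i'"
    using i i' assms(3) by (metis linorder_not_le linorder_neqE_nat less_asym)
  then show ?thesis using i i' assms(3,4) by (metis order_less_le_trans)
qed

section \<open>Tails, reflection and concatenation\<close>

definition shift :: "nat \<Rightarrow> (nat \<Rightarrow> nat) \<Rightarrow> nat \<Rightarrow> nat" where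
  "shift k c = (\<lambda>i. c (k + i))"

text \<open>The alphabet bound \<open>m\<close> is a parameter because a comparison sequence may
  start with a digit below the largest one. Truncated subtraction makes this an involution only on
  digits at most \<open>m\<close>.\<close>

definition mirror :: "nat \<Rightarrow> (nat \<Rightarrow> nat) \<Rightarrow> nat \<Rightarrow> nat" where
  "mirror m c = (\<lambda>i. m - c i)"

definition join :: "nat \<Rightarrow> (nat \<Rightarrow> nat) \<Rightarrow> (nat \<Rightarrow> nat) \<Rightarrow> nat \<Rightarrow> nat" where
  "join n c d = (\<lambda>i. if i < n then c i else d (i - n))"

definition cycle :: "nat \<Rightarrow> (nat \<Rightarrow> nat) \<Rightarrow> nat \<Rightarrow> nat" where
  "cycle p c = (\<lambda>i. c (i mod p))"

lemma shift_apply [simp]: "shift k c i = c (k + i)"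
  by (simp add: shift_def)

lemma shift_0 [simp]: "shift 0 c = c"
  by (simp add: shift_def)

lemma shift_shift [simp]: "shift j (shift k c) = shift (k + j) c"
  by (simp add: shift_def add.assoc)

lemma mirror_apply [simp]: "mirror m c i = m - c i"
  by (simp add: mirror_def)

lemma shift_mirror: "shift k (mirror m c) = mirror m (shift k c)"
  by (simp add: shift_def mirror_def)

lemma mirror_mirror [simp]: "\<forall>i. c i \<le> m \<Longrightarrow> mirror m (mirror m c) = c"
  by (simp add: mirror_def)

lemma shift_greaterE:
  assumes "a \<sqsubset> shift k b"
  obtains i where "a i < b (k + i)" "\<forall>j<i. b (k + j) = a j"
proof -
  obtain i where i: "a i < shift k b i" "\<forall>j<i. a j = shift k b j"
    using assms by (rule lex_lessE)
  show ?thesis using that[of i] i unfolding shift_apply by metis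
qed

lemma mirror_shift_greaterE:
  assumes "a \<sqsubset> mirror m (shift k b)"
  obtains i where "a i < m - b (k + i)" "\<forall>j<i. m - b (k + j) = a j"
proof -
  obtain i where i: "a i < mirror m (shift k b) i" "\<forall>j<i. a j = mirror m (shift k b) j"
    using assms by (rule lex_lessE)
  show ?thesis using that[of i] i unfolding shift_apply mirror_apply by metis
qed

lemma mirror_less_iff:
  assumes "\<forall>i. c i \<le> m" "\<forall>i. d i \<le> m"
  shows "mirror m c \<sqsubset> mirror m d \<longleftrightarrow> d \<sqsubset> c"
proof -
  have "(m - c i < m - d i \<longleftrightarrow> d i < c i) \<and> (m - c i = m - d i \<longleftrightarrow> d i = c i)" for i
    using assms[rule_format, of i] by linarith
  then show ?thesis by (simp add: less_fun_def)
qed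

lemma mirror_le_iff:
  assumes "\<forall>i. c i \<le> m" "\<forall>i. d i \<le> m"
  shows "mirror m c \<sqsubseteq> mirror m d \<longleftrightarrow> d \<sqsubseteq> c"
  using mirror_less_iff[OF assms(2,1)] by (simp flip: lex.not_less)

lemma mirror_less_swap:
  assumes "\<forall>i. c i \<le> m" "\<forall>i. d i \<le> m"
  shows "mirror m c \<sqsubset> d \<longleftrightarrow> mirror m d \<sqsubset> c"
  using mirror_less_iff[of c m "mirror m d"] assms by simp

lemma mirror_le_swap:
  assumes "\<forall>i. c i \<le> m" "\<forall>i. d i \<le> m"
  shows "mirror m c \<sqsubseteq> d \<longleftrightarrow> mirror m d \<sqsubseteq> c"
  using mirror_le_iff[of c m "mirror m d"] assms by simp

text \<open>Cancels a common prefix; comparisons that survive a cut are reduced in this way to the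
  continuation after it.\<close>

lemma lex_less_shift_iff:
  assumes "\<And>j. j < n \<Longrightarrow> (a :: nat \<Rightarrow> nat) j = b j"
  shows "a \<sqsubset> b \<longleftrightarrow> shift n a \<sqsubset> shift n b"
proof
  assume "a \<sqsubset> b"
  then obtain i where i: "a i < b i" "\<forall>j<i. a j = b j" by (rule lex_lessE)
  have "n \<le> i" using assms i by (metis less_irrefl not_le)
  then show "shift n a \<sqsubset> shift n b"
    by (intro lex_lessI[of _ "i - n"]) (use i in auto)
next
  assume "shift n a \<sqsubset> shift n b"
  then obtain i where i: "a (n + i) < b (n + i)" "\<forall>j<i. a (n + j) = b (n + j)"
    by (auto elim: lex_lessE)
  show "a \<sqsubset> b"
  proof (rule lex_lessI[of _ "n + i"])
    fix j assume "j < n + i"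
    then show "a j = b j"
      using assms i(2)[rule_format, of "j - n"] by (cases "j < n") auto
  qed (use i in simp)
qed

lemma lex_le_shift_iff:
  assumes "\<And>j. j < n \<Longrightarrow> (a :: nat \<Rightarrow> nat) j = b j"
  shows "a \<sqsubseteq> b \<longleftrightarrow> shift n a \<sqsubseteq> shift n b"
  using lex_less_shift_iff[of n b a] assms by (simp flip: lex.not_less)

lemma eq_iff_shift:
  assumes "\<And>j. j < n \<Longrightarrow> (a :: nat \<Rightarrow> nat) j = b j"
  shows "a = b \<longleftrightarrow> shift n a = shift n b"
  using lex_le_shift_iff[of n a b] lex_le_shift_iff[of n b a] assms
  by (metis lex.dual_order.eq_iff)

lemma shift_join: "shift n (join n c d) = d"
  by (auto simp: join_def)

lemma shift_join_ge: "shift (n + k) (join n c d) = shift k d"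
  by (auto simp: join_def fun_eq_iff)

lemma join_apply_less [simp]: "i < n \<Longrightarrow> join n c d i = c i"
  by (simp add: join_def)

lemma cycle_apply_less [simp]: "i < p \<Longrightarrow> cycle p c i = c i"
  by (simp add: cycle_def)

lemma shift_cycle: "shift p (cycle p c) = cycle p c"
  by (simp add: cycle_def fun_eq_iff)

lemma shift_mult_period: "shift p c = c \<Longrightarrow> shift (p * k) c = c"
proof (induction k)
  case (Suc k)
  have "shift (p * Suc k) c = shift (p * k) (shift p c)" by (simp add: add.commute)
  then show ?case using Suc by simp
qed simp

lemma shift_mod_period: "shift p c = c \<Longrightarrow> shift k c = shift (k mod p) c"
proof -
  assume p: "shift p c = c"
  have "shift k c = shift (k mod p) (shift (p * (k div p)) c)" by simp
  then show ?thesis using shift_mult_period[OF p] by simp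
qed

text \<open>Every base \<open>q > 1\<close> corresponds to exactly one such sequence, namely \<open>\<alpha>(q)\<close>.\<close>

definition admissible :: "(nat \<Rightarrow> nat) \<Rightarrow> bool" where
  "admissible a \<longleftrightarrow> infinite_seq a \<and> (\<forall>k. shift k a \<sqsubseteq> a)"

text \<open>Quantifies over \<open>k = 0\<close> as well, unlike \<open>bases_V\<close>;
  \<open>V_seqI\<close> bridges the two.\<close>

definition V_seq :: "(nat \<Rightarrow> nat) \<Rightarrow> bool" where
  "V_seq a \<longleftrightarrow> admissible a \<and> (\<forall>k. mirror (a 0) (shift k a) \<sqsubseteq> a)"

lemma le_first_digit: "shift k c \<sqsubseteq> (a :: nat \<Rightarrow> nat) \<Longrightarrow> c k \<le> a 0"
  unfolding lex_le_def less_fun_def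
  by (metis add.right_neutral gr0I less_imp_le order_refl shift_apply)

lemma less_first_digit: "shift k c \<sqsubset> (a :: nat \<Rightarrow> nat) \<Longrightarrow> c k \<le> a 0"
  unfolding less_fun_def
  by (metis add.right_neutral gr0I less_imp_le order_refl shift_apply)

lemma admissible_le_first: "admissible a \<Longrightarrow> a i \<le> a 0"
  using le_first_digit by (simp add: admissible_def)

lemma admissible_shift_le: "admissible a \<Longrightarrow> shift k a \<sqsubseteq> a"
  by (simp add: admissible_def)

lemma infinite_seqE:
  assumes "infinite_seq a"
  obtains i where "i \<ge> n" "a i > 0"
  using assms unfolding infinite_seq_def
  by (metis (mono_tags, lifting) finite_nat_set_iff_bounded_le mem_Collect_eq nat_le_linear not_gr0)

lemma admissible_first_pos: "admissible a \<Longrightarrow> a 0 > 0"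
  by (metis admissible_def admissible_le_first infinite_seqE not_gr0 le_zero_eq)

lemma infinite_seqI:
  assumes "\<And>n. \<exists>i\<ge>n. a i > 0"
  shows "infinite_seq a"
  using assms unfolding infinite_seq_def
  by (metis (mono_tags, lifting) finite_nat_set_iff_bounded linorder_not_less mem_Collect_eq not_gr0)

lemma infinite_seq_period:
  assumes "shift p a = a" "p \<ge> 1" "a i > 0"
  shows "infinite_seq a"
proof (rule infinite_seqI)
  fix n
  have "shift (p * n) a i = a i" using shift_mult_period[OF assms(1)] by simp
  moreover have "p * n + i \<ge> n" using assms(2) by (simp add: trans_le_add1)
  ultimately show "\<exists>i\<ge>n. a i > 0" using assms(3) by (metis shift_apply)
qed

text \<open>Every tail of \<open>x\<close> starting in \<open>{K..n}\<close> is seen to be below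
  \<open>a\<close> by the digits up to position \<open>n\<close>. Raising the digit of
  \<open>x\<close> at \<open>n\<close> by one then costs at most the strictness of the comparisons
  decided at \<open>n\<close> itself.\<close>

definition dominated :: "nat \<Rightarrow> (nat \<Rightarrow> nat) \<Rightarrow> (nat \<Rightarrow> nat) \<Rightarrow> nat \<Rightarrow> bool" where
  "dominated K x a n \<longleftrightarrow>
     (\<forall>k\<ge>K. k \<le> n \<longrightarrow> (\<exists>i. k + i \<le> n \<and> x (k + i) < a i \<and> (\<forall>j<i. x (k + j) = a j)))"

text \<open>If \<open>n\<close> fails, take the least start \<open>k\<close> of a match with a prefix of \<open>a\<close> and the first position
  where that match breaks; a match starting later cannot survive this position, because
  the tails of \<open>a\<close> do not exceed \<open>a\<close>.\<close>

lemma dominated_frequently: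
  assumes a: "\<And>k. shift k a \<sqsubseteq> a" and x: "\<And>k. k \<ge> K \<Longrightarrow> shift k x \<sqsubset> a"
  shows "\<exists>n\<ge>N. dominated K x a n"
proof -
  define n0 where "n0 = max N K"
  define ok where "ok = (\<lambda>k n. \<exists>i. k + i \<le> n \<and> x (k + i) < a i \<and> (\<forall>j<i. x (k + j) = a j))"
  show ?thesis
  proof (cases "dominated K x a n0")
    case True
    then show ?thesis unfolding n0_def by (meson max.cobounded1)
  next
    case False
    then have ex: "\<exists>k. K \<le> k \<and> k \<le> n0 \<and> \<not> ok k n0" unfolding dominated_def ok_def by blast
    define k where "k = (LEAST k. K \<le> k \<and> k \<le> n0 \<and> \<not> ok k n0)"
    have k: "K \<le> k" "k \<le> n0" "\<not> ok k n0" using LeastI_ex[OF ex] unfolding k_def by auto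
    have min: "ok k' n0" if "K \<le> k'" "k' < k" for k'
      using that k not_less_Least[of k' "\<lambda>k. K \<le> k \<and> k \<le> n0 \<and> \<not> ok k n0"]
      unfolding k_def[symmetric] by auto
    obtain i where i: "x (k + i) < a i" "\<forall>j<i. x (k + j) = a j"
      using x[OF k(1)] by (auto elim!: lex_lessE)
    define n where "n = k + i"
    have n: "n > n0" using k(3) i unfolding ok_def n_def by (metis not_le)
    have "ok k' n" if k': "K \<le> k'" "k' \<le> n" for k'
    proof (cases k' k rule: linorder_cases)
      case less
      then show ?thesis using min[OF k'(1)] n unfolding ok_def by (meson le_trans less_imp_le)
    next
      case equal
      then show ?thesis using i unfolding ok_def n_def by blast
    next
      case greater
      obtain i' where i': "x (k' + i') < a i'" "\<forall>j<i'. x (k' + j) = a j"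
        using x[OF k'(1)] by (auto elim!: lex_lessE)
      show ?thesis
      proof (cases "k' + i' \<le> n")
        case True
        then show ?thesis unfolding ok_def using i' by blast
      next
        case False
        define d where "d = k' - k"
        have d: "k' = k + d" "d \<le> i" "d > 0" using greater k'(2) by (auto simp: d_def n_def)
        have "i - d < i'" using False d by (auto simp: n_def)
        then have "a (i - d) = x (k + i)" using i'(2)[rule_format, of "i - d"] d by simp
        then have lt: "a (i - d) < a (d + (i - d))" using i d by simp
        have "a j = a (d + j)" if "j < i - d" for j
          using i'(2)[rule_format, of j] i(2)[rule_format, of "d + j"] that d \<open>i - d < i'\<close> by (simp add: add.assoc)
        with lt have "a \<sqsubset> shift d a" by (intro lex_lessI[of _ "i - d"]) auto
        then show ?thesis using a lex.not_less by blast
      qed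
    qed
    then have "dominated K x a n" unfolding dominated_def ok_def by blast
    moreover have "n \<ge> N" using n unfolding n0_def by simp
    ultimately show ?thesis by blast
  qed
qed

section \<open>Expansions and the quasi-greedy map\<close>

definition val :: "real \<Rightarrow> (nat \<Rightarrow> nat) \<Rightarrow> real" where
  "val q c = (\<Sum>i. real (c i) / q ^ Suc i)"

text \<open>For \<open>q > 1\<close> this is the largest integer strictly below \<open>q\<close>,
  hence \<open>q - 1\<close> at an integer base.\<close>

definition top_digit :: "real \<Rightarrow> nat" where
  "top_digit q = nat \<lceil>q\<rceil> - 1"

lemma geometric_div_sums:
  fixes q x :: real
  assumes "1 < q"
  shows "(\<lambda>i. x / q ^ Suc i) sums (x / (q - 1))"
proof -
  have "(\<lambda>i. x / q * (1 / q) ^ i) sums (x / q * (1 / (1 - 1 / q)))"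
    by (intro sums_mult geometric_sums) (use assms in simp)
  moreover have "x / q * (1 / (1 - 1 / q)) = x / (q - 1)"
    using assms by (simp add: divide_simps)
  moreover have "(\<lambda>i. x / q * (1 / q) ^ i) = (\<lambda>i. x / q ^ Suc i)"
    by (simp add: power_divide)
  ultimately show ?thesis by (simp only:)
qed

lemma summable_val:
  assumes "1 < q" "\<forall>i. c i \<le> m"
  shows "summable (\<lambda>i. real (c i) / q ^ Suc i)"
proof (rule summable_comparison_test')
  show "summable (\<lambda>i. real m / q ^ Suc i)"
    using geometric_div_sums[OF assms(1)] by (rule sums_summable)
  show "norm (real (c i) / q ^ Suc i) \<le> real m / q ^ Suc i" if "i \<ge> 0" for i
    using assms by (simp add: divide_right_mono)
qed

lemma val_sums:
  assumes "1 < q" "\<forall>i. c i \<le> m"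
  shows "(\<lambda>i. real (c i) / q ^ Suc i) sums val q c"
  unfolding val_def using summable_val[OF assms] by (rule summable_sums)

lemma val_nonneg:
  assumes "1 < q" "\<forall>i. c i \<le> m"
  shows "0 \<le> val q c"
  unfolding val_def using summable_val[OF assms] assms(1) by (intro suminf_nonneg) auto

lemma val_le:
  assumes "1 < q" "\<forall>i. c i \<le> m"
  shows "val q c \<le> real m / (q - 1)"
  by (rule sums_le[OF _ val_sums[OF assms] geometric_div_sums[OF assms(1)]])
    (use assms in \<open>simp add: divide_right_mono\<close>)

lemma val_split:
  assumes "1 < q" "\<forall>i. c i \<le> m"
  shows "val q c = (\<Sum>i<n. real (c i) / q ^ Suc i) + val q (shift n c) / q ^ n"
proof -
  have s: "summable (\<lambda>i. real (shift n c i) / q ^ Suc i)"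
    using assms by (intro summable_val[of q _ m]) auto
  have "val q c = (\<Sum>i. real (c (i + n)) / q ^ Suc (i + n)) + (\<Sum>i<n. real (c i) / q ^ Suc i)"
    unfolding val_def by (rule suminf_split_initial_segment[OF summable_val[OF assms]])
  also have "(\<Sum>i. real (c (i + n)) / q ^ Suc (i + n)) = (\<Sum>i. real (shift n c i) / q ^ Suc i / q ^ n)"
    by (simp add: power_add add.commute mult.assoc)
  also have "\<dots> = val q (shift n c) / q ^ n"
    unfolding val_def by (rule suminf_divide[OF s])
  finally show ?thesis by simp
qed

lemma val_shift_Suc:
  assumes "1 < q" "\<forall>i. c i \<le> m"
  shows "val q (shift (Suc n) c) = q * val q (shift n c) - real (c n)"
proof -
  have "val q (shift n c) = real (c n) / q + val q (shift (Suc n) c) / q"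
    using val_split[of q "shift n c" m 1] assms by simp
  then show ?thesis using assms(1) by (simp add: field_simps)
qed

lemma val_agree:
  assumes "1 < q" "\<forall>i. c i \<le> m" "\<forall>i. d i \<le> m" "\<And>j. j < n \<Longrightarrow> c j = d j"
  shows "val q c - val q d = (val q (shift n c) - val q (shift n d)) / q ^ n"
  using val_split[OF assms(1,2), of n] val_split[OF assms(1,3), of n] assms(4)
  by (simp add: diff_divide_distrib)

lemma val_agree_abs_le:
  assumes "1 < q" "\<forall>i. c i \<le> m" "\<forall>i. d i \<le> m" "\<And>j. j < n \<Longrightarrow> c j = d j"
  shows "\<bar>val q c - val q d\<bar> \<le> real m / (q - 1) / q ^ n"
proof -
  have "\<bar>val q (shift n c) - val q (shift n d)\<bar> \<le> real m / (q - 1)"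
    using val_nonneg[of q "shift n c" m] val_le[of q "shift n c" m]
      val_nonneg[of q "shift n d" m] val_le[of q "shift n d" m] assms by auto
  then have "\<bar>val q (shift n c) - val q (shift n d)\<bar> / q ^ n \<le> real m / (q - 1) / q ^ n"
    using assms(1) by (intro divide_right_mono) auto
  moreover have "\<bar>val q c - val q d\<bar> = \<bar>val q (shift n c) - val q (shift n d)\<bar> / q ^ n"
    using val_agree[OF assms(1-3), of n] assms(1,4) by simp
  ultimately show ?thesis by linarith
qed

text \<open>After scaling, only the digit gap and the values of the two remaining tails are left, so
  comparing values means weighing at least one unit against a difference of tail values.\<close>

lemma val_first_diff:
  assumes "1 < q" "\<forall>i. c i \<le> m" "\<forall>i. d i \<le> m" "\<And>j. j < n \<Longrightarrow> c j = d j"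
  shows "(val q c - val q d) * q ^ Suc n =
    real (c n) - real (d n) + val q (shift (Suc n) c) - val q (shift (Suc n) d)"
proof -
  have "(val q c - val q d) * q ^ n = val q (shift n c) - val q (shift n d)"
    using val_agree[OF assms(1-3), of n] assms(1,4) by simp
  then have "(val q c - val q d) * q ^ Suc n = q * (val q (shift n c) - val q (shift n d))"
    by (simp add: mult.commute mult.left_commute)
  then show ?thesis
    using val_shift_Suc[OF assms(1,2), of n] val_shift_Suc[OF assms(1,3), of n]
    by (simp add: right_diff_distrib)
qed

lemma val_less_first_diff:
  assumes "1 < q" "\<forall>i. c i \<le> m" "\<forall>i. d i \<le> m" "\<forall>j<n. c j = d j" "c n < d n"
    "val q (shift (Suc n) c) < 1 + val q (shift (Suc n) d)"
  shows "val q c < val q d"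
proof -
  have "real (c n) + 1 \<le> real (d n)" using assms(5) by linarith
  then have "(val q c - val q d) * q ^ Suc n < 0"
    using val_first_diff[OF assms(1-3), of n] assms(4,6) by simp
  then show ?thesis using assms(1) by (simp add: mult_less_0_iff)
qed

lemma val_le_first_diff:
  assumes "1 < q" "\<forall>i. c i \<le> m" "\<forall>i. d i \<le> m" "\<forall>j<n. c j = d j" "c n < d n"
    "val q (shift (Suc n) c) \<le> 1 + val q (shift (Suc n) d)"
  shows "val q c \<le> val q d"
proof -
  have "real (c n) + 1 \<le> real (d n)" using assms(5) by linarith
  then have "(val q c - val q d) * q ^ Suc n \<le> 0"
    using val_first_diff[OF assms(1-3), of n] assms(4,6) by simp
  moreover have "0 < q ^ Suc n" using assms(1) by simp
  ultimately show ?thesis by (metis diff_le_0_iff_le linorder_not_less mult_pos_pos diff_gt_0_iff_gt)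
qed

lemma val_pos:
  assumes "1 < q" "\<forall>i. c i \<le> m" "c i > 0"
  shows "0 < val q c"
  unfolding val_def
  by (rule suminf_pos2[OF summable_val[OF assms(1,2)], of i]) (use assms in auto)

lemma val_eq_0: "(\<And>i. c i = 0) \<Longrightarrow> val q c = 0"
  by (simp add: val_def)

lemma val_mirror:
  assumes "1 < q" "\<forall>i. c i \<le> m"
  shows "val q (mirror m c) = real m / (q - 1) - val q c"
proof -
  have "(\<lambda>i. real m / q ^ Suc i - real (c i) / q ^ Suc i) sums (real m / (q - 1) - val q c)"
    by (intro sums_diff geometric_div_sums[OF assms(1)] val_sums[OF assms])
  moreover have "(\<lambda>i. real m / q ^ Suc i - real (c i) / q ^ Suc i) =
      (\<lambda>i. real (mirror m c i) / q ^ Suc i)"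
    using assms(2) by (simp add: of_nat_diff diff_divide_distrib)
  ultimately have "(\<lambda>i. real (mirror m c i) / q ^ Suc i) sums (real m / (q - 1) - val q c)"
    by (simp only:)
  then show ?thesis unfolding val_def[of q "mirror m c"] by (rule sums_unique[symmetric])
qed

section \<open>Expansions produced by remainder maps\<close>

lemma digit_iff:
  assumes "1 < q"
  shows "real n < q \<longleftrightarrow> n \<le> top_digit q"
  unfolding top_digit_def using assms by linarith

lemma top_digit_bounds:
  assumes "1 < q"
  shows "real (top_digit q) < q" "q \<le> real (top_digit q) + 1" "1 \<le> top_digit q"
  unfolding top_digit_def using assms by linarith+

lemma top_digit_eqI: "real m < q \<Longrightarrow> q \<le> real m + 1 \<Longrightarrow> top_digit q = m"
  unfolding top_digit_def by linarith

lemma expansion_iff: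
  assumes "1 < q"
  shows "expansion q x c \<longleftrightarrow> (\<forall>i. c i \<le> top_digit q) \<and> val q c = x"
proof -
  have "(\<lambda>i. real (c i) / q ^ Suc i) sums x \<longleftrightarrow> val q c = x" if "\<forall>i. c i \<le> top_digit q"
    using val_sums[OF assms that] sums_unique2 by blast
  then show ?thesis unfolding expansion_def digit_iff[OF assms] by blast
qed

text \<open>Iterates \<open>y \<mapsto> q * y - d\<close> with a digit \<open>d\<close> that keeps
  the remainder in \<open>I\<close>. Bounded remainders vanish after division by
  \<open>q ^ n\<close>, so they are the values of the tails. The choice of \<open>I\<close> selects
  the algorithm: a closed interval for arbitrary expansions, \<open>{0<..1}\<close> for the
  quasi-greedy one.\<close>

lemma digit_expansion:
  assumes q: "1 < q" and I: "\<And>y. y \<in> I \<Longrightarrow> 0 \<le> y \<and> y \<le> B"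
    and step: "\<And>y. y \<in> I \<Longrightarrow> \<exists>d\<le>m. q * y - real d \<in> I" and y: "y \<in> I"
  shows "\<exists>c. (\<forall>i. c i \<le> m) \<and> (\<forall>n. val q (shift n c) \<in> I) \<and> val q c = y"
proof -
  obtain d where d: "\<And>y. y \<in> I \<Longrightarrow> d y \<le> m \<and> q * y - real (d y) \<in> I"
    using step by metis
  define r where "r = rec_nat y (\<lambda>_ r. q * r - real (d r))"
  have r0: "r 0 = y" and rS: "r (Suc n) = q * r n - real (d (r n))" for n
    by (simp_all add: r_def)
  have rI: "r n \<in> I" for n by (induction n) (use y d r0 rS in auto)
  define c where "c = (\<lambda>n. d (r n))"
  have c: "\<forall>i. c i \<le> m" using d rI by (simp add: c_def)
  have partial: "r k = (\<Sum>i<n. real (shift k c i) / q ^ Suc i) + r (k + n) / q ^ n" for k n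
  proof (induction n)
    case (Suc n)
    have "r (k + n) / q ^ n = real (c (k + n)) / q ^ Suc n + r (k + Suc n) / q ^ Suc n"
      using q by (simp add: rS c_def field_simps)
    then show ?case using Suc by simp
  qed simp
  have lim: "(\<lambda>n. r (k + n) / q ^ n) \<longlonglongrightarrow> 0" for k
  proof (rule Lim_null_comparison)
    show "\<forall>\<^sub>F n in sequentially. norm (r (k + n) / q ^ n) \<le> B * (1 / q) ^ n"
      using I[OF rI] q by (intro always_eventually) (simp add: power_divide divide_right_mono)
    show "(\<lambda>n. B * (1 / q) ^ n) \<longlonglongrightarrow> 0"
      using q by (intro tendsto_mult_right_zero LIMSEQ_realpow_zero) auto
  qed
  have "(\<lambda>i. real (shift k c i) / q ^ Suc i) sums r k" for k
  proof -
    have "(\<lambda>n. r k - r (k + n) / q ^ n) \<longlonglongrightarrow> r k - 0"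
      by (intro tendsto_diff lim tendsto_const)
    moreover have "(\<Sum>i<n. real (shift k c i) / q ^ Suc i) = r k - r (k + n) / q ^ n" for n
      using partial[of k n] by linarith
    ultimately show ?thesis unfolding sums_def by simp
  qed
  then have "val q (shift k c) = r k" for k
    unfolding val_def by (rule sums_unique[symmetric])
  with rI c r0 show ?thesis by (metis shift_0)
qed

lemma exists_expansion:
  assumes q: "1 < q" "q \<le> real m + 1" and y: "0 \<le> y" "y \<le> real m / (q - 1)"
  shows "\<exists>c. (\<forall>i. c i \<le> m) \<and> val q c = y"
proof -
  have m: "1 \<le> real m / (q - 1)" using q by (simp add: field_simps)
  \<comment> \<open>Take the integer part of \<open>q * y\<close> if it is a digit; the remainder is
    then below \<open>1\<close>, hence within the bound. Otherwise take \<open>m\<close>: the bound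
    \<open>m / (q - 1)\<close> is the fixed point of \<open>y \<mapsto> q * y - m\<close>.\<close>
  have "\<exists>d\<le>m. q * y - real d \<in> {0..real m / (q - 1)}" if "y \<in> {0..real m / (q - 1)}" for y
  proof (cases "q * y \<le> real m")
    case True
    have "0 \<le> q * y" using that q by simp
    then have "real (nat \<lfloor>q * y\<rfloor>) \<le> q * y" "q * y - real (nat \<lfloor>q * y\<rfloor>) < 1" by linarith+
    moreover have "nat \<lfloor>q * y\<rfloor> \<le> m" using True by linarith
    ultimately show ?thesis using m by (intro exI[of _ "nat \<lfloor>q * y\<rfloor>"]) auto
  next
    case False
    have "q * y \<le> q * (real m / (q - 1))" using that q by (intro mult_left_mono) auto
    also have "\<dots> = real m + real m / (q - 1)" using q by (simp add: field_simps)
    finally show ?thesis using False by (intro exI[of _ m]) auto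
  qed
  then show ?thesis
    using digit_expansion[of q "{0..real m / (q - 1)}" "real m / (q - 1)" m y] q y by auto
qed

section \<open>Order, values and the quasi-greedy sequence\<close>

text \<open>Let \<open>S\<close> be the supremum of all tail values. A tail that leaves
  \<open>a\<close> downwards loses a whole digit against a further tail worth at most
  \<open>S\<close>, so if \<open>S > 1\<close> its value is at most \<open>1 + (S - 1) / q\<close>,
  which is less than \<open>S\<close>.\<close>

lemma val_shifts_le:
  assumes q: "1 < q" and c: "\<forall>i. c i \<le> m" and a: "\<forall>i. a i \<le> m" "val q a = 1"
    and le: "\<And>k. shift k c \<sqsubseteq> a"
  shows "val q c \<le> 1"
proof -
  have bdd: "bdd_above (range (\<lambda>k. val q (shift k c)))"
    by (rule bdd_aboveI2[of _ _ "real m / (q - 1)"]) (use val_le[OF q] c in auto)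
  define S where "S = (SUP k. val q (shift k c))"
  have leS: "val q (shift k c) \<le> S" for k
    unfolding S_def by (rule cSUP_upper[OF _ bdd]) simp
  have "S \<le> 1"
  proof (rule ccontr)
    assume "\<not> S \<le> 1"
    then have S: "S > 1" by simp
    have "val q (shift k c) \<le> 1 + (S - 1) / q" for k
    proof (cases "shift k c = a")
      case True
      then show ?thesis using a S q by simp
    next
      case False
      with le[of k] have "shift k c \<sqsubset> a" by (simp add: lex.le_less)
      then obtain i where i: "shift k c i < a i" "\<forall>j<i. shift k c j = a j" by (rule lex_lessE)
      have ge: "0 \<le> val q (shift (Suc i) a)" using a q by (intro val_nonneg) auto
      have "(val q (shift k c) - val q a) * q ^ Suc i \<le> S - 1"
        using val_first_diff[OF q _ a(1), of "shift k c" i] c i ge leS[of "k + Suc i"] by simp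
      then have "val q (shift k c) - val q a \<le> (S - 1) / q ^ Suc i"
        using q by (simp add: field_simps)
      also have "\<dots> \<le> (S - 1) / q ^ 1"
        using S q by (intro divide_left_mono power_increasing) auto
      finally show ?thesis using a by simp
    qed
    then have "S \<le> 1 + (S - 1) / q" unfolding S_def by (intro cSUP_least) auto
    then have "(S - 1) * q \<le> S - 1" using q by (simp add: field_simps)
    then show False using S q by (simp add: mult_le_cancel_left1)
  qed
  then show ?thesis using leS[of 0] by simp
qed

text \<open>At the first deviation a whole digit is lost against a tail worth at most one, while
  \<open>a\<close> still has a nonzero digit to come.\<close>

lemma val_shifts_less:
  assumes q: "1 < q" and c: "\<forall>i. c i \<le> m" and a: "\<forall>i. a i \<le> m" "val q a = 1" "infinite_seq a"
    and le: "\<And>k. shift k c \<sqsubseteq> a" and less: "c \<sqsubset> a"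
  shows "val q c < 1"
proof -
  obtain i where i: "c i < a i" "\<forall>j<i. c j = a j" using less by (rule lex_lessE)
  obtain j where "j \<ge> Suc i" "a j > 0" using a(3) by (rule infinite_seqE)
  then have "0 < val q (shift (Suc i) a)"
    using a q by (intro val_pos[of q _ m "j - Suc i"]) auto
  moreover have "val q (shift (Suc i) c) \<le> 1"
    using val_shifts_le[OF q _ a(1,2), of "shift (Suc i) c"] c le by simp
  ultimately show ?thesis using val_less_first_diff[OF q c a(1) i(2,1)] a by simp
qed

text \<open>An infinite expansion above \<open>a\<close> would gain a digit and keep a positive
  tail, while the tail of \<open>a\<close> given up is worth at most one; its value would exceed
  \<open>1\<close>.\<close>

lemma quasi_greedyI:
  assumes q: "1 < q" and a: "\<And>i. real (a i) < q" "val q a = 1"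
    and tails: "\<And>n. 0 < val q (shift n a)" "\<And>n. val q (shift n a) \<le> 1"
  shows "quasi_greedy q = a"
proof -
  have da: "\<forall>i. a i \<le> top_digit q" using a digit_iff[OF q] by blast
  have inf: "infinite_seq a"
  proof (rule infinite_seqI)
    fix n
    show "\<exists>i\<ge>n. a i > 0"
      using tails(1)[of n] val_eq_0[of "shift n a" q] by (metis gr0I le_add1 less_irrefl shift_apply)
  qed
  have largest: "lex_le c a" if c: "expansion q 1 c" "infinite_seq c" for c
  proof (rule ccontr)
    assume "\<not> c \<sqsubseteq> a"
    then obtain i where i: "a i < c i" "\<forall>j<i. a j = c j" by (auto simp: lex.not_le elim: lex_lessE)
    have dc: "\<forall>i. c i \<le> top_digit q" and v: "val q c = 1" using c expansion_iff[OF q] by auto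
    obtain j where "j \<ge> Suc i" "c j > 0" using c(2) by (rule infinite_seqE)
    then have "0 < val q (shift (Suc i) c)"
      using dc q by (intro val_pos[of q _ "top_digit q" "j - Suc i"]) auto
    with val_less_first_diff[OF q da dc i(2,1)] tails(2)[of "Suc i"] v a show False by simp
  qed
  show ?thesis
    unfolding quasi_greedy_def
    by (rule the_equality) (use da a inf largest expansion_iff[OF q] in \<open>auto intro: lex.order.antisym\<close>)
qed

text \<open>The digit \<open>\<lceil>q * y\<rceil> - 1\<close> is the largest one leaving a positive
  remainder, and \<open>{0<..1}\<close> is invariant under this choice. Besides the tail bounds,
  this supplies the existence behind \<open>THE\<close>.\<close>

lemma quasi_greedy_tails:
  assumes q: "1 < q"
  shows "\<forall>i. quasi_greedy q i \<le> top_digit q" "val q (quasi_greedy q) = 1"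
    "0 < val q (shift n (quasi_greedy q))" "val q (shift n (quasi_greedy q)) \<le> 1"
proof -
  have step: "\<exists>d\<le>top_digit q. q * y - real d \<in> {0<..1}" if "y \<in> {0<..1}" for y
  proof -
    have qy: "0 < q * y" "q * y \<le> q" using that q by (auto simp: mult_le_cancel_left1)
    have "real (nat (\<lceil>q * y\<rceil> - 1)) < q * y" "q * y \<le> real (nat (\<lceil>q * y\<rceil> - 1)) + 1"
      using qy by linarith+
    then show ?thesis using qy digit_iff[OF q, of "nat (\<lceil>q * y\<rceil> - 1)"]
      by (intro exI[of _ "nat (\<lceil>q * y\<rceil> - 1)"]) auto
  qed
  obtain c where c: "\<forall>i. c i \<le> top_digit q" "\<forall>n. val q (shift n c) \<in> {0<..1}" "val q c = 1"
    using digit_expansion[of q "{0<..1}" 1 "top_digit q" 1] q step by auto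
  then have "quasi_greedy q = c" using q digit_iff[OF q] by (intro quasi_greedyI) auto
  then show "\<forall>i. quasi_greedy q i \<le> top_digit q" "val q (quasi_greedy q) = 1"
    "0 < val q (shift n (quasi_greedy q))" "val q (shift n (quasi_greedy q)) \<le> 1"
    using c by auto
qed

lemma quasi_greedy_0:
  assumes "1 < q"
  shows "quasi_greedy q 0 = top_digit q"
proof -
  let ?a = "quasi_greedy q"
  have "val q (shift (Suc 0) ?a) = q - real (?a 0)"
    using val_shift_Suc[OF assms quasi_greedy_tails(1)[OF assms], of 0] quasi_greedy_tails(2)[OF assms]
    by simp
  then show ?thesis
    using quasi_greedy_tails(3,4)[OF assms, of "Suc 0"] by (intro top_digit_eqI[symmetric]) auto
qed

lemma admissible_quasi_greedy:
  assumes q: "1 < q"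
  shows "admissible (quasi_greedy q)"
proof -
  let ?a = "quasi_greedy q" and ?m = "top_digit q"
  note a = quasi_greedy_tails[OF q]
  have inf: "infinite_seq ?a"
  proof (rule infinite_seqI)
    fix n
    show "\<exists>i\<ge>n. ?a i > 0"
      using a(3)[of n] val_eq_0[of "shift n ?a" q] by (metis gr0I le_add1 less_irrefl shift_apply)
  qed
  have "shift k ?a \<sqsubseteq> ?a" for k
  proof (rule ccontr)
    assume "\<not> shift k ?a \<sqsubseteq> ?a"
    then obtain i where i: "?a i < shift k ?a i" "\<forall>j<i. ?a j = shift k ?a j"
      by (auto simp: lex.not_le elim: lex_lessE)
    have "val q (shift (Suc i) ?a) < 1 + val q (shift (Suc i) (shift k ?a))"
      using a(3)[of "k + Suc i"] a(4)[of "Suc i"] by simp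
    then have "val q ?a < val q (shift k ?a)"
      using a(1) i by (intro val_less_first_diff[OF q a(1), of "shift k ?a" i]) auto
    then show False using a(2) a(4)[of k] by simp
  qed
  with inf show ?thesis by (simp add: admissible_def)
qed

text \<open>Otherwise all tails of \<open>\<alpha>(q)\<close> are at most
  \<open>\<alpha>(p)\<close>, so \<open>\<alpha>(q)\<close> has value at most \<open>1\<close> in
  base \<open>p\<close>; but passing from \<open>q\<close> to the smaller base \<open>p\<close>
  raises its value above \<open>1\<close>.\<close>

lemma quasi_greedy_strict_mono:
  assumes q: "1 < p" "p < q"
  shows "quasi_greedy p \<sqsubset> quasi_greedy q"
proof (rule ccontr)
  let ?a = "quasi_greedy p" and ?b = "quasi_greedy q"
  have q1: "1 < q" using q by simp
  assume "\<not> ?a \<sqsubset> ?b"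
  then have le: "?b \<sqsubseteq> ?a" by simp
  have shifts: "shift k ?b \<sqsubseteq> ?a" for k
    using admissible_shift_le[OF admissible_quasi_greedy[OF q1]] le by (rule lex.order_trans)
  note a = quasi_greedy_tails[OF q(1)] and b = quasi_greedy_tails[OF q1]
  define m where "m = max (top_digit p) (top_digit q)"
  have am: "\<forall>i. ?a i \<le> m" and bm: "\<forall>i. ?b i \<le> m"
    using a(1) b(1) by (auto simp: m_def le_max_iff_disj)
  have "val p ?b \<le> 1" by (rule val_shifts_le[OF q(1) bm am a(2) shifts])
  moreover have "val q ?b < val p ?b"
  proof -
    have le: "real (?b i) / q ^ Suc i \<le> real (?b i) / p ^ Suc i" for i
      using q by (intro divide_left_mono power_mono) auto
    obtain i where i: "?b i > 0"
      using admissible_first_pos[OF admissible_quasi_greedy[OF q1]] by blast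
    have "real (?b i) / q ^ Suc i < real (?b i) / p ^ Suc i"
      using q i by (intro divide_strict_left_mono power_strict_mono mult_pos_pos) auto
    then have "0 < (\<Sum>i. real (?b i) / p ^ Suc i - real (?b i) / q ^ Suc i)"
      using le by (intro suminf_pos2[of _ i] summable_diff summable_val[OF q1 bm] summable_val[OF q(1) bm]) auto
    then show ?thesis unfolding val_def
      using suminf_diff[OF summable_val[OF q(1) bm] summable_val[OF q1 bm]] by simp
  qed
  ultimately show False using b(2) by simp
qed

lemma quasi_greedy_less_iff:
  assumes "1 < p" "1 < q"
  shows "quasi_greedy p \<sqsubset> quasi_greedy q \<longleftrightarrow> p < q"
  using quasi_greedy_strict_mono[of p q] quasi_greedy_strict_mono[of q p] assms
  by (cases p q rule: linorder_cases) (auto dest: lex.less_asym)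

text \<open>With \<open>x = 1 / q\<close> the base is found by the intermediate value theorem for a
  power series. Then \<open>val_shifts_le\<close> bounds all tails, and \<open>quasi_greedyI\<close>
  applies.\<close>

lemma quasi_greedy_surj:
  assumes a: "admissible a"
  obtains q where "1 < q" "quasi_greedy q = a"
proof -
  have inf: "infinite_seq a" and am: "\<forall>i. a i \<le> a 0"
    using a admissible_le_first by (auto simp: admissible_def)
  have a0: "a 0 > 0" using a by (rule admissible_first_pos)
  obtain j where j: "j \<ge> 1" "a j > 0" using inf by (rule infinite_seqE)
  define f where "f = (\<lambda>x :: real. x * (\<Sum>n. real (a n) * x ^ n))"
  have sm: "summable (\<lambda>n. real (a n) * x ^ n)" if "0 \<le> x" "x < 1" for x :: real
  proof (rule summable_comparison_test')
    show "summable (\<lambda>n. real (a 0) * x ^ n)"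
      using that by (intro summable_mult summable_geometric) auto
    show "norm (real (a n) * x ^ n) \<le> real (a 0) * x ^ n" if "n \<ge> 0" for n
      using am \<open>0 \<le> x\<close> by (simp add: mult_right_mono)
  qed
  \<comment> \<open>Bernoulli's inequality gives \<open>x0 ^ (j + 1) \<ge> 1 / 2\<close>, so the
    nonzero digits at \<open>0\<close> and \<open>j\<close> alone contribute at least
    \<open>1\<close>.\<close>
  define x0 where "x0 = 1 - 1 / (2 * real (Suc j))"
  have x0: "0 < x0" "x0 < 1" using j by (auto simp: x0_def field_simps)
  have half: "1 / 2 \<le> x0 ^ Suc j"
  proof -
    have "1 + real (Suc j) * (- (1 / (2 * real (Suc j)))) \<le> (1 + - (1 / (2 * real (Suc j)))) ^ Suc j"
      by (rule Bernoulli_inequality) (simp add: field_simps)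
    moreover have "1 + - (1 / (2 * real (Suc j))) = x0" by (simp add: x0_def)
    moreover have "1 + real (Suc j) * (- (1 / (2 * real (Suc j)))) = 1 / 2" by (simp add: field_simps)
    ultimately show ?thesis by (simp only:)
  qed
  have "1 \<le> f x0"
  proof -
    have "x0 ^ j \<le> x0 ^ 0" using x0 by (intro power_decreasing) auto
    then have "1 / 2 \<le> x0 ^ Suc j \<and> x0 ^ Suc j \<le> x0" using half x0 by (simp add: mult_le_cancel_left1)
    have "(\<Sum>n\<in>{0, j}. real (a n) * x0 ^ n) \<le> (\<Sum>n. real (a n) * x0 ^ n)"
      using x0 by (intro sum_le_suminf sm) auto
    moreover have "real (a 0) \<ge> 1" "real (a j) * x0 ^ j \<ge> x0 ^ j"
      using a0 j x0 by (auto simp: mult_le_cancel_right1)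
    ultimately have "1 + x0 ^ j \<le> (\<Sum>n. real (a n) * x0 ^ n)" using j by simp
    then have "x0 * (1 + x0 ^ j) \<le> f x0" unfolding f_def using x0 by (intro mult_left_mono) auto
    moreover have "x0 * (1 + x0 ^ j) = x0 + x0 ^ Suc j" by (simp add: algebra_simps)
    ultimately show ?thesis using \<open>1 / 2 \<le> x0 ^ Suc j \<and> x0 ^ Suc j \<le> x0\<close> by linarith
  qed
  moreover have "isCont f x" if "0 \<le> x" "x \<le> x0" for x
  proof -
    have "x < (x0 + 1) / 2" "0 < (x0 + 1) / 2" "(x0 + 1) / 2 < 1" using that x0 by auto
    then show ?thesis unfolding f_def
      using that by (intro isCont_mult continuous_ident isCont_powser[OF sm[of "(x0 + 1) / 2"]]) auto
  qed
  ultimately obtain x where x: "0 \<le> x" "x \<le> x0" "f x = 1"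
    using IVT[of f 0 1 x0] x0 by (auto simp: f_def)
  have xpos: "0 < x" using x by (cases "x = 0") (auto simp: f_def)
  define q where "q = 1 / x"
  have q: "1 < q" using x xpos x0 by (simp add: q_def)
  have val1: "val q a = 1"
  proof -
    have "val q a = (\<Sum>n. x * (real (a n) * x ^ n))"
      unfolding val_def q_def by (simp add: power_divide mult.commute mult.left_commute)
    also have "\<dots> = f x" unfolding f_def using x x0 by (intro suminf_mult sm) auto
    finally show ?thesis using x by simp
  qed
  have pos: "0 < val q (shift n a)" for n
  proof -
    obtain i where "i \<ge> n" "a i > 0" using inf by (rule infinite_seqE)
    then show ?thesis using am q by (intro val_pos[of q _ "a 0" "i - n"]) auto
  qed
  have le1: "val q (shift n a) \<le> 1" for n
    by (rule val_shifts_le[OF q _ am val1]) (use am admissible_shift_le[OF a] in auto)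
  have "val q (shift (Suc 0) a) = q - real (a 0)"
    using val_shift_Suc[OF q am, of 0] val1 by simp
  then have "real (a 0) < q" using pos[of "Suc 0"] by simp
  then have "real (a i) < q" for i using am by (meson le_less_trans of_nat_mono)
  then have "quasi_greedy q = a" using val1 pos le1 q by (intro quasi_greedyI) auto
  with q that show ?thesis by blast
qed

section \<open>Lexicographic description of unique expansions\<close>

text \<open>A tail following the digit \<open>m\<close> arises from a tail below \<open>a\<close> by
  cancelling \<open>a 0 = m\<close>, so it is below a tail of \<open>a\<close>. The bound, imposed
  only after digits below \<open>m\<close>, thus propagates to every tail after the first such
  digit.\<close>

lemma active_less:
  assumes a: "shift (Suc 0) a \<sqsubseteq> a" and m: "a 0 \<le> m"
    and act: "\<And>k. c k < m \<Longrightarrow> shift (Suc k) c \<sqsubset> a"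
    and k: "c k0 < m" "k0 < k"
  shows "shift k c \<sqsubset> a"
  using k(2)
proof (induction k)
  case (Suc k)
  show ?case
  proof (cases "c k < m")
    case False
    then have "k \<noteq> k0" using k(1) by blast
    then have IH: "shift k c \<sqsubset> a" using Suc.IH Suc.prems by linarith
    then have "c k \<le> a 0" by (rule less_first_digit)
    then have "c k = a 0" using False m by simp
    then have "shift (Suc k) c \<sqsubset> shift (Suc 0) a"
      using lex_less_shift_iff[of "Suc 0" "shift k c" a] IH by simp
    then show ?thesis using a by (rule lex.less_le_trans)
  next
    case True
    then show ?thesis by (rule act)
  qed
qed simp

lemma active_le:
  assumes a: "shift (Suc 0) a \<sqsubseteq> a" and m: "a 0 \<le> m"
    and act: "\<And>k. c k < m \<Longrightarrow> shift (Suc k) c \<sqsubseteq> a"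
    and k: "c k0 < m" "k0 < k"
  shows "shift k c \<sqsubseteq> a"
  using k(2)
proof (induction k)
  case (Suc k)
  show ?case
  proof (cases "c k < m")
    case False
    then have "k \<noteq> k0" using k(1) by blast
    then have IH: "shift k c \<sqsubseteq> a" using Suc.IH Suc.prems by linarith
    then have "c k \<le> a 0" by (rule le_first_digit)
    then have "c k = a 0" using False m by simp
    then have "shift (Suc k) c \<sqsubseteq> shift (Suc 0) a"
      using lex_le_shift_iff[of "Suc 0" "shift k c" a] IH by simp
    then show ?thesis using a by (rule lex.order_trans)
  next
    case True
    then show ?thesis by (rule act)
  qed
qed simp

text \<open>The unique expansions of base \<open>q\<close>, with \<open>A = \<alpha>(q)\<close>.\<close>

definition univ_seq :: "(nat \<Rightarrow> nat) \<Rightarrow> (nat \<Rightarrow> nat) \<Rightarrow> bool" where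
  "univ_seq A c \<longleftrightarrow> (\<forall>i. c i \<le> A 0) \<and> (\<forall>k. c k < A 0 \<longrightarrow> shift (Suc k) c \<sqsubset> A) \<and>
     (\<forall>k. 0 < c k \<longrightarrow> mirror (A 0) (shift (Suc k) c) \<sqsubset> A)"

text \<open>At the first difference \<open>c\<close> has a digit below the maximum. This activates
  the bound on its next tail, which is then worth less than the digit gained by
  \<open>d\<close>.\<close>

lemma val_mono_greedy:
  assumes q: "1 < q" and A: "A = quasi_greedy q"
    and c: "\<forall>i. c i \<le> A 0" "\<And>k. c k < A 0 \<Longrightarrow> shift (Suc k) c \<sqsubset> A"
    and d: "\<forall>i. d i \<le> A 0" "c \<sqsubset> d"
  shows "val q c < val q d"
proof -
  have adm: "admissible A" using admissible_quasi_greedy[OF q] A by simp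
  note T = quasi_greedy_tails[OF q, folded A quasi_greedy_0[OF q]]
  obtain i where i: "c i < d i" "\<forall>j<i. c j = d j" using d(2) by (rule lex_lessE)
  have ci: "c i < A 0" using i(1) d(1) by (meson less_le_trans)
  have "shift k (shift (Suc i) c) \<sqsubseteq> A" for k
    using active_less[OF admissible_shift_le[OF adm] order_refl c(2) ci, of "Suc i + k"]
    by (simp add: lex.less_imp_le)
  then have "val q (shift (Suc i) c) < 1"
    using T(1,2) A adm c(1) c(2)[OF ci]
    by (intro val_shifts_less[OF q _ _ _ _ _ c(2)[OF ci]]) (auto simp: admissible_def)
  moreover have "0 \<le> val q (shift (Suc i) d)" using d q by (intro val_nonneg) auto
  ultimately show ?thesis using val_less_first_diff[OF q c(1) d(1) i(2,1)] by simp
qed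

lemma univ_seq_mirror: "univ_seq A c \<Longrightarrow> univ_seq A (mirror (A 0) c)"
  unfolding univ_seq_def by (auto simp: shift_mirror)

text \<open>A larger \<open>d\<close> has larger value by \<open>val_mono_greedy\<close>; a smaller
  one becomes larger under reflection, which preserves \<open>univ_seq\<close> and reverses
  values.\<close>

lemma univ_seq_inj:
  assumes q: "1 < q" and A: "A = quasi_greedy q" and c: "univ_seq A c"
    and d: "\<forall>i. d i \<le> A 0" "val q d = val q c"
  shows "d = c"
proof (rule ccontr)
  assume "d \<noteq> c"
  then consider "c \<sqsubset> d" | "d \<sqsubset> c" using lex_neq_cases by blast
  then show False
  proof cases
    case 1
    then have "val q c < val q d"
      using c by (intro val_mono_greedy[OF q A _ _ d(1)]) (auto simp: univ_seq_def)
    then show False using d(2) by simp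
  next
    case 2
    have cA: "\<forall>i. c i \<le> A 0" using c by (simp add: univ_seq_def)
    have "mirror (A 0) c \<sqsubset> mirror (A 0) d" using 2 cA d(1) by (simp add: mirror_less_iff)
    then have "val q (mirror (A 0) c) < val q (mirror (A 0) d)"
      using univ_seq_mirror[OF c] by (intro val_mono_greedy[OF q A]) (auto simp: univ_seq_def)
    then show False using cA d val_mirror[OF q] by simp
  qed
qed

text \<open>A tail worth at least \<open>1\<close> could lend one unit to digit \<open>k\<close>,
  giving a second expansion. So its value is below \<open>1\<close>, which excludes \<open>A\<close>
  and every sequence above \<open>A\<close>.\<close>

lemma greedy_of_unique:
  assumes q: "1 < q" and A: "A = quasi_greedy q" and c: "\<forall>i. c i \<le> A 0"
    and uniq: "\<And>d. \<lbrakk>\<forall>i. d i \<le> A 0; val q d = val q c\<rbrakk> \<Longrightarrow> d = c" and k: "c k < A 0"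
  shows "shift (Suc k) c \<sqsubset> A"
proof -
  note T = quasi_greedy_tails[OF q, folded A quasi_greedy_0[OF q]]
  have TA: "\<forall>i. A i \<le> A 0" using T(1) A by simp
  have m: "q \<le> real (A 0) + 1" using top_digit_bounds[OF q] quasi_greedy_0[OF q] A by simp
  let ?s = "shift (Suc k) c"
  have lt: "val q ?s < 1"
  proof (rule ccontr)
    assume "\<not> val q ?s < 1"
    moreover have "val q ?s \<le> real (A 0) / (q - 1)" using c by (intro val_le q) auto
    ultimately obtain e where e: "\<forall>i. e i \<le> A 0" "val q e = val q ?s - 1"
      using exists_expansion[OF q m, of "val q ?s - 1"] by auto
    define d where "d = join (Suc k) (c(k := c k + 1)) e"
    have dA: "\<forall>i. d i \<le> A 0" using c e k by (auto simp: d_def join_def)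
    have "(val q d - val q c) * q ^ Suc k = 0"
      using val_first_diff[OF q dA c, of k] e by (simp add: d_def shift_join)
    then have "d = c" using q by (intro uniq dA) simp
    then have "d k = c k" by simp
    then show False by (simp add: d_def)
  qed
  show ?thesis
  proof (rule ccontr)
    assume n: "\<not> ?s \<sqsubset> A"
    have "?s \<noteq> A" using lt T(2) A by auto
    with n have "A \<sqsubset> ?s" using lex_neq_cases by blast
    then obtain i where i: "A i < ?s i" "\<forall>j<i. A j = ?s j" by (rule lex_lessE)
    have "val q (shift (Suc i) A) \<le> 1" using T(4) A by simp
    moreover have "0 \<le> val q (shift (Suc i) ?s)"
      using c q by (intro val_nonneg[of q _ "A 0"]) auto
    ultimately have "val q (shift (Suc i) A) \<le> 1 + val q (shift (Suc i) ?s)" by linarith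
    then have "val q A \<le> val q ?s"
      using c i by (intro val_le_first_diff[OF q TA, of ?s i]) auto
    then show False using lt T(2) A by simp
  qed
qed

lemma univ_seq_of_unique:
  assumes q: "1 < q" and A: "A = quasi_greedy q" and c: "\<forall>i. c i \<le> A 0"
    and uniq: "\<And>d. \<lbrakk>\<forall>i. d i \<le> A 0; val q d = val q c\<rbrakk> \<Longrightarrow> d = c"
  shows "univ_seq A c"
  unfolding univ_seq_def
proof (intro conjI allI impI)
  fix k
  show "c k \<le> A 0" using c by simp
  show "shift (Suc k) c \<sqsubset> A" if "c k < A 0" by (rule greedy_of_unique[OF q A c uniq that])
  have "shift (Suc k) (mirror (A 0) c) \<sqsubset> A" if "0 < c k"
  proof (rule greedy_of_unique[OF q A])
    fix d assume d: "\<forall>i. d i \<le> A 0" "val q d = val q (mirror (A 0) c)"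
    have "mirror (A 0) d = c" by (rule uniq) (use d c val_mirror[OF q] in auto)
    then show "d = mirror (A 0) c" using d by auto
  next
    show "mirror (A 0) c k < A 0" using that c[rule_format, of k] by simp
  qed (use c in auto)
  then show "mirror (A 0) (shift (Suc k) c) \<sqsubset> A" if "0 < c k" using that by (simp add: shift_mirror)
qed

lemma unique_expansion_iff:
  assumes q: "1 < q" and A: "A = quasi_greedy q" and c: "expansion q x c"
  shows "(\<exists>!c. expansion q x c) \<longleftrightarrow> univ_seq A c"
proof -
  have A0: "top_digit q = A 0" using quasi_greedy_0[OF q] A by simp
  note E = expansion_iff[OF q, unfolded A0]
  show ?thesis
  proof
    assume u: "\<exists>!c. expansion q x c"
    show "univ_seq A c"
      using u c unfolding E by (intro univ_seq_of_unique[OF q A]) auto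
  next
    assume "univ_seq A c"
    then show "\<exists>!c. expansion q x c"
      using univ_seq_inj[OF q A] c E by (intro ex1I[of _ c]) auto
  qed
qed

lemma univoque_set_eq:
  assumes q: "1 < q" and A: "A = quasi_greedy q"
  shows "univoque_set q = val q ` {c. univ_seq A c}"
proof -
  have A0: "top_digit q = A 0" using quasi_greedy_0[OF q] A by simp
  note E = expansion_iff[OF q, unfolded A0]
  have "x \<in> univoque_set q \<longleftrightarrow> (\<exists>c. expansion q x c \<and> univ_seq A c)" for x
    unfolding univoque_set_def using unique_expansion_iff[OF q A] by blast
  moreover have "x \<in> val q ` {c. univ_seq A c} \<longleftrightarrow> (\<exists>c. expansion q x c \<and> univ_seq A c)" for x
    unfolding E image_iff univ_seq_def by blast
  ultimately show ?thesis by blast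
qed

section \<open>Approximation of quasi-greedy sequences\<close>

text \<open>A digit below \<open>a 0\<close> makes the bound on later tails strict, and a periodic
  \<open>a\<close> violates it when it returns to itself. A constant \<open>a\<close> has no such
  digit, whence the first disjunct: the integer bases.\<close>

lemma univ_seq_self_iff:
  assumes a: "admissible a"
  shows "univ_seq a a \<longleftrightarrow> (\<forall>k\<ge>1. mirror (a 0) (shift k a) \<sqsubset> a) \<and>
    ((\<forall>i. a i = a 0) \<or> (\<forall>k\<ge>1. shift k a \<noteq> a))"
proof (intro iffI conjI allI impI)
  assume u: "univ_seq a a"
  note le = admissible_shift_le[OF a]
  show "mirror (a 0) (shift k a) \<sqsubset> a" if "k \<ge> 1" for k
    using active_less[of a "a 0" "mirror (a 0) a" 0 k] le[of "Suc 0"] u that admissible_first_pos[OF a]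
      admissible_le_first[OF a]
    by (simp add: univ_seq_def shift_mirror)
  show "(\<forall>i. a i = a 0) \<or> (\<forall>k\<ge>1. shift k a \<noteq> a)"
  proof (rule ccontr)
    assume "\<not> ((\<forall>i. a i = a 0) \<or> (\<forall>k\<ge>1. shift k a \<noteq> a))"
    then obtain i k where ik: "a i \<noteq> a 0" "k \<ge> 1" "shift k a = a" by blast
    have "a i < a 0" using ik admissible_le_first[OF a, of i] by simp
    \<comment> \<open>A multiple of the period past the digit \<open>a i < a 0\<close>; the tail
      there is \<open>a\<close> again.\<close>
    moreover have "i < k * Suc i" using ik(2) by (cases k) auto
    moreover have "shift (Suc k) a \<sqsubset> a" if "a k < a 0" for k
      using u that by (simp add: univ_seq_def)
    ultimately have "shift (k * Suc i) a \<sqsubset> a"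
      using active_less[OF le order_refl] by blast
    then show False using shift_mult_period[OF ik(3), of "Suc i"] by (metis lex.less_irrefl)
  qed
next
  assume *: "(\<forall>k\<ge>1. mirror (a 0) (shift k a) \<sqsubset> a) \<and> ((\<forall>i. a i = a 0) \<or> (\<forall>k\<ge>1. shift k a \<noteq> a))"
  show "univ_seq a a"
    unfolding univ_seq_def
  proof (intro conjI allI impI)
    fix k
    show "a k \<le> a 0" by (rule admissible_le_first[OF a])
    show "mirror (a 0) (shift (Suc k) a) \<sqsubset> a" using * by simp
    assume "a k < a 0"
    then have "shift (Suc k) a \<noteq> a" using * by (metis le_add1 less_irrefl plus_1_eq_Suc)
    then show "shift (Suc k) a \<sqsubset> a" using admissible_shift_le[OF a, of "Suc k"] by (simp add: lex.less_le)
  qed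
qed

lemma V_seqI:
  assumes a: "admissible a" and m: "\<And>k. k \<ge> 1 \<Longrightarrow> mirror (a 0) (shift k a) \<sqsubseteq> a"
  shows "V_seq a"
proof -
  have "mirror (a 0) a \<sqsubset> a"
    by (rule lex_lessI[of _ 0]) (use admissible_first_pos[OF a] in auto)
  then have "mirror (a 0) (shift k a) \<sqsubseteq> a" for k
    using m[of k] by (cases "k = 0") (auto simp: lex.less_imp_le)
  then show ?thesis using a by (simp add: V_seq_def)
qed

text \<open>Characterises the closure of \<open>bases_U\<close>, see \<open>closure_U_eq\<close>. In
  contrast to \<open>univ_seq a a\<close>, a non-constant \<open>a\<close> may be periodic
  here.\<close>

definition strict_seq :: "(nat \<Rightarrow> nat) \<Rightarrow> bool" where
  "strict_seq a \<longleftrightarrow> admissible a \<and> (\<forall>k. mirror (a 0) (shift k a) \<sqsubset> a)"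

lemma strict_seqI:
  assumes a: "admissible a" and m: "\<And>k. k \<ge> 1 \<Longrightarrow> mirror (a 0) (shift k a) \<sqsubset> a"
  shows "strict_seq a"
proof -
  have "mirror (a 0) a \<sqsubset> a"
    by (rule lex_lessI[of _ 0]) (use admissible_first_pos[OF a] in auto)
  then have "mirror (a 0) (shift k a) \<sqsubset> a" for k
    using m[of k] by (cases "k = 0") auto
  then show ?thesis using a by (simp add: strict_seq_def)
qed

lemma strict_imp_V: "strict_seq a \<Longrightarrow> V_seq a"
  by (simp add: strict_seq_def V_seq_def lex.less_imp_le)

lemma V_not_strict:
  assumes "V_seq a" "\<not> strict_seq a"
  obtains k where "k \<ge> 1" "mirror (a 0) (shift k a) = a"
proof -
  obtain k where "k \<ge> 1" "\<not> mirror (a 0) (shift k a) \<sqsubset> a"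
    using assms strict_seqI V_seq_def by blast
  then show ?thesis using that assms(1) unfolding V_seq_def by (metis lex.le_imp_less_or_eq)
qed

lemma univ_self_imp_strict: "admissible a \<Longrightarrow> univ_seq a a \<Longrightarrow> strict_seq a"
  using univ_seq_self_iff strict_seqI by blast

section \<open>Decremented words continued periodically\<close>

text \<open>The sequence \<open>(w\<^sup>-)\<^sup>\<infinity>\<close> for the word \<open>w\<close>
  of length \<open>n + 1\<close> at positions \<open>0\<close> to \<open>n\<close>.\<close>

definition lower :: "nat \<Rightarrow> (nat \<Rightarrow> nat) \<Rightarrow> nat \<Rightarrow> nat" where
  "lower n a = cycle (Suc n) (a(n := a n - 1))"

lemma lower_agree: "j < n \<Longrightarrow> lower n a j = a j"
  by (simp add: lower_def)

lemma lower_last: "lower n a n = a n - 1"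
  by (simp add: lower_def)

lemma lower_period: "shift (Suc n) (lower n a) = lower n a"
  unfolding lower_def by (rule shift_cycle)

lemma lower_add_period: "lower n a (Suc n + i) = lower n a i"
  using fun_cong[OF lower_period, of n a i] by simp

lemma lower_less: "a n > 0 \<Longrightarrow> lower n a \<sqsubset> a"
  by (rule lex_lessI[of _ n]) (simp_all add: lower_agree lower_last)

lemma lower_le_digit: "(\<And>i. a i \<le> m) \<Longrightarrow> lower n a i \<le> m"
  unfolding lower_def cycle_def by (auto intro: le_trans[OF diff_le_self])

text \<open>Let an exceeding tail start at \<open>r\<close> inside the block. If it exceeds before
  position \<open>n\<close>, the same happens in \<open>a\<close>; otherwise the undecremented digit
  \<open>a n\<close> makes the tail of \<open>a\<close> at \<open>r\<close> exceed there. Both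
  contradict admissibility.\<close>

lemma lower_shift_le:
  assumes a: "admissible a" "a n > 0"
  shows "shift k (lower n a) \<sqsubseteq> lower n a"
proof (rule ccontr)
  let ?b = "lower n a"
  define r where "r = k mod Suc n"
  assume "\<not> shift k ?b \<sqsubseteq> ?b"
  then have "?b \<sqsubset> shift r ?b"
    using shift_mod_period[OF lower_period[of n a], of k] by (simp add: r_def)
  then obtain i where i: "?b i < ?b (r + i)" "\<forall>j<i. ?b (r + j) = ?b j" by (rule shift_greaterE)
  have r: "0 < r" "r \<le> n" using i(1) by (auto simp: r_def intro: gr0I)
  have "\<exists>i. a i < a (r + i) \<and> (\<forall>j<i. a j = a (r + j))"
  proof (cases "r + i < n")
    case True
    then show ?thesis using i by (intro exI[of _ i]) (auto simp: lower_agree)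
  next
    case False
    have "a (n - r) < a (r + (n - r))"
    proof (cases "i = n - r")
      case True
      then show ?thesis using i(1) r a(2) by (auto simp: lower_agree lower_last)
    next
      case ne: False
      then have "?b (n - r) = ?b (r + (n - r))" using i(2) False by auto
      then show ?thesis using r a(2) by (auto simp: lower_agree lower_last)
    qed
    moreover have "a j = a (r + j)" if "j < n - r" for j
      using i(2)[rule_format, of j] that False r by (auto simp: lower_agree)
    ultimately show ?thesis by blast
  qed
  then have "a \<sqsubset> shift r a" by (auto intro: lex_lessI)
  then show False using admissible_shift_le[OF a(1), of r] by (simp flip: lex.not_less)
qed

lemma lower_admissible:
  assumes a: "admissible a" "a n > 0" and n: "n \<ge> 1 \<or> a 0 \<ge> 2"
  shows "admissible (lower n a)"
proof -
  have "lower n a 0 > 0"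
    using n admissible_first_pos[OF a(1)] lower_agree[of 0 n a] lower_last[of 0 a]
    by (cases "n = 0") auto
  then have "infinite_seq (lower n a)" using lower_period by (rule infinite_seq_period[rotated 2]) simp
  then show ?thesis using lower_shift_le[OF a] by (simp add: admissible_def)
qed

lemma dominated_last_pos:
  assumes "dominated K (mirror (a 0) a) a n" "K \<le> n" "\<And>i. a i \<le> a 0"
  shows "a n > 0"
proof -
  obtain i where "n + i \<le> n" "mirror (a 0) a (n + i) < a i"
    using assms(1,2) unfolding dominated_def by blast
  then show ?thesis by (cases "a n = 0") auto
qed

text \<open>Dominance leaves a reflected tail starting at \<open>r > 0\<close> at most equal up to
  the end of the block. In case of equality the block restarts, and reflecting both sides gives the
  comparison for the tail at \<open>s = n + 1 - r\<close>, with its first difference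
  \<open>s\<close> places earlier. Hence the induction on that place.\<close>

lemma lower_mirror_le:
  assumes a: "admissible a" "dominated 0 (mirror (a 0) a) a n" and n: "n \<ge> 1 \<or> a 0 \<ge> 2"
  shows "mirror (a 0) (shift k (lower n a)) \<sqsubseteq> lower n a"
proof -
  let ?b = "lower n a" and ?m = "a 0"
  have am: "a i \<le> ?m" for i using admissible_le_first[OF a(1)] .
  have bm: "?b i \<le> ?m" for i using lower_le_digit[of a ?m] am by blast
  have an: "a n > 0" using dominated_last_pos[OF a(2)] am by simp
  have no: "\<not> (?b i < ?m - ?b (r + i) \<and> (\<forall>j<i. ?m - ?b (r + j) = ?b j))" if "r \<le> n" for i r
    using that
  proof (induction i arbitrary: r rule: less_induct)
    case (less i)
    show ?case
    proof
      assume *: "?b i < ?m - ?b (r + i) \<and> (\<forall>j<i. ?m - ?b (r + j) = ?b j)"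
      show False
      proof (cases "r = 0")
        case True
        show False
        proof (cases "n = 0")
          case n0: True
          \<comment> \<open>Here \<open>m \<ge> 2\<close>, so the reflection, constantly
            \<open>1\<close>, does not exceed the constant \<open>m - 1\<close>.\<close>
          have "?b j = ?m - 1" for j using n0 by (simp add: lower_def cycle_def)
          then show False using * n n0 by auto
        next
          case False
          then have "?b 0 = ?m" by (simp add: lower_agree)
          moreover have "?m > 0" using admissible_first_pos[OF a(1)] .
          ultimately show False using * True bm[of i] by (cases "i = 0") (use bm in \<open>fastforce+\<close>)
        qed
      next
        case False
        obtain e where e: "r + e \<le> n" "?m - a (r + e) < a e" "\<forall>j<e. ?m - a (r + j) = a j"
          using a(2) less.prems unfolding dominated_def by auto
        have en: "e < n" using e(1) False by simp
        have be: "?b j = a j" if "j \<le> e" for j using that en by (simp add: lower_agree)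
        have br: "?b (r + j) = a (r + j)" if "j < e" for j using that e(1) by (simp add: lower_agree)
        have i: "\<not> i < e" using * e(3) be br by auto
        have le: "?m - ?b (r + e) \<le> a e"
        proof (cases "r + e = n")
          case True
          then show ?thesis using e(2) an am[of n] by (auto simp: lower_last)
        qed (use e in \<open>auto simp: lower_agree\<close>)
        have "i \<noteq> e" using * le be by auto
        with i have ie: "e < i" by simp
        then have "?m - ?b (r + e) = a e" using * be by auto
        then have re: "r + e = n" using e by (cases "r + e = n") (auto simp: lower_agree)
        define s where "s = Suc n - r"
        define i' where "i' = i - s"
        have s: "s \<le> n" "s = Suc e" "i = s + i'" "i' < i" "r + s = Suc n"
          using False re ie less.prems by (auto simp: s_def i'_def)
        have "?b (s + i') < ?m - ?b i'"
          using * s(3,5) lower_add_period[of n a i'] by (metis add.assoc)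
        then have "?b i' < ?m - ?b (s + i')" using bm[of i'] by linarith
        moreover have "?m - ?b (s + j) = ?b j" if "j < i'" for j
        proof -
          have "?m - ?b (r + (s + j)) = ?b (s + j)" using * s(3) that by auto
          then have "?m - ?b j = ?b (s + j)" using s(5) lower_add_period[of n a j] by (metis add.assoc)
          then show ?thesis using bm[of j] by linarith
        qed
        ultimately show False using less.IH[OF s(4,1)] by blast
      qed
    qed
  qed
  show ?thesis
  proof (rule ccontr)
    define r where "r = k mod Suc n"
    assume "\<not> mirror ?m (shift k ?b) \<sqsubseteq> ?b"
    then have "?b \<sqsubset> mirror ?m (shift r ?b)"
      using shift_mod_period[OF lower_period[of n a], of k] by (simp add: r_def)
    then obtain i where "?b i < ?m - ?b (r + i)" "\<forall>j<i. ?m - ?b (r + j) = ?b j"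
      by (rule mirror_shift_greaterE)
    then show False using no[of r i] by (auto simp: r_def)
  qed
qed

lemma lower_V:
  assumes a: "admissible a" "dominated 0 (mirror (a 0) a) a n" and n: "n \<ge> 1"
  shows "V_seq (lower n a)"
proof -
  have an: "a n > 0" using dominated_last_pos[OF a(2)] admissible_le_first[OF a(1)] by simp
  have "lower n a 0 = a 0" using n by (simp add: lower_agree)
  then show ?thesis
    unfolding V_seq_def using lower_admissible[OF a(1) an] lower_mirror_le[OF a] n by simp
qed

lemma strict_lower_frequently:
  assumes a: "strict_seq a"
  shows "\<exists>n\<ge>N. dominated 0 (mirror (a 0) a) a n"
  using a unfolding strict_seq_def
  by (intro dominated_frequently) (auto simp: shift_mirror admissible_shift_le)

lemma strict_left_limit:
  assumes a: "strict_seq a"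
  shows "\<exists>b. V_seq b \<and> b \<sqsubset> a \<and> (\<forall>j<N. b j = a j)"
proof -
  have adm: "admissible a" using a by (simp add: strict_seq_def)
  obtain n where n: "n \<ge> N + 1" "dominated 0 (mirror (a 0) a) a n"
    using strict_lower_frequently[OF a] by blast
  have "a n > 0" using dominated_last_pos[OF n(2)] admissible_le_first[OF adm] by simp
  then show ?thesis
    using n lower_V[OF adm n(2)] by (intro exI[of _ "lower n a"]) (auto simp: lower_less lower_agree)
qed

text \<open>A first difference beyond one period would, as \<open>b\<close> repeats, show that the
  tail \<open>shift p v\<close> exceeds \<open>v\<close>.\<close>

lemma first_diff_less_period:
  assumes b: "shift p b = b" "p \<ge> 1" and v: "\<And>k. shift k v \<sqsubseteq> v" and less: "b \<sqsubset> v"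
  obtains i where "i < p" "b i < v i" "\<forall>j<i. b j = v j"
proof -
  obtain i where i: "b i < v i" "\<forall>j<i. b j = v j" using less by (rule lex_lessE)
  have bp: "b (p + j) = b j" for j using fun_cong[OF b(1), of j] by simp
  have "i < p"
  proof (rule ccontr)
    assume *: "\<not> i < p"
    have "v \<sqsubset> shift p v"
    proof (rule lex_lessI[of _ "i - p"])
      have "v (i - p) = b (i - p)" using i(2) b(2) * by simp
      then show "v (i - p) < shift p v (i - p)" using i(1) bp[of "i - p"] * by simp
      fix j assume "j < i - p"
      then show "v j = shift p v j" using i(2) bp[of j] by (simp add: less_diff_conv add.commute)
    qed
    then show False using v[of p] by (simp flip: lex.not_less)
  qed
  with i that show ?thesis by blast
qed

text \<open>Reflected tails before \<open>n + 1\<close> are strictly smaller by minimality. If one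
  matched \<open>A\<close> through position \<open>n\<close>, its rest, which is \<open>A\<close>,
  would be compared with a tail of \<open>A\<close>; admissibility forces equality, and the
  reflection would have reproduced \<open>A\<close> too early.\<close>

lemma mirror_period_dominated:
  assumes A: "V_seq A" and n: "mirror (A 0) (shift (Suc n) A) = A"
    and least: "\<And>k. \<lbrakk>k \<ge> 1; k \<le> n\<rbrakk> \<Longrightarrow> mirror (A 0) (shift k A) \<noteq> A"
  shows "dominated 0 (mirror (A 0) A) A n"
  unfolding dominated_def
proof (intro allI impI)
  fix k assume k: "k \<le> n"
  let ?m = "A 0"
  have adm: "admissible A" using A by (simp add: V_seq_def)
  have Am: "\<forall>i. A i \<le> ?m" using admissible_le_first[OF adm] by simp
  have sA: "shift (Suc n) A = mirror ?m A"
    using arg_cong[OF n, of "mirror ?m"] Am by simp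
  show "\<exists>i. k + i \<le> n \<and> mirror ?m A (k + i) < A i \<and> (\<forall>j<i. mirror ?m A (k + j) = A j)"
  proof (cases "k = 0")
    case True
    then show ?thesis using admissible_first_pos[OF adm] by (intro exI[of _ 0]) simp
  next
    case False
    have "mirror ?m (shift k A) \<sqsubset> A"
      using A least[of k] k False unfolding V_seq_def by (simp add: lex.less_le)
    then obtain i where i: "?m - A (k + i) < A i" "\<forall>j<i. ?m - A (k + j) = A j" by (auto elim: lex_lessE)
    have "k + i \<le> n"
    proof (rule ccontr)
      assume c: "\<not> k + i \<le> n"
      define l where "l = Suc n - k"
      have l: "l \<ge> 1" "l \<le> n" "k + l = Suc n" using k False by (auto simp: l_def)
      have agree: "mirror ?m (shift k A) j = A j" if "j < l" for j
        using i(2)[rule_format, of j] that c l by simp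
      have "shift l (mirror ?m (shift k A)) = A"
        using n l(3) by (simp add: shift_mirror)
      then have "A \<sqsubseteq> shift l A"
        using lex_le_shift_iff[of l "mirror ?m (shift k A)" A, OF agree] A by (simp add: V_seq_def)
      then have "shift l A = A" using admissible_shift_le[OF adm, of l] by simp
      then have "mirror ?m (shift k A) = A"
        using eq_iff_shift[of l "mirror ?m (shift k A)" A, OF agree] \<open>shift l (mirror ?m (shift k A)) = A\<close> by simp
      then show False using least[of k] False k by simp
    qed
    then show ?thesis using i by auto
  qed
qed

text \<open>On positions \<open>0\<close> to \<open>n\<close> the two sequences carry consecutive
  words, so exceeding the smaller one there without exceeding \<open>A\<close> leaves only the word
  of \<open>A\<close>.\<close>

lemma agree_if_above_lower:
  assumes i: "i \<le> n" "lower n A i < v i" "\<forall>j<i. lower n A j = v j" and le: "v \<sqsubseteq> A"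
    and j: "j \<le> n"
  shows "v j = A j"
proof -
  have vi: "v j = A j" if "j < i" for j using i that by (simp add: lower_agree)
  have "A i \<le> v i" using i by (cases "i = n") (auto simp: lower_agree lower_last)
  moreover have "v i \<le> A i" using lex_le_next[OF le vi] .
  ultimately have eq: "v i = A i" by simp
  then have "i = n" using i(1,2) by (cases "i = n") (auto simp: lower_agree)
  then show ?thesis using vi eq j by (cases "j = n") auto
qed

text \<open>The sequence \<open>v\<close> shares the first block with \<open>A\<close>, so its next
  tail is below the reflection of \<open>A\<close>. The reflection of that tail then lies above
  \<open>A\<close>, hence above \<open>v\<close>, which \<open>V_seq\<close> forbids.\<close>

lemma no_V_between:
  assumes A: "admissible A" "shift (Suc n) A = mirror (A 0) A"
    and v: "V_seq v" "lower n A \<sqsubset> v" "v \<sqsubset> A"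
  shows False
proof -
  let ?m = "A 0"
  have vs: "shift k v \<sqsubseteq> v" for k using v(1) by (simp add: V_seq_def admissible_def)
  have "1 \<le> Suc n" by simp
  from first_diff_less_period[OF lower_period this vs v(2)]
  obtain i where i: "i < Suc n" "lower n A i < v i" "\<forall>j<i. lower n A j = v j"
    by metis
  have agree: "v j = A j" if "j < Suc n" for j
    using agree_if_above_lower[OF _ i(2,3) lex.less_imp_le[OF v(3)]] i(1) that by simp
  have "shift (Suc n) v \<sqsubset> mirror ?m A"
    using lex_less_shift_iff[of "Suc n" v A, OF agree] v(3) A(2) by simp
  moreover have "v 0 = ?m" using agree by simp
  moreover have "v i \<le> ?m" for i
    using admissible_le_first[of v i] v(1) \<open>v 0 = ?m\<close> by (simp add: V_seq_def)
  ultimately have "A \<sqsubset> mirror ?m (shift (Suc n) v)"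
    using mirror_less_swap[of A ?m "mirror ?m (shift (Suc n) v)"] admissible_le_first[OF A(1)]
      mirror_less_iff[of "mirror ?m A" ?m "shift (Suc n) v"] by simp
  moreover have "mirror ?m (shift (Suc n) v) \<sqsubseteq> v"
    using v(1) \<open>v 0 = ?m\<close> unfolding V_seq_def by metis
  ultimately show False using v(3) by (meson lex.less_le_not_le lex.less_le_trans lex.less_trans lex.less_irrefl)
qed

text \<open>The block of \<open>n + 2\<close> zeros is longer than the word before it, hence cannot follow this word in
  a sequence of \<open>\<V>\<close>.\<close>

definition upper :: "nat \<Rightarrow> (nat \<Rightarrow> nat) \<Rightarrow> nat \<Rightarrow> nat" where
  "upper n a = cycle (2 * n + 3) (join (Suc n) (a(n := a n + 1)) (\<lambda>_. 0))"

lemma upper_agree: "j < n \<Longrightarrow> upper n a j = a j"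
  by (simp add: upper_def)

lemma upper_last: "upper n a n = a n + 1"
  by (simp add: upper_def)

lemma upper_zero: "n < j \<Longrightarrow> j < 2 * n + 3 \<Longrightarrow> upper n a j = 0"
  by (simp add: upper_def join_def)

lemma upper_greater: "a \<sqsubset> upper n a"
  by (rule lex_lessI[of _ n]) (simp_all add: upper_agree upper_last)

lemma upper_period: "shift (2 * n + 3) (upper n a) = upper n a"
  unfolding upper_def by (rule shift_cycle)

text \<open>Tails starting in the zeros are too small. A proper tail starting in the word falls
  short by position \<open>n\<close>; raising the digit there can at best restore equality, and then
  zeros are compared with a word still to end in a positive digit.\<close>

lemma upper_admissible:
  assumes a: "admissible a" "dominated 1 a a n"
  shows "admissible (upper n a)"
proof -
  let ?b = "upper n a"
  have "?b 0 > 0" using admissible_first_pos[OF a(1)] by (cases n) (auto simp: upper_agree upper_last)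
  then have inf: "infinite_seq ?b" using upper_period by (rule infinite_seq_period[rotated 2]) simp
  have "shift k ?b \<sqsubseteq> ?b" for k
  proof (rule ccontr)
    define r where "r = k mod (2 * n + 3)"
    assume "\<not> shift k ?b \<sqsubseteq> ?b"
    then have "?b \<sqsubset> shift r ?b"
      using shift_mod_period[OF upper_period[of n a], of k] by (simp add: r_def)
    then obtain i where i: "?b i < ?b (r + i)" "\<forall>j<i. ?b (r + j) = ?b j" by (rule shift_greaterE)
    have r: "0 < r" "r < 2 * n + 3" using i(1) by (auto simp: r_def intro: gr0I)
    show False
    proof (cases "r \<le> n")
      case False
      then have "?b r = 0" using r by (simp add: upper_zero)
      then show False using i \<open>?b 0 > 0\<close> by (cases "i = 0") auto
    next
      case True
      obtain e where e: "r + e \<le> n" "a (r + e) < a e" "\<forall>j<e. a (r + j) = a j"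
        using a(2)[unfolded dominated_def, rule_format, of r] True r by auto
      have en: "e < n" using e(1) r by simp
      have be: "?b j = a j" if "j \<le> e" for j using that en by (simp add: upper_agree)
      have br: "?b (r + j) = a (r + j)" if "j < e" for j using that e(1) by (simp add: upper_agree)
      have "?b (r + e) \<le> a e"
        using e by (cases "r + e = n") (auto simp: upper_agree upper_last)
      then have "i \<noteq> e" using i(1) be by auto
      moreover have "\<not> i < e" using i(1) be br e(3) by auto
      ultimately have ie: "e < i" by simp
      then have "?b (r + e) = a e" using i(2) be by auto
      then have re: "r + e = n" using e by (cases "r + e = n") (auto simp: upper_agree)
      have "i < n + 1"
      proof (rule ccontr)
        assume "\<not> i < n + 1"
        then have "?b n = ?b (r + n)" using i(2) by simp
        then show False using True r by (simp add: upper_zero upper_last)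
      qed
      then have "?b (r + i) = 0" using re ie True by (intro upper_zero) auto
      then show False using i(1) by simp
    qed
  qed
  with inf show ?thesis by (simp add: admissible_def)
qed

lemma no_V_above_periodic:
  assumes a: "admissible a" "shift (Suc n) a = a" and v: "V_seq v" "a \<sqsubset> v" "v \<sqsubset> upper n a"
  shows False
proof -
  let ?b = "upper n a"
  have adm: "admissible v" using v(1) by (simp add: V_seq_def)
  have vs: "shift k v \<sqsubseteq> v" for k using adm by (rule admissible_shift_le)
  have "1 \<le> Suc n" by simp
  from first_diff_less_period[OF a(2) this vs v(2)]
  obtain i where i: "i < Suc n" "a i < v i" "\<forall>j<i. a j = v j"
    by metis
  obtain i' where i': "v i' < ?b i'" "\<forall>j<i'. v j = ?b j" using v(3) by (rule lex_lessE)
  have vi: "\<forall>j<i. v j = ?b j" using i by (simp add: upper_agree)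
  have "?b i \<le> v i" using i by (cases "i = n") (auto simp: upper_agree upper_last)
  then have "i < i'" using i' vi by (cases i i' rule: linorder_cases) auto
  \<comment> \<open>An increase before the last digit of the period would already exceed
    \<open>upper n a\<close>.\<close>
  have "i = n"
  proof (rule ccontr)
    assume "i \<noteq> n"
    then have "?b i = a i" using i(1) by (simp add: upper_agree)
    then show False using i(2) i'(2) \<open>i < i'\<close> by auto
  qed
  then have "n < i'" using \<open>i < i'\<close> by simp
  have "2 * n + 3 \<le> i'" using upper_zero[of n i' a] i'(1) \<open>n < i'\<close> by (cases "i' < 2 * n + 3") auto
  then have zero: "v j = 0" if "n < j" "j < 2 * n + 3" for j
    using i'(2) that upper_zero[of n j a] by simp
  have v0: "v 0 > 0" using admissible_first_pos[OF adm] .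
  have le: "mirror (v 0) (shift (Suc n) v) \<sqsubseteq> v" using v(1) by (simp add: V_seq_def)
  \<comment> \<open>The reflected tail begins with \<open>n + 2\<close> largest digits, whereas
    \<open>v\<close> has a zero at position \<open>n + 1\<close>.\<close>
  have "v \<sqsubset> mirror (v 0) (shift (Suc n) v)"
  proof (rule ccontr)
    assume "\<not> v \<sqsubset> mirror (v 0) (shift (Suc n) v)"
    with le have "mirror (v 0) (shift (Suc n) v) \<sqsubset> v \<or> mirror (v 0) (shift (Suc n) v) = v"
      by (simp add: lex.le_less)
    then show False
    proof
      assume "mirror (v 0) (shift (Suc n) v) \<sqsubset> v"
      then obtain l where l: "v 0 - v (Suc n + l) < v l" "\<forall>j<l. v 0 - v (Suc n + j) = v j"
        by (auto elim: lex_lessE)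
      have "l \<le> Suc n"
      proof (rule ccontr)
        assume "\<not> l \<le> Suc n"
        then have "v 0 - v (Suc n + Suc n) = v (Suc n)" using l(2)[rule_format, of "Suc n"] by simp
        then show False using zero[of "Suc n"] zero[of "Suc n + Suc n"] v0 by simp
      qed
      then have "v (Suc n + l) = 0" using zero[of "Suc n + l"] by simp
      then show False using l(1) admissible_le_first[OF adm, of l] by simp
    next
      assume "mirror (v 0) (shift (Suc n) v) = v"
      then have "v 0 - v (Suc n + Suc n) = v (Suc n)" by (metis mirror_apply shift_apply)
      then show False using zero[of "Suc n"] zero[of "Suc n + Suc n"] v0 by simp
    qed
  qed
  with le show False by (simp flip: lex.not_less)
qed

text \<open>For the least period, a later tail matching \<open>a\<close> to the end of the period
  would leave \<open>a\<close> below one of its own tails.\<close>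

lemma minimal_period_dominated:
  assumes a: "admissible a" "shift p a = a" "p \<ge> 1"
  obtains n where "shift (Suc n) a = a" "dominated 1 a a n"
proof -
  define p0 where "p0 = (LEAST p. p \<ge> 1 \<and> shift p a = a)"
  have p0: "p0 \<ge> 1" "shift p0 a = a"
    unfolding p0_def using LeastI[of "\<lambda>p. p \<ge> 1 \<and> shift p a = a" p] a by auto
  have min: "shift k a \<noteq> a" if "k \<ge> 1" "k < p0" for k
    using that not_less_Least unfolding p0_def by blast
  obtain n where n: "p0 = Suc n" using p0(1) by (cases p0) auto
  have "dominated 1 a a n"
    unfolding dominated_def
  proof (intro allI impI)
    fix k assume k: "1 \<le> k" "k \<le> n"
    have "shift k a \<sqsubset> a" using admissible_shift_le[OF a(1), of k] min[of k] k n by (simp add: lex.less_le)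
    then obtain i where i: "a (k + i) < a i" "\<forall>j<i. a (k + j) = a j" by (auto elim: lex_lessE)
    have "k + i \<le> n"
    proof (rule ccontr)
      assume c: "\<not> k + i \<le> n"
      define l where "l = Suc n - k"
      have l: "l \<ge> 1" "l < p0" "k + l = Suc n" using k n by (auto simp: l_def)
      have agree: "shift k a j = a j" if "j < l" for j
        using i(2)[rule_format, of j] that c l by simp
      have "a \<sqsubset> shift l a \<or> a = shift l a"
        using lex_less_shift_iff[of l "shift k a" a, OF agree] \<open>shift k a \<sqsubset> a\<close> l(3) p0(2) n by simp
      then have "shift l a = a" using admissible_shift_le[OF a(1), of l] by auto
      then show False using min[OF l(1,2)] by simp
    qed
    then show "\<exists>i. k + i \<le> n \<and> a (k + i) < a i \<and> (\<forall>j<i. a (k + j) = a j)" using i by blast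
  qed
  then show ?thesis using that p0(2) n by simp
qed

lemma periodic_right_gap:
  assumes a: "admissible a" "shift p a = a" "p \<ge> 1"
  shows "\<exists>b. admissible b \<and> a \<sqsubset> b \<and> (\<forall>v. a \<sqsubset> v \<longrightarrow> v \<sqsubset> b \<longrightarrow> \<not> V_seq v)"
proof -
  obtain n where n: "shift (Suc n) a = a" "dominated 1 a a n"
    using minimal_period_dominated[OF a] by blast
  have "\<not> V_seq v" if "a \<sqsubset> v" "v \<sqsubset> upper n a" for v
    using no_V_above_periodic[OF a(1) n(1) _ that] by blast
  then show ?thesis using upper_admissible[OF a(1) n(2)] upper_greater by metis
qed

section \<open>Gaps around sequences outside \<open>\<V>\<close>\<close>

lemma not_V_finite:
  assumes a: "admissible a" "\<not> V_seq a"
  obtains M where "\<And>v. (\<And>j. j < M \<Longrightarrow> v j = a j) \<Longrightarrow> \<not> V_seq v"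
proof -
  obtain k where "\<not> mirror (a 0) (shift k a) \<sqsubseteq> a" using a unfolding V_seq_def by blast
  then have "a \<sqsubset> mirror (a 0) (shift k a)" by simp
  then obtain i where i: "a i < a 0 - a (k + i)" "\<forall>j<i. a 0 - a (k + j) = a j"
    by (rule mirror_shift_greaterE)
  have "\<not> V_seq v" if "\<And>j. j < Suc (k + i) \<Longrightarrow> v j = a j" for v
  proof -
    have v: "v j = a j" if "j \<le> k + i" for j using \<open>\<And>j. j < Suc (k + i) \<Longrightarrow> v j = a j\<close> that by simp
    have "v \<sqsubset> mirror (v 0) (shift k v)"
    proof (rule lex_lessI[of _ i])
      show "v i < mirror (v 0) (shift k v) i" using i(1) v[of i] v[of 0] v[of "k + i"] by simp
      fix j assume "j < i"
      then have "a 0 - a (k + j) = a j" using i(2) by blast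
      then show "v j = mirror (v 0) (shift k v) j" using v[of j] v[of 0] v[of "k + j"] \<open>j < i\<close> by simp
    qed
    then show ?thesis unfolding V_seq_def by (meson lex.not_le)
  qed
  then show ?thesis using that by blast
qed

text \<open>Without a period all proper tails are strictly smaller, so the word can be raised at a
  dominated position behind the violation of \<open>V_seq\<close>; everything in between keeps the
  violating prefix.\<close>

lemma not_V_right_gap:
  assumes a: "admissible a" "\<not> V_seq a"
  shows "\<exists>b. admissible b \<and> a \<sqsubset> b \<and> (\<forall>v. a \<sqsubset> v \<longrightarrow> v \<sqsubset> b \<longrightarrow> \<not> V_seq v)"
proof (cases "\<exists>p\<ge>1. shift p a = a")
  case True
  then show ?thesis using periodic_right_gap[OF a(1)] by blast
next
  case False
  obtain M where M: "\<And>v. (\<And>j. j < M \<Longrightarrow> v j = a j) \<Longrightarrow> \<not> V_seq v" using not_V_finite[OF a] by blast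
  have less: "shift k a \<sqsubset> a" if "k \<ge> 1" for k
    using False that admissible_shift_le[OF a(1), of k] by (auto simp: lex.less_le)
  obtain n where n: "n \<ge> M" "dominated 1 a a n"
    using dominated_frequently[OF admissible_shift_le[OF a(1)] less] by blast
  have "\<not> V_seq v" if "a \<sqsubset> v" "v \<sqsubset> upper n a" for v
  proof (rule M)
    fix j assume "j < M"
    then show "v j = a j"
      using lex_sandwich[OF that, of n j] n(1) upper_agree[of _ n a] by simp
  qed
  then show ?thesis using upper_admissible[OF a(1) n(2)] upper_greater by metis
qed

lemma not_V_left_gap:
  assumes a: "admissible a" "\<not> V_seq a"
  shows "\<exists>b. admissible b \<and> b \<sqsubset> a \<and> (\<forall>v. b \<sqsubset> v \<longrightarrow> v \<sqsubset> a \<longrightarrow> \<not> V_seq v)"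
proof -
  obtain M where M: "\<And>v. (\<And>j. j < M \<Longrightarrow> v j = a j) \<Longrightarrow> \<not> V_seq v" using not_V_finite[OF a] by blast
  obtain n where n: "n \<ge> Suc M" "a n > 0" using a(1) infinite_seqE unfolding admissible_def by blast
  have "\<not> V_seq v" if "lower n a \<sqsubset> v" "v \<sqsubset> a" for v
  proof (rule M)
    fix j assume "j < M"
    then show "v j = a j"
      using lex_sandwich[OF that, of n j] n(1) lower_agree[of _ n a] by simp
  qed
  then show ?thesis using lower_admissible[OF a(1) n(2)] lower_less[of a n] n by auto
qed

section \<open>The connected components\<close>

text \<open>Periodicity leaves finitely many tails, so the places that decide the comparisons are
  bounded.\<close>

lemma uniform_first_diff:
  assumes a: "strict_seq a" and p: "shift p a = a" "p \<ge> 1"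
  obtains M where "\<And>k. \<exists>e<M. a 0 - a (k + e) < a e \<and> (\<forall>j<e. a 0 - a (k + j) = a j)"
proof -
  have "\<exists>e. a 0 - a (k + e) < a e \<and> (\<forall>j<e. a 0 - a (k + j) = a j)" for k
  proof -
    have "mirror (a 0) (shift k a) \<sqsubset> a" using a by (simp add: strict_seq_def)
    then obtain e where "a 0 - a (k + e) < a e" "\<forall>j<e. a 0 - a (k + j) = a j"
      by (auto elim: lex_lessE)
    then show ?thesis by blast
  qed
  then obtain e where e: "\<And>k. a 0 - a (k + e k) < a (e k) \<and> (\<forall>j<e k. a 0 - a (k + j) = a j)"
    by metis
  define M where "M = Suc (Max (e ` {..<p}))"
  have "\<exists>e<M. a 0 - a (k + e) < a e \<and> (\<forall>j<e. a 0 - a (k + j) = a j)" for k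
  proof (intro exI conjI)
    have per: "a (k + j) = a (k mod p + j)" for j
      using fun_cong[OF shift_mod_period[OF p(1), of k], of j] by simp
    have "k mod p < p" using p(2) by simp
    then show "e (k mod p) < M" unfolding M_def by (simp add: less_Suc_eq_le)
    show "a 0 - a (k + e (k mod p)) < a (e (k mod p))"
      using conjunct1[OF e[of "k mod p"]] by (simp only: per)
    show "\<forall>j<e (k mod p). a 0 - a (k + j) = a j"
      using conjunct2[OF e[of "k mod p"]] by (simp only: per)
  qed
  then show ?thesis using that by blast
qed

text \<open>The approximation is \<open>a\<^sub>0 \<dots> a\<^sub>n\<^sub>-\<^sub>1 (a\<^sub>n - 1) t\<close> with \<open>t = lower n\<^sub>0 a\<close> for some \<open>n\<^sub>0\<close> much
  smaller than \<open>n\<close>. Since \<open>a\<close> is periodic, the comparison of any reflected tail of \<open>a\<close> with \<open>a\<close> is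
  decided within the first \<open>M\<close> digits, so that \<open>t\<close> only needs to follow \<open>a\<close> for \<open>M\<close> digits.\<close>

lemma strict_periodic_U_limit:
  assumes a: "strict_seq a" and p: "shift p a = a" "p \<ge> 1"
  shows "\<exists>b. admissible b \<and> univ_seq b b \<and> b \<sqsubset> a \<and> (\<forall>j<N. b j = a j)"
proof -
  let ?m = "a 0"
  have adm: "admissible a" using a by (simp add: strict_seq_def)
  have am: "a i \<le> ?m" for i using admissible_le_first[OF adm] .
  obtain M where M: "\<And>k. \<exists>e<M. ?m - a (k + e) < a e \<and> (\<forall>j<e. ?m - a (k + j) = a j)"
    using uniform_first_diff[OF a p] by blast
  obtain n0 where n0: "n0 \<ge> Suc M" "dominated 0 (mirror ?m a) a n0"
    using strict_lower_frequently[OF a] by blast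
  \<comment> \<open>The slack covers the \<open>N\<close> digits to preserve, the first difference
    \<open>n0\<close> of \<open>t\<close> and \<open>b\<close>, and two successive comparisons of
    fewer than \<open>M\<close> places each, which must stay inside the part copied from
    \<open>a\<close>.\<close>
  obtain n where n: "n \<ge> n0 + 2 * M + N + 2" "dominated 0 (mirror ?m a) a n"
    using strict_lower_frequently[OF a] by blast
  have an0: "a n0 > 0" and an: "a n > 0"
    using dominated_last_pos[OF n0(2)] dominated_last_pos[OF n(2)] am by auto
  define t where "t = lower n0 a"
  define b where "b = join (Suc n) (a(n := a n - 1)) t"
  have ba: "b j = a j" if "j < n" for j using that by (simp add: b_def)
  have bn: "b n = a n - 1" by (simp add: b_def)
  have ta: "t j = a j" if "j < n0" for j using that by (simp add: t_def lower_agree)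
  have bt: "shift (Suc n + k) b = shift k t" for k unfolding b_def by (rule shift_join_ge)
  have t0: "t 0 = ?m" using ta n0(1) by simp
  have tV: "V_seq t" unfolding t_def using n0 by (intro lower_V[OF adm]) auto
  then have ts: "shift k t \<sqsubseteq> t" and tm: "mirror ?m (shift k t) \<sqsubseteq> t" for k
    using t0 by (simp_all add: V_seq_def admissible_def)
  \<comment> \<open>Tails of \<open>t\<close> and their reflections are at most \<open>t\<close>;
    this makes them strictly smaller than \<open>b\<close>, as \<open>univ_seq b b\<close>
    demands.\<close>
  have tb: "t \<sqsubset> b"
    by (rule lex_lessI[of _ n0]) (use n n0 an0 ba ta in \<open>auto simp: t_def lower_last\<close>)
  have ble: "b \<sqsubset> a"
    by (rule lex_lessI[of _ n]) (use ba bn an in auto)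
  have u1: "shift k b \<sqsubset> b" if k: "k \<ge> 1" for k
  proof (cases "k \<le> n")
    case False
    then have "shift k b = shift (k - Suc n) t" using bt[of "k - Suc n"] by simp
    then show ?thesis using ts tb lex.le_less_trans by metis
  next
    case True
    \<comment> \<open>The first such \<open>e\<close> is where the tail leaves \<open>a\<close> or
      meets the decremented digit; in both cases the tail of \<open>b\<close> drops strictly
      there.\<close>
    define P where "P = (\<lambda>e. k + e = n \<or> a (k + e) \<noteq> a e)"
    define e where "e = (LEAST e. P e)"
    have "P (n - k)" using True by (simp add: P_def)
    then have Pe: "P e" and ek: "e \<le> n - k" and le: "\<And>j. j < e \<Longrightarrow> \<not> P j"
      unfolding e_def by (auto intro: LeastI Least_le dest: not_less_Least)
    have agree: "shift k a j = a j" if "j < e" for j using le[OF that] by (simp add: P_def)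
    have "a (k + e) \<le> a e"
      using lex_le_next[OF admissible_shift_le[OF adm, of k] agree, of e] by simp
    then have lt: "b (k + e) < b e"
      using Pe ek True k ba[of e] ba[of "k + e"] bn an by (cases "k + e = n") (auto simp: P_def)
    show ?thesis
      by (rule lex_lessI[of _ e]) (use lt agree ba ek True k in auto)
  qed
  have u2: "mirror ?m (shift k b) \<sqsubset> b" if k: "k \<ge> 1" for k
  proof (cases "k \<le> n")
    case False
    then have "shift k b = shift (k - Suc n) t" using bt[of "k - Suc n"] by simp
    then show ?thesis using tm tb lex.le_less_trans by metis
  next
    case True
    obtain e where e: "k + e \<le> n" "?m - a (k + e) < a e" "\<forall>j<e. ?m - a (k + j) = a j"
      using n(2)[unfolded dominated_def, rule_format, of k] True by auto
    have en: "e < n" using e(1) k by simp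
    have le: "?m - b (k + e) \<le> b e"
      using e en ba[of e] ba[of "k + e"] bn an am[of n] by (cases "k + e = n") auto
    have agree: "mirror ?m (shift k b) j = b j" if "j < e" for j
      using that e(1,3) en ba[of j] ba[of "k + j"] by simp
    show ?thesis
    proof (cases "?m - b (k + e) < b e")
      case True
      then show ?thesis using agree by (intro lex_lessI[of _ e]) auto
    next
      case False
      then have eq: "?m - b (k + e) = b e" using le by simp
      then have ken: "k + e = n" using e en ba[of e] ba[of "k + e"] by (cases "k + e = n") auto
      \<comment> \<open>Equality ends at the cut. What remains to be compared is the reflection of
        \<open>t\<close> with \<open>shift (Suc e) b\<close>, and a bounded \<open>e\<close> keeps
        the deciding digits within the copy of \<open>a\<close>.\<close>
      have "e < M"
      proof -
        obtain e' where e': "e' < M" "?m - a (k + e') < a e'" "\<forall>j<e'. ?m - a (k + j) = a j"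
          using M by blast
        have "e = e'" using e e' by (metis linorder_neqE_nat less_irrefl)
        then show ?thesis using e' by simp
      qed
      obtain f where f: "f < M" "?m - a (Suc e + f) < a f" "\<forall>j<f. ?m - a (Suc e + j) = a j"
        using M by blast
      have bs: "b (Suc e + j) = a (Suc e + j)" if "j \<le> f" for j
        using that f(1) \<open>e < M\<close> n(1) by (intro ba) simp
      have tt: "t j = a j" if "j \<le> f" for j using that f(1) n0(1) by (intro ta) simp
      have "mirror ?m t \<sqsubset> shift (Suc e) b"
      proof (rule lex_lessI[of _ f])
        show "mirror ?m t f < shift (Suc e) b f"
          using f(2) bs[of f] tt[of f] am[of f] am[of "Suc e + f"] by auto
        fix j assume "j < f"
        then have "?m - a (Suc e + j) = a j" using f(3) by blast
        then show "mirror ?m t j = shift (Suc e) b j"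
          using \<open>j < f\<close> bs[of j] tt[of j] am[of "Suc e + j"] by auto
      qed
      moreover have "shift (Suc e) (mirror ?m (shift k b)) = mirror ?m t"
        using bt[of 0] ken by (simp add: shift_mirror)
      moreover have agree': "mirror ?m (shift k b) j = b j" if "j < Suc e" for j
        using that agree eq by (cases "j = e") auto
      ultimately show ?thesis
        using lex_less_shift_iff[of "Suc e" "mirror ?m (shift k b)" b, OF agree'] by simp
    qed
  qed
  have "infinite_seq b"
  proof (rule infinite_seqI)
    fix N
    obtain i where "i \<ge> N" "t i > 0" using tV infinite_seqE unfolding V_seq_def admissible_def by blast
    then show "\<exists>i\<ge>N. b i > 0" using fun_cong[OF bt[of 0], of i] by (intro exI[of _ "Suc n + i"]) auto
  qed
  moreover have "shift k b \<sqsubseteq> b" for k using u1[of k] by (cases "k = 0") (auto simp: lex.less_imp_le)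
  ultimately have badm: "admissible b" by (simp add: admissible_def)
  have "b 0 = ?m" using ba n by simp
  then have "univ_seq b b"
    unfolding univ_seq_self_iff[OF badm] using u1 u2 by (metis lex.less_irrefl)
  then show ?thesis using badm ble ba n(1) by (intro exI[of _ b]) auto
qed

section \<open>From sequences back to bases\<close>

lemma reflect_eq: "reflect q c = mirror (quasi_greedy q 0) c"
  by (simp add: reflect_def mirror_def)

lemma mem_V_iff: "q \<in> bases_V \<longleftrightarrow> 1 < q \<and> V_seq (quasi_greedy q)"
proof -
  have "V_seq a \<longleftrightarrow> (\<forall>k\<ge>1. mirror (a 0) (shift k a) \<sqsubseteq> a)" if "admissible a" for a
    using V_seqI[OF that] by (auto simp: V_seq_def)
  then show ?thesis
    unfolding bases_V_def reflect_eq using admissible_quasi_greedy by (auto simp: shift_def)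
qed

lemma mem_U_iff: "q \<in> bases_U \<longleftrightarrow> 1 < q \<and> univ_seq (quasi_greedy q) (quasi_greedy q)"
proof -
  have "expansion q 1 (quasi_greedy q)" if "1 < q"
    using quasi_greedy_tails(1,2)[OF that] expansion_iff[OF that] by simp
  then show ?thesis unfolding bases_U_def using unique_expansion_iff by blast
qed

lemma U_strict: "q \<in> bases_U \<Longrightarrow> strict_seq (quasi_greedy q)"
  using univ_self_imp_strict admissible_quasi_greedy by (simp add: mem_U_iff)

lemma U_subset_V: "bases_U \<subseteq> bases_V"
  using U_strict strict_imp_V by (auto simp: mem_U_iff mem_V_iff)

lemma base_above:
  assumes "1 < q" "admissible b" "quasi_greedy q \<sqsubset> b"
  obtains r where "q < r" "quasi_greedy r = b"
proof -
  obtain r where r: "1 < r" "quasi_greedy r = b" using quasi_greedy_surj[OF assms(2)] .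
  then show ?thesis using that quasi_greedy_less_iff[OF assms(1) r(1)] assms(3) by blast
qed

lemma base_below:
  assumes "1 < q" "admissible b" "b \<sqsubset> quasi_greedy q"
  obtains r where "1 < r" "r < q" "quasi_greedy r = b"
proof -
  obtain r where r: "1 < r" "quasi_greedy r = b" using quasi_greedy_surj[OF assms(2)] .
  then show ?thesis using that quasi_greedy_less_iff[OF r(1) assms(1)] assms(3) by blast
qed

lemma right_gap_of_seq:
  assumes q: "1 < q" and b: "admissible b" "quasi_greedy q \<sqsubset> b"
    and gap: "\<And>v. \<lbrakk>quasi_greedy q \<sqsubset> v; v \<sqsubset> b\<rbrakk> \<Longrightarrow> \<not> V_seq v"
  shows "\<exists>r>q. {q<..<r} \<inter> bases_V = {}"
proof -
  obtain r where r: "q < r" "quasi_greedy r = b" using base_above[OF q b] .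
  have "v \<notin> bases_V" if "q < v" "v < r" for v
    using gap[of "quasi_greedy v"] quasi_greedy_strict_mono[of q v] quasi_greedy_strict_mono[of v r] that q r
    by (auto simp: mem_V_iff)
  then show ?thesis using r by (intro exI[of _ r]) auto
qed

lemma left_gap_of_seq:
  assumes q: "1 < q" and b: "admissible b" "b \<sqsubset> quasi_greedy q"
    and gap: "\<And>v. \<lbrakk>b \<sqsubset> v; v \<sqsubset> quasi_greedy q\<rbrakk> \<Longrightarrow> \<not> V_seq v"
  shows "\<exists>p<q. 1 < p \<and> {p<..<q} \<inter> bases_V = {}"
proof -
  obtain p where p: "1 < p" "p < q" "quasi_greedy p = b" using base_below[OF q b] .
  have "v \<notin> bases_V" if "p < v" "v < q" for v
    using gap[of "quasi_greedy v"] quasi_greedy_strict_mono[of p v] quasi_greedy_strict_mono[of v q] that p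
    by (auto simp: mem_V_iff)
  then show ?thesis using p by (intro exI[of _ p]) auto
qed

lemma periodic_base_right_gap:
  assumes "1 < q" "shift k (quasi_greedy q) = quasi_greedy q" "k \<ge> 1"
  shows "\<exists>r>q. {q<..<r} \<inter> bases_V = {}"
  using periodic_right_gap[OF admissible_quasi_greedy[OF assms(1)] assms(2,3)]
    right_gap_of_seq[OF assms(1)] by metis

text \<open>The two gap lemmas give an interval around each base outside \<open>\<V>\<close>. Adding
  \<open>{..1}\<close> postpones the question whether \<open>1\<close> is a limit point, which
  \<open>first_component\<close> answers.\<close>

lemma closed_V_Un: "closed ({..1} \<union> bases_V)"
proof -
  have "\<exists>e>0. ball q e \<subseteq> - ({..1} \<union> bases_V)" if q: "1 < q" "q \<notin> bases_V" for q
  proof -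
    note adm = admissible_quasi_greedy[OF q(1)]
    have nV: "\<not> V_seq (quasi_greedy q)" using q by (simp add: mem_V_iff)
    obtain r where r: "q < r" "{q<..<r} \<inter> bases_V = {}"
      using not_V_right_gap[OF adm nV] right_gap_of_seq[OF q(1)] by metis
    obtain p where p: "p < q" "1 < p" "{p<..<q} \<inter> bases_V = {}"
      using not_V_left_gap[OF adm nV] left_gap_of_seq[OF q(1)] by metis
    have "v \<in> - ({..1} \<union> bases_V)" if "p < v" "v < r" for v
      using that p r q by (cases v q rule: linorder_cases) auto
    then have "ball q (min (q - p) (r - q)) \<subseteq> - ({..1} \<union> bases_V)"
      by (auto simp: ball_def dist_real_def abs_if split: if_splits)
    then show ?thesis using p r by (intro exI[of _ "min (q - p) (r - q)"]) auto
  qed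
  then show ?thesis unfolding closed_def open_contains_ball by (auto simp: not_le)
qed

lemma const_seq:
  assumes "m \<ge> 1"
  shows "strict_seq (\<lambda>_. m)"
proof -
  have "admissible (\<lambda>_. m)"
    using assms by (auto simp: admissible_def infinite_seq_def shift_def)
  then show ?thesis
    using assms by (intro strict_seqI lex_lessI[of _ 0]) auto
qed

lemma quasi_greedy_of_nat:
  assumes "m \<ge> 1"
  shows "quasi_greedy (real m + 1) = (\<lambda>_. m)"
proof (rule quasi_greedyI)
  show "1 < real m + 1" using assms by simp
  then have "val (real m + 1) (\<lambda>_. m) = 1"
    using sums_unique[OF geometric_div_sums[of "real m + 1" "real m"]] assms by (simp add: val_def)
  then show "val (real m + 1) (\<lambda>_. m) = 1"
    "0 < val (real m + 1) (shift n (\<lambda>_. m))" "val (real m + 1) (shift n (\<lambda>_. m)) \<le> 1" for n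
    by (simp_all add: shift_def)
qed simp

lemma quasi_greedy_const:
  assumes "1 < q" "\<And>i. quasi_greedy q i = m"
  shows "m \<ge> 1" "q = real m + 1"
proof -
  have q: "quasi_greedy q = (\<lambda>_. m)" using assms(2) by auto
  show m: "m \<ge> 1" using admissible_first_pos[OF admissible_quasi_greedy[OF assms(1)]] assms(2) by simp
  then have "quasi_greedy (real m + 1) = quasi_greedy q" using quasi_greedy_of_nat q by simp
  then show "q = real m + 1"
    using quasi_greedy_less_iff[of "real m + 1" q] quasi_greedy_less_iff[of q "real m + 1"] assms(1) m
    by (metis add_increasing lex.less_irrefl less_add_same_cancel2 linorder_neqE_linordered_idom of_nat_0_less_iff
        zero_less_one order_less_le_trans zero_less_iff_neq_zero)
qed

text \<open>An endpoint outside \<open>\<V>\<close> and other than \<open>1\<close> could be added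
  to the interval, against maximality. Conversely, a larger connected set would contain an endpoint,
  which the open set omits.\<close>

lemma component_V_iff:
  "component_V p r \<longleftrightarrow> p < r \<and> 1 \<le> p \<and> (p = 1 \<or> p \<in> bases_V) \<and> r \<in> bases_V \<and> {p<..<r} \<inter> bases_V = {}"
proof
  let ?S = "{1<..} - bases_V"
  assume "component_V p r"
  then have C: "{p<..<r} \<in> components ?S" by (simp add: component_V_def)
  have ne: "p < r" using in_components_nonempty[OF C] by simp
  have sub: "{p<..<r} \<subseteq> ?S" using in_components_subset[OF C] .
  have max: "d = {p<..<r}" if "d \<noteq> {}" "d \<subseteq> ?S" "connected d" "{p<..<r} \<subseteq> d" for d
    using C that unfolding in_components_maximal by blast
  have p1: "1 \<le> p"
  proof (rule ccontr)
    assume "\<not> 1 \<le> p"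
    then have "(p + min r 1) / 2 \<in> {p<..<r}" "(p + min r 1) / 2 < 1" using ne by auto
    then show False using sub by fastforce
  qed
  have "p = 1 \<or> p \<in> bases_V"
  proof (rule ccontr)
    assume "\<not> (p = 1 \<or> p \<in> bases_V)"
    then have "p \<in> ?S" using p1 by simp
    then have "{p..<r} \<subseteq> ?S" using sub by (force simp: le_less)
    then have "{p..<r} = {p<..<r}" using ne by (intro max) auto
    then show False using ne by (metis atLeastLessThan_iff greaterThanLessThan_iff order_refl less_irrefl)
  qed
  moreover have "r \<in> bases_V"
  proof (rule ccontr)
    assume "r \<notin> bases_V"
    then have "r \<in> ?S" using p1 ne by simp
    then have "{p<..r} \<subseteq> ?S" using sub by (force simp: le_less)
    then have "{p<..r} = {p<..<r}" using ne by (intro max) auto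
    then show False using ne by (metis greaterThanAtMost_iff greaterThanLessThan_iff order_refl less_irrefl)
  qed
  ultimately show "p < r \<and> 1 \<le> p \<and> (p = 1 \<or> p \<in> bases_V) \<and> r \<in> bases_V \<and> {p<..<r} \<inter> bases_V = {}"
    using ne sub p1 by auto
next
  let ?S = "{1<..} - bases_V"
  assume *: "p < r \<and> 1 \<le> p \<and> (p = 1 \<or> p \<in> bases_V) \<and> r \<in> bases_V \<and> {p<..<r} \<inter> bases_V = {}"
  have "d = {p<..<r}" if d: "d \<subseteq> ?S" "connected d" "{p<..<r} \<subseteq> d" for d
  proof (rule ccontr)
    assume "d \<noteq> {p<..<r}"
    then have "\<not> d \<subseteq> {p<..<r}" using d(3) by blast
    then obtain x where x: "x \<in> d" "\<not> (p < x \<and> x < r)"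
      by (metis greaterThanLessThan_iff subsetI)
    define y where "y = (p + r) / 2"
    have y: "p < y" "y < r" "y \<in> d" using * d(3) by (auto simp: y_def)
    have int: "z \<in> d" if "u \<in> d" "v \<in> d" "u \<le> z" "z \<le> v" for u v z
      using d(2) that unfolding connected_iff_interval by blast
    have "p \<in> d \<or> r \<in> d" using x y int[of x y p] int[of y x r] by force
    then show False using d(1) * by auto
  qed
  then show "component_V p r"
    unfolding component_V_def in_components_maximal using * by auto
qed

text \<open>The endpoints are the nearest points of the closed set on either side; on the right
  there is one because large integers belong to \<open>\<V>\<close>.\<close>

lemma component_V_exists:
  assumes q: "1 < q" "q \<notin> bases_V"
  obtains p r where "component_V p r" "p < q" "q < r"
proof -
  let ?T = "{..1} \<union> bases_V"
  define P where "P = ?T \<inter> {..q}"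
  define R where "R = ?T \<inter> {q..}"
  have "closed P" "closed R" unfolding P_def R_def by (intro closed_Int closed_V_Un closed_atMost closed_atLeast)+
  have P1: "1 \<in> P" using q by (simp add: P_def)
  have bP: "bdd_above P" by (auto simp: P_def intro: bdd_aboveI[of _ q])
  have bR: "bdd_below R" by (auto simp: R_def intro: bdd_belowI[of _ q])
  obtain m :: nat where m: "q < real m" using reals_Archimedean2 by blast
  then have "m \<ge> 1" using q by linarith
  then have "real m + 1 \<in> bases_V"
    unfolding mem_V_iff using quasi_greedy_of_nat strict_imp_V[OF const_seq] by simp
  then have R1: "real m + 1 \<in> R" using m by (simp add: R_def)
  have SP: "Sup P \<in> P" using closed_contains_Sup[OF _ bP \<open>closed P\<close>] P1 by blast
  have IR: "Inf R \<in> R" using closed_contains_Inf[OF _ bR \<open>closed R\<close>] R1 by blast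
  have "1 \<le> Sup P" using cSup_upper[OF P1 bP] .
  have q': "Sup P < q" "q < Inf R"
    using SP IR q by (auto simp: P_def R_def less_le)
  have "component_V (Sup P) (Inf R)"
    unfolding component_V_iff
  proof (intro conjI)
    show "Sup P < Inf R" using q' by simp
    show "1 \<le> Sup P" by fact
    show "Sup P = 1 \<or> Sup P \<in> bases_V" using SP \<open>1 \<le> Sup P\<close> by (auto simp: P_def)
    show "Inf R \<in> bases_V" using IR q by (auto simp: R_def)
    have "v \<notin> bases_V" if "Sup P < v" "v < Inf R" for v
    proof
      assume "v \<in> bases_V"
      then have "v \<in> P \<or> v \<in> R" by (auto simp: P_def R_def)
      then show False using cSup_upper[OF _ bP, of v] cInf_lower[OF _ bR, of v] that by auto
    qed
    then show "{Sup P<..<Inf R} \<inter> bases_V = {}" by auto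
  qed
  then show ?thesis using that q' by blast
qed

lemma component_V_of_right_gap:
  assumes q: "q = 1 \<or> q \<in> bases_V" and r: "q < r" "{q<..<r} \<inter> bases_V = {}"
  obtains r' where "component_V q r'"
proof -
  have q1: "1 \<le> q" using q by (auto simp: mem_V_iff)
  define y where "y = (q + r) / 2"
  have y: "q < y" "y < r" using r by (auto simp: y_def)
  then have "1 < y" "y \<notin> bases_V" using q1 r(2) by auto
  then obtain p r' where pr: "component_V p r'" "p < y" "y < r'" using component_V_exists by blast
  have "p = q"
  proof (rule ccontr)
    assume "p \<noteq> q"
    then consider "q < p" | "p < q" by linarith
    then show False
    proof cases
      case 1
      then have "p \<in> bases_V" using pr(1) q1 unfolding component_V_iff by auto
      moreover have "p \<in> {q<..<r}" using 1 pr(2) y by simp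
      ultimately show False using r(2) by blast
    next
      case 2
      then have "q \<in> bases_V" using pr(1) q unfolding component_V_iff by auto
      moreover have "q < r'" using y pr by simp
      ultimately show False using 2 pr(1) unfolding component_V_iff by auto
    qed
  qed
  then show ?thesis using that pr(1) by blast
qed

lemma component_V_left_unique:
  assumes "component_V p r" "component_V p' r"
  shows "p = p'"
proof (rule ccontr)
  assume "p \<noteq> p'"
  then consider "p < p'" | "p' < p" by linarith
  then show False
    using assms unfolding component_V_iff by cases auto
qed

text \<open>Take \<open>n\<close> least such that the tail at \<open>n + 1\<close> is the reflection
  of \<open>A\<close>. Leastness gives dominance, hence \<open>lower n A\<close> in
  \<open>\<V>\<close>, and \<open>no_V_between\<close> empties the gap. If \<open>n = 0\<close> and
  \<open>A 0 = 1\<close>, the lowered sequence is zero and belongs to no base; the component then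
  starts at \<open>1\<close>.\<close>

lemma component_of_not_strict:
  assumes r: "r \<in> bases_V" and A: "A = quasi_greedy r" "\<not> strict_seq A"
  obtains n p where "component_V p r" "dominated 0 (mirror (A 0) A) A n" "shift (Suc n) A = mirror (A 0) A"
    "n = 0 \<and> A 0 = 1 \<and> p = 1 \<or> (n \<ge> 1 \<or> A 0 \<ge> 2) \<and> p \<in> bases_V \<and> quasi_greedy p = lower n A"
proof -
  have r1: "1 < r" and V: "V_seq A" using r A by (auto simp: mem_V_iff)
  have adm: "admissible A" using V by (simp add: V_seq_def)
  have Am: "\<forall>i. A i \<le> A 0" using admissible_le_first[OF adm] by simp
  define P where "P = (\<lambda>n. mirror (A 0) (shift (Suc n) A) = A)"
  obtain k where "k \<ge> 1" "mirror (A 0) (shift k A) = A" using V_not_strict[OF V A(2)] .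
  then have "P (k - 1)" by (simp add: P_def)
  define n where "n = (LEAST n. P n)"
  have Pn: "mirror (A 0) (shift (Suc n) A) = A"
    using LeastI[of P, OF \<open>P (k - 1)\<close>] unfolding n_def P_def by simp
  have min: "mirror (A 0) (shift k A) \<noteq> A" if "k \<ge> 1" "k \<le> n" for k
    using not_less_Least[of "k - 1" P] that unfolding n_def[symmetric] by (auto simp: P_def)
  have dom: "dominated 0 (mirror (A 0) A) A n" by (rule mirror_period_dominated[OF V Pn min])
  have sA: "shift (Suc n) A = mirror (A 0) A" using arg_cong[OF Pn, of "mirror (A 0)"] Am by simp
  have An: "A n > 0" using dominated_last_pos[OF dom] Am by simp
  note gap = no_V_between[OF adm sA]
  show ?thesis
  proof (cases "n \<ge> 1 \<or> A 0 \<ge> 2")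
    case True
    have lV: "V_seq (lower n A)"
    proof (cases "n \<ge> 1")
      case False
      then have "n = 0" by simp
      then have "lower n A = (\<lambda>_. A 0 - 1)" by (simp add: lower_def cycle_def fun_eq_iff)
      then show ?thesis using strict_imp_V[OF const_seq[of "A 0 - 1"]] True False by simp
    qed (rule lower_V[OF adm dom])
    then obtain p where p: "1 < p" "p < r" "quasi_greedy p = lower n A"
      using base_below[OF r1, of "lower n A"] lower_less[of A n] An A by (auto simp: V_seq_def)
    have "v \<notin> bases_V" if "p < v" "v < r" for v
      using gap[of "quasi_greedy v"] that p A(1) quasi_greedy_strict_mono[of p v] quasi_greedy_strict_mono[of v r]
      by (auto simp: mem_V_iff)
    moreover have "p \<in> bases_V" using p lV by (simp add: mem_V_iff)
    ultimately have "component_V p r" using p r unfolding component_V_iff by auto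
    then show ?thesis using that dom sA True p \<open>p \<in> bases_V\<close> by blast
  next
    case False
    then have "n = 0" by simp
    then have n: "n = 0" "A 0 = 1" using An False by auto
    then have low: "lower n A = (\<lambda>_. 0)" by (simp add: lower_def cycle_def fun_eq_iff)
    have "v \<notin> bases_V" if "1 < v" "v < r" for v
    proof
      assume "v \<in> bases_V"
      then have v: "V_seq (quasi_greedy v)" by (simp add: mem_V_iff)
      then have "lower n A \<sqsubset> quasi_greedy v"
        using admissible_first_pos[of "quasi_greedy v"] low
        by (intro lex_lessI[of _ 0]) (auto simp: V_seq_def)
      then show False using gap v quasi_greedy_strict_mono[OF that] A by blast
    qed
    then have "component_V 1 r" using r r1 unfolding component_V_iff by auto
    then show ?thesis using that dom sA n by blast
  qed
qed

text \<open>A strict sequence is a limit from below of sequences in \<open>\<V>\<close>, so no gap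
  can end at its base.\<close>

lemma component_right_not_strict:
  assumes "component_V p r"
  shows "\<not> strict_seq (quasi_greedy r)"
proof
  let ?A = "quasi_greedy r"
  assume s: "strict_seq ?A"
  have C: "p < r" "1 \<le> p" "{p<..<r} \<inter> bases_V = {}" using assms by (auto simp: component_V_iff)
  define y where "y = (p + r) / 2"
  have y: "1 < y" "p < y" "y < r" using C by (auto simp: y_def)
  obtain N where N: "quasi_greedy y N < ?A N" "\<forall>j<N. quasi_greedy y j = ?A j"
    using quasi_greedy_strict_mono[OF y(1,3)] by (rule lex_lessE)
  obtain b where b: "V_seq b" "b \<sqsubset> ?A" "\<forall>j<Suc N. b j = ?A j" using strict_left_limit[OF s] by blast
  obtain v where v: "1 < v" "v < r" "quasi_greedy v = b"
    using base_below[of r b] b y by (auto simp: V_seq_def)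
  have "quasi_greedy y \<sqsubset> quasi_greedy v" by (rule lex_lessI[of _ N]) (use N b v in auto)
  then have "y < v" using quasi_greedy_less_iff[OF y(1) v(1)] by simp
  then have "v \<in> {p<..<r}" using v y by simp
  moreover have "v \<in> bases_V" using v b by (simp add: mem_V_iff)
  ultimately show False using C(3) by blast
qed

text \<open>The quasi-greedy expansion \<open>(10)\<^sup>\<infinity>\<close> for the golden ratio.
  It serves later also as a tail in which both \<open>0\<close> and \<open>1\<close> recur.\<close>

definition golden_seq :: "nat \<Rightarrow> nat" where
  "golden_seq i = (if even i then 1 else 0)"

lemma first_component: obtains r where "component_V 1 r"
proof -
  let ?A = golden_seq
  have odd: "mirror 1 (shift k ?A) = ?A" if "odd k" for k
    using that by (auto simp: golden_seq_def fun_eq_iff)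
  have even: "shift k ?A = ?A" if "even k" for k
    using that by (auto simp: golden_seq_def fun_eq_iff)
  have A01: "?A 0 = 1" "?A 1 = 0" by (auto simp: golden_seq_def)
  have inf: "infinite_seq ?A" by (rule infinite_seq_period[OF even[of 2], of 0]) (auto simp: A01)
  have "shift k ?A \<sqsubseteq> ?A" for k
  proof (cases "even k")
    case False
    then have "shift k ?A \<sqsubset> ?A" by (intro lex_lessI[of _ 0]) (auto simp: golden_seq_def)
    then show ?thesis by (rule lex.less_imp_le)
  qed (simp add: even)
  with inf have adm: "admissible ?A" by (simp add: admissible_def)
  have "mirror 1 (shift k ?A) \<sqsubseteq> ?A" for k
  proof (cases "even k")
    case True
    then have "mirror 1 (shift k ?A) \<sqsubset> ?A" by (intro lex_lessI[of _ 0]) (auto simp: golden_seq_def)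
    then show ?thesis by (rule lex.less_imp_le)
  next
    case False
    then show ?thesis using odd[of k] by (metis lex.order_refl)
  qed
  then have V: "V_seq ?A" using adm A01 by (simp add: V_seq_def)
  have ns: "\<not> strict_seq ?A" using odd[of 1] A01 unfolding strict_seq_def by (metis lex.less_irrefl odd_one)
  obtain r where r: "1 < r" "quasi_greedy r = ?A" using quasi_greedy_surj[OF adm] .
  have rV: "r \<in> bases_V" using r V by (simp add: mem_V_iff)
  obtain n p where np: "component_V p r" "dominated 0 (mirror (?A 0) ?A) ?A n"
    "n = 0 \<and> ?A 0 = 1 \<and> p = 1 \<or> (n \<ge> 1 \<or> ?A 0 \<ge> 2) \<and> p \<in> bases_V \<and> quasi_greedy p = lower n ?A"
    using component_of_not_strict[OF rV, of ?A] r ns by metis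
  show ?thesis
  proof (cases "p = 1")
    case False
    then have "n \<ge> 1" using np(3) A01 by auto
    \<comment> \<open>From position \<open>1\<close> the reflected sequence is
      \<open>golden_seq\<close> itself, so dominance at \<open>k = 1\<close> is impossible.\<close>
    then obtain i where "1 + i \<le> n" "1 - ?A (1 + i) < ?A i" "\<forall>j<i. 1 - ?A (1 + j) = ?A j"
      using np(2)[unfolded dominated_def, rule_format, of 1] A01 by auto
    then have False by (auto simp: golden_seq_def split: if_splits)
    then show ?thesis ..
  qed (use np that in blast)
qed

text \<open>At a base of \<open>\<V>\<close> whose sequence is not strict a component ends, and a
  gap follows because the sequence is periodic; such a base has a neighbourhood without points of
  \<open>bases_U\<close>. Strict sequences without period belong to \<open>bases_U\<close>, periodic
  ones are approached from below.\<close>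

lemma closure_U_eq: "closure bases_U = {q. 1 < q \<and> strict_seq (quasi_greedy q)}"
proof (intro equalityI subsetI)
  fix q assume q: "q \<in> closure bases_U"
  obtain r0 where r0: "component_V 1 r0" using first_component .
  \<comment> \<open>Keeps the closure away from \<open>1\<close>.\<close>
  have "bases_U \<subseteq> {r0..}"
  proof
    fix u assume "u \<in> bases_U"
    then have "u \<in> bases_V" "1 < u" using U_subset_V by (auto simp: mem_U_iff)
    then show "u \<in> {r0..}" using r0 unfolding component_V_iff by force
  qed
  then have "q \<in> {r0..}" using q closure_minimal closed_atLeast by blast
  then have q1: "1 < q" using r0 by (auto simp: component_V_iff)
  have "closure bases_U \<subseteq> {..1} \<union> bases_V"
    using U_subset_V by (intro closure_minimal closed_V_Un) auto
  then have qV: "q \<in> bases_V" using q q1 by auto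
  have "strict_seq (quasi_greedy q)"
  proof (rule ccontr)
    let ?A = "quasi_greedy q"
    assume ns: "\<not> strict_seq ?A"
    obtain n p where np: "component_V p q" "shift (Suc n) ?A = mirror (?A 0) ?A"
      using component_of_not_strict[OF qV refl ns] by metis
    \<comment> \<open>Reflecting twice gives the period \<open>2 * (n + 1)\<close>.\<close>
    have "shift (Suc n) (shift (Suc n) ?A) = ?A"
      unfolding np(2) using np(2) admissible_le_first[OF admissible_quasi_greedy[OF q1]]
      by (simp add: shift_mirror)
    then have "shift (Suc n + Suc n) ?A = ?A" by (simp only: shift_shift)
    then obtain r where r: "q < r" "{q<..<r} \<inter> bases_V = {}"
      using periodic_base_right_gap[OF q1, of "Suc n + Suc n"] by auto
    have "v \<notin> bases_U" if "v \<in> {p<..<r}" for v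
      using that np(1) r U_subset_V U_strict ns unfolding component_V_iff
      by (cases v q rule: linorder_cases) auto
    then have "bases_U \<inter> {p<..<r} = {}" by blast
    moreover have "q \<in> {p<..<r}" using np(1) r by (auto simp: component_V_iff)
    ultimately show False
      using q open_Int_closure_eq_empty[of "{p<..<r}" bases_U] by auto
  qed
  then show "q \<in> {q. 1 < q \<and> strict_seq (quasi_greedy q)}" using q1 by simp
next
  fix q assume "q \<in> {q. 1 < q \<and> strict_seq (quasi_greedy q)}"
  then have q: "1 < q" "strict_seq (quasi_greedy q)" by auto
  let ?A = "quasi_greedy q"
  note adm = admissible_quasi_greedy[OF q(1)]
  show "q \<in> closure bases_U"
  proof (cases "\<exists>p\<ge>1. shift p ?A = ?A")
    case False
    then have "univ_seq ?A ?A" unfolding univ_seq_self_iff[OF adm] using q(2) by (auto simp: strict_seq_def)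
    then show ?thesis using q closure_subset[of bases_U] by (auto simp: mem_U_iff)
  next
    case True
    then obtain k where k: "k \<ge> 1" "shift k ?A = ?A" by blast
    show ?thesis
      unfolding closure_approachable
    proof (intro allI impI)
      fix e :: real assume e: "0 < e"
      define y where "y = max ((1 + q) / 2) (q - e / 2)"
      have "1 < (1 + q) / 2" using q by simp
      then have y: "1 < y" "y < q" "q - y < e" using q e unfolding y_def by (linarith, auto)
      obtain N where N: "quasi_greedy y N < ?A N" "\<forall>j<N. quasi_greedy y j = ?A j"
        using quasi_greedy_strict_mono[OF y(1,2)] by (rule lex_lessE)
      obtain b where b: "admissible b" "univ_seq b b" "b \<sqsubset> ?A" "\<forall>j<Suc N. b j = ?A j"
        using strict_periodic_U_limit[OF q(2) k(2,1)] by blast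
      obtain v where v: "1 < v" "v < q" "quasi_greedy v = b" using base_below[OF q(1) b(1,3)] .
      have "quasi_greedy y \<sqsubset> quasi_greedy v" by (rule lex_lessI[of _ N]) (use N b v in auto)
      then have "y < v" using quasi_greedy_less_iff[OF y(1) v(1)] by simp
      then have "dist v q < e" using v y by (simp add: dist_real_def)
      moreover have "v \<in> bases_U" using v b by (simp add: mem_U_iff)
      ultimately show "\<exists>v\<in>bases_U. dist v q < e" by blast
    qed
  qed
qed

lemma V_minus_U_periodic:
  assumes "q \<in> bases_V - bases_U"
  obtains k where "k \<ge> 1" "shift k (quasi_greedy q) = quasi_greedy q"
proof (cases "strict_seq (quasi_greedy q)")
  case True
  have q: "1 < q" using assms by (simp add: mem_V_iff)
  have "\<not> univ_seq (quasi_greedy q) (quasi_greedy q)" using assms q by (simp add: mem_U_iff)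
  then show ?thesis
    using True that unfolding univ_seq_self_iff[OF admissible_quasi_greedy[OF q]] strict_seq_def by blast
next
  case False
  let ?A = "quasi_greedy q"
  have q: "1 < q" "V_seq ?A" using assms by (auto simp: mem_V_iff)
  obtain k where k: "k \<ge> 1" "mirror (?A 0) (shift k ?A) = ?A" using V_not_strict[OF q(2) False] .
  have "mirror (?A 0) ?A = shift k ?A"
    using arg_cong[OF k(2), of "mirror (?A 0)"] admissible_le_first[OF admissible_quasi_greedy[OF q(1)]] by simp
  then have "shift k (shift k ?A) = ?A" using k(2) by (metis shift_mirror)
  then show ?thesis using that[of "k + k"] k(1) by simp
qed

lemma nat_bases_U:
  assumes "m \<ge> 2"
  shows "real m \<in> bases_U"
proof -
  define k where "k = m - 1"
  have k: "real m = real k + 1" "k \<ge> 1" using assms by (auto simp: k_def)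
  have "admissible (\<lambda>_. k)" using const_seq[OF k(2)] by (simp add: strict_seq_def)
  then have "univ_seq (\<lambda>_. k) (\<lambda>_. k)"
    using univ_seq_self_iff const_seq[OF k(2)] by (simp add: strict_seq_def)
  then show ?thesis unfolding mem_U_iff using k quasi_greedy_of_nat[OF k(2)] by simp
qed

text \<open>A left endpoint above \<open>1\<close> has the periodic sequence
  \<open>lower n A\<close>; membership in \<open>bases_U\<close> forces this to be constant, so the
  base is an integer. Conversely, integers above \<open>1\<close> and bases of \<open>\<V>\<close>
  outside \<open>bases_U\<close> have periodic sequences, which leave a gap on the right.\<close>

lemma left_endpoints_eq: "left_endpoints = real ` {1..} \<union> (bases_V - bases_U)"
proof (intro equalityI subsetI)
  fix p assume "p \<in> left_endpoints"
  then obtain r where C: "component_V p r" by (auto simp: left_endpoints_def)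
  show "p \<in> real ` {1..} \<union> (bases_V - bases_U)"
  proof (rule ccontr)
    assume *: "p \<notin> real ` {1..} \<union> (bases_V - bases_U)"
    have "p \<noteq> 1" using * by force
    then have p: "p \<in> bases_U" "1 < p" using C * by (auto simp: component_V_iff)
    let ?A = "quasi_greedy r" and ?a = "quasi_greedy p"
    obtain n p' where "component_V p' r" "p' = 1 \<or> quasi_greedy p' = lower n ?A"
      using component_of_not_strict[OF _ refl component_right_not_strict[OF C]] C
      unfolding component_V_iff by metis
    then have "?a = lower n ?A" using component_V_left_unique[OF C] \<open>p \<noteq> 1\<close> by blast
    then have "shift (Suc n) ?a = ?a" using lower_period by simp
    then have "\<forall>i. ?a i = ?a 0"
      using p univ_seq_self_iff[OF admissible_quasi_greedy[OF p(2)]] by (auto simp: mem_U_iff)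
    then have "p = real (?a 0 + 1)" using quasi_greedy_const[OF p(2), of "?a 0"] by simp
    then have "p \<in> real ` {1..}" by (rule image_eqI) simp
    then show False using * by blast
  qed
next
  fix p assume p: "p \<in> real ` {1..} \<union> (bases_V - bases_U)"
  show "p \<in> left_endpoints"
  proof (cases "p = 1")
    case True
    then show ?thesis using first_component by (auto simp: left_endpoints_def)
  next
    case False
    have "p \<in> bases_V \<and> (\<exists>k\<ge>1. shift k (quasi_greedy p) = quasi_greedy p)"
    proof (cases "p \<in> bases_V - bases_U")
      case True
      then show ?thesis using V_minus_U_periodic by blast
    next
      case F: False
      then obtain m where m: "p = real m" "m \<ge> 1" using p by auto
      then obtain k where k: "m = k + 1" "k \<ge> 1" using False by (cases m) (auto simp: Suc_le_eq)
      then have "quasi_greedy p = (\<lambda>_. k)" using quasi_greedy_of_nat[OF k(2)] m by (simp add: add.commute)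
      then have "shift 1 (quasi_greedy p) = quasi_greedy p" by (simp add: shift_def)
      moreover have "p \<in> bases_V" using nat_bases_U[of m] U_subset_V m k by auto
      ultimately show ?thesis by blast
    qed
    then obtain k where k: "p \<in> bases_V" "k \<ge> 1" "shift k (quasi_greedy p) = quasi_greedy p" by blast
    then have "1 < p" by (simp add: mem_V_iff)
    then obtain r where "p < r" "{p<..<r} \<inter> bases_V = {}"
      using periodic_base_right_gap[OF _ k(3,2)] by blast
    then show ?thesis using component_V_of_right_gap[of p r] k(1) by (auto simp: left_endpoints_def)
  qed
qed

lemma right_endpoints_eq: "right_endpoints = bases_V - closure bases_U"
proof (intro equalityI subsetI)
  fix r assume "r \<in> right_endpoints"
  then obtain p where "component_V p r" by (auto simp: right_endpoints_def)
  then show "r \<in> bases_V - closure bases_U"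
    using component_right_not_strict unfolding closure_U_eq by (auto simp: component_V_iff)
next
  fix r assume "r \<in> bases_V - closure bases_U"
  then have "r \<in> bases_V" "\<not> strict_seq (quasi_greedy r)" by (auto simp: closure_U_eq mem_V_iff)
  then show "r \<in> right_endpoints"
    using component_of_not_strict[OF _ refl] unfolding right_endpoints_def by blast
qed

lemma closure_U_subset_V: "closure bases_U \<subseteq> bases_V"
  using strict_imp_V by (auto simp: closure_U_eq mem_V_iff)

lemma complement_closure_U:
  "{1<..} - closure bases_U = \<Union> {{q\<^sub>1<..q\<^sub>2} | q\<^sub>1 q\<^sub>2. component_V q\<^sub>1 q\<^sub>2}"
proof (intro equalityI subsetI)
  fix q assume q: "q \<in> {1<..} - closure bases_U"
  have "\<exists>p r. component_V p r \<and> q \<in> {p<..r}"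
  proof (cases "q \<in> bases_V")
    case True
    then have "q \<in> right_endpoints" using q right_endpoints_eq by auto
    then show ?thesis unfolding right_endpoints_def by (auto simp: component_V_iff)
  next
    case False
    then obtain p r where "component_V p r" "p < q" "q < r" using component_V_exists[of q] q by auto
    then show ?thesis by force
  qed
  then show "q \<in> \<Union> {{q\<^sub>1<..q\<^sub>2} | q\<^sub>1 q\<^sub>2. component_V q\<^sub>1 q\<^sub>2}" by blast
next
  fix q assume "q \<in> \<Union> {{q\<^sub>1<..q\<^sub>2} | q\<^sub>1 q\<^sub>2. component_V q\<^sub>1 q\<^sub>2}"
  then obtain p r where pr: "component_V p r" "q \<in> {p<..r}" by blast
  have "q \<notin> closure bases_U"
  proof (cases "q = r")
    case True
    then have "q \<in> right_endpoints" using pr by (auto simp: right_endpoints_def)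
    then show ?thesis using right_endpoints_eq by blast
  next
    case False
    then have "q \<in> {p<..<r}" using pr by simp
    then have "q \<notin> bases_V" using pr(1) unfolding component_V_iff by blast
    then show ?thesis using closure_U_subset_V by blast
  qed
  then show "q \<in> {1<..} - closure bases_U" using pr by (auto simp: component_V_iff)
qed

section \<open>The topology of the univoque sets\<close>

lemma open_cylinder: "open {d :: nat \<Rightarrow> nat. \<forall>j<n. d j = c j}"
  using product_topology_basis'[of "{..<n}" "\<lambda>j. {c j}" "\<lambda>j. j"]
  by (simp add: open_discrete Ball_def)

lemma compact_digits: "compact {c :: nat \<Rightarrow> nat. \<forall>i. c i \<le> m}"
proof -
  have "compactin (product_topology (\<lambda>i. euclidean) UNIV) (PiE UNIV (\<lambda>_ :: nat. {..m}))"
    unfolding compactin_PiE by (auto intro: finite_imp_compact)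
  moreover have "PiE UNIV (\<lambda>_ :: nat. {..m}) = {c. \<forall>i. c i \<le> m}" by auto
  ultimately show ?thesis by (simp add: euclidean_product_topology)
qed

lemma small_tail:
  fixes q e C :: real
  assumes "1 < q" "0 < e"
  obtains n where "C / q ^ n < e"
proof -
  have "(\<lambda>n. C * (1 / q) ^ n) \<longlonglongrightarrow> 0"
    using assms by (intro tendsto_mult_right_zero LIMSEQ_realpow_zero) auto
  then have "\<forall>\<^sub>F n in sequentially. C * (1 / q) ^ n < e"
    using assms(2) by (rule order_tendstoD(2))
  then obtain n where "C * (1 / q) ^ n < e" by (meson eventually_sequentially order_refl)
  then show ?thesis using that by (simp add: power_divide)
qed

lemma continuous_val:
  assumes q: "1 < q"
  shows "continuous_on {c. \<forall>i. c i \<le> m} (val q)"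
  unfolding continuous_on_topological
proof (intro ballI allI impI)
  fix c B assume c: "c \<in> {c. \<forall>i. c i \<le> m}" and B: "open B" "val q c \<in> B"
  obtain e where e: "e > 0" "ball (val q c) e \<subseteq> B" using B by (meson open_contains_ball)
  obtain n where n: "real m / (q - 1) / q ^ n < e" using small_tail[OF q e(1)] .
  have "val q d \<in> B" if d: "\<forall>i. d i \<le> m" "\<forall>j<n. d j = c j" for d
  proof -
    have "\<bar>val q c - val q d\<bar> \<le> real m / (q - 1) / q ^ n"
      using c d by (intro val_agree_abs_le[OF q]) auto
    then have "val q d \<in> ball (val q c) e" using n by (simp add: dist_real_def)
    then show ?thesis using e by blast
  qed
  then show "\<exists>A. open A \<and> c \<in> A \<and> (\<forall>d\<in>{c. \<forall>i. c i \<le> m}. d \<in> A \<longrightarrow> val q d \<in> B)"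
    by (intro exI[of _ "{d. \<forall>j<n. d j = c j}"]) (auto simp: open_cylinder)
qed

lemma closed_seqI:
  assumes "\<And>c :: nat \<Rightarrow> nat. c \<notin> W \<Longrightarrow> \<exists>n. \<forall>d. (\<forall>j<n. d j = c j) \<longrightarrow> d \<notin> W"
  shows "closed W"
  unfolding closed_def
proof (subst open_subopen, intro ballI)
  fix c assume "c \<in> - W"
  then obtain n where "\<forall>d. (\<forall>j<n. d j = c j) \<longrightarrow> d \<notin> W" using assms by blast
  then show "\<exists>T. open T \<and> c \<in> T \<and> T \<subseteq> - W"
    by (intro exI[of _ "{d. \<forall>j<n. d j = c j}"]) (auto simp: open_cylinder)
qed

lemma closed_val_image:
  assumes q: "1 < q" and W: "closed W" "\<And>c i. c \<in> W \<Longrightarrow> c i \<le> m"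
  shows "closed (val q ` W)"
proof -
  have "compact ({c. \<forall>i. c i \<le> m} \<inter> W)" by (rule compact_Int_closed[OF compact_digits W(1)])
  moreover have "{c. \<forall>i. c i \<le> m} \<inter> W = W" using W(2) by auto
  ultimately have "compact W" by simp
  moreover have "continuous_on W (val q)"
    by (rule continuous_on_subset[OF continuous_val[OF q]]) (use W(2) in auto)
  ultimately show ?thesis by (intro compact_imp_closed compact_continuous_image)
qed

text \<open>The digit sequences that do not start like \<open>c\<close> have a compact set of
  values. It misses \<open>val q c\<close>, since no other digit sequence represents this number,
  and its complement is the isolating neighbourhood.\<close>

lemma isolated_val:
  assumes q: "1 < q" and A: "A = quasi_greedy q" and c: "univ_seq A c"
    and iso: "\<And>d. \<lbrakk>univ_seq A d; \<And>j. j < n \<Longrightarrow> d j = c j\<rbrakk> \<Longrightarrow> d = c"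
  shows "val q c isolated_in univoque_set q"
proof -
  define W where "W = {d. \<forall>i. d i \<le> A 0} \<inter> - {d. \<forall>j<n. d j = c j}"
  have "closed {d :: nat \<Rightarrow> nat. \<forall>i. d i \<le> A 0}"
  proof (rule closed_seqI)
    fix c :: "nat \<Rightarrow> nat" assume "c \<notin> {d. \<forall>i. d i \<le> A 0}"
    then obtain i where "\<not> c i \<le> A 0" by blast
    then show "\<exists>n. \<forall>d. (\<forall>j<n. d j = c j) \<longrightarrow> d \<notin> {d. \<forall>i. d i \<le> A 0}"
      by (metis (mono_tags, lifting) lessI mem_Collect_eq)
  qed
  then have "closed W" unfolding W_def using open_cylinder by (intro closed_Int) auto
  then have cl: "closed (val q ` W)" by (rule closed_val_image[OF q]) (auto simp: W_def)
  have nW: "val q c \<notin> val q ` W"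
    using univ_seq_inj[OF q A c] by (auto simp: W_def)
  have U: "univoque_set q = val q ` {c. univ_seq A c}" by (rule univoque_set_eq[OF q A])
  have only: "d = c" if "univ_seq A d" "val q d \<notin> val q ` W" for d
  proof (rule iso[OF that(1)])
    have "d \<notin> W" "\<forall>i. d i \<le> A 0" using that by (auto simp: univ_seq_def)
    then show "d j = c j" if "j < n" for j using that by (auto simp: W_def)
  qed
  have "- (val q ` W) \<inter> univoque_set q = {val q c}"
  proof (intro equalityI subsetI)
    fix x assume "x \<in> - (val q ` W) \<inter> univoque_set q"
    then have x: "x \<notin> val q ` W" "x \<in> val q ` {c. univ_seq A c}" unfolding U by simp_all
    then obtain d where d: "univ_seq A d" "x = val q d" by (elim imageE) simp
    then show "x \<in> {val q c}" using only[of d] x(1) by simp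
  next
    fix x assume "x \<in> {val q c}"
    then show "x \<in> - (val q ` W) \<inter> univoque_set q" using nW c unfolding U by simp
  qed
  moreover have "val q c \<in> univoque_set q" unfolding U using c by simp
  moreover have "open (- (val q ` W))" using cl by (rule open_Compl)
  ultimately show ?thesis unfolding isolated_in_def by blast
qed

lemma val_closure:
  assumes q: "1 < q" and c: "\<And>i. c i \<le> m"
    and D: "\<And>n. \<exists>d. d \<in> D \<and> (\<forall>i. d i \<le> m) \<and> (\<forall>j<n. d j = c j)"
  shows "val q c \<in> closure (val q ` D)"
  unfolding closure_approachable
proof (intro allI impI)
  fix e :: real assume "0 < e"
  then obtain n where n: "real m / (q - 1) / q ^ n < e" using small_tail[OF q] by blast
  obtain d where d: "d \<in> D" "\<forall>i. d i \<le> m" "\<forall>j<n. d j = c j" using D by blast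
  have "\<bar>val q d - val q c\<bar> \<le> real m / (q - 1) / q ^ n"
    using c d by (intro val_agree_abs_le[OF q]) auto
  then have "dist (val q d) (val q c) < e" using n by (simp add: dist_real_def)
  then show "\<exists>y\<in>val q ` D. dist y (val q c) < e" using d by blast
qed

lemma not_isolated_val:
  assumes q: "1 < q" and A: "A = quasi_greedy q" and c: "univ_seq A c"
    and lim: "\<And>n. \<exists>d. univ_seq A d \<and> d \<noteq> c \<and> (\<forall>j<n. d j = c j)"
  shows "\<not> val q c isolated_in univoque_set q"
proof -
  have "val q c \<in> closure (val q ` {d. univ_seq A d \<and> d \<noteq> c})"
  proof (rule val_closure[OF q])
    show "c i \<le> A 0" for i using c by (simp add: univ_seq_def)
    show "\<exists>d. d \<in> {d. univ_seq A d \<and> d \<noteq> c} \<and> (\<forall>i. d i \<le> A 0) \<and> (\<forall>j<n. d j = c j)" for n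
    proof -
      obtain d where "univ_seq A d" "d \<noteq> c" "\<forall>j<n. d j = c j" using lim by blast
      moreover from this have "\<forall>i. d i \<le> A 0" by (simp add: univ_seq_def)
      ultimately show ?thesis by blast
    qed
  qed
  moreover have "val q ` {d. univ_seq A d \<and> d \<noteq> c} \<subseteq> univoque_set q - {val q c}"
    using univ_seq_inj[OF q A c] unfolding univoque_set_eq[OF q A] by (auto simp: univ_seq_def)
  ultimately have "val q c \<in> closure (univoque_set q - {val q c})" using closure_mono by blast
  then show ?thesis unfolding isolated_in_islimpt_iff islimpt_in_closure by simp
qed

lemma isolated_in_closure:
  assumes "x isolated_in closure S"
  shows "x isolated_in S"
proof -
  obtain T where T: "open T" "T \<inter> closure S = {x}" using assms by (auto simp: isolated_in_def)
  then have "T \<inter> S \<noteq> {}" using open_Int_closure_eq_empty[of T S] by auto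
  moreover have "T \<inter> S \<subseteq> {x}" using T closure_subset[of S] by blast
  ultimately have "T \<inter> S = {x}" by blast
  then show ?thesis using T by (auto simp: isolated_in_def)
qed

lemma univ_seq_zero: "A 0 > 0 \<Longrightarrow> univ_seq A (\<lambda>_. 0)"
  unfolding univ_seq_def by (auto intro: lex_lessI[of _ 0])

lemma univoque_set_nonempty:
  assumes "1 < q"
  shows "univoque_set q \<noteq> {}"
  using univ_seq_zero[of "quasi_greedy q", OF admissible_first_pos[OF admissible_quasi_greedy[OF assms]]]
  unfolding univoque_set_eq[OF assms refl] by auto

section \<open>Switch regions and empty interior\<close>

lemma val_join:
  assumes q: "1 < q" and c: "\<forall>i. c i \<le> m" and d: "\<forall>i. d i \<le> m"
  shows "val q (join n c d) = (\<Sum>i<n. real (c i) / q ^ Suc i) + val q d / q ^ n"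
proof -
  have "\<forall>i. join n c d i \<le> m" using c d by (simp add: join_def)
  then have "val q (join n c d) = (\<Sum>i<n. real (join n c d i) / q ^ Suc i) + val q d / q ^ n"
    using val_split[OF q, of "join n c d" m n] by (simp add: shift_join)
  then show ?thesis by simp
qed

text \<open>In this range the expansion can go on with the digit \<open>0\<close> and a tail of
  value \<open>z\<close>, or with the digit \<open>1\<close> and a tail of value
  \<open>z - 1\<close>.\<close>

lemma switch_region_not_univoque:
  assumes q: "1 < q" and m: "m = top_digit q" and c: "\<forall>i. c i \<le> m"
    and z: "1 \<le> z" "z \<le> real m / (q - 1)"
  shows "(\<Sum>i<n. real (c i) / q ^ Suc i) + z / q ^ Suc n \<notin> univoque_set q"
proof
  let ?x = "(\<Sum>i<n. real (c i) / q ^ Suc i) + z / q ^ Suc n"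
  assume u: "?x \<in> univoque_set q"
  have m1: "1 \<le> m" "q \<le> real m + 1" using top_digit_bounds[OF q] m by auto
  obtain e where e: "\<forall>i. e i \<le> m" "val q e = z" using exists_expansion[OF q m1(2), of z] z by auto
  obtain f where f: "\<forall>i. f i \<le> m" "val q f = z - 1"
    using exists_expansion[OF q m1(2), of "z - 1"] z by auto
  have b: "\<forall>i. join n c (join 1 (\<lambda>_. k) g) i \<le> m" if "k \<le> m" "\<forall>i. g i \<le> m" for k g
    using that c by (simp add: join_def)
  have v: "val q (join n c (join 1 (\<lambda>_. k) g)) =
      (\<Sum>i<n. real (c i) / q ^ Suc i) + (real k + val q g) / q ^ Suc n"
    if "k \<le> m" "\<forall>i. g i \<le> m" for k g
  proof -
    have "\<forall>i. join 1 (\<lambda>_. k) g i \<le> m" using that by (simp add: join_def)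
    then have "val q (join n c (join 1 (\<lambda>_. k) g)) =
        (\<Sum>i<n. real (c i) / q ^ Suc i) + val q (join 1 (\<lambda>_. k) g) / q ^ n"
      using val_join[OF q c] by blast
    moreover have "val q (join 1 (\<lambda>_. k) g) = (real k + val q g) / q"
      using val_join[OF q, of "\<lambda>_. k" m g 1] that by (simp add: add_divide_distrib)
    ultimately show ?thesis by (simp add: mult.commute)
  qed
  have "expansion q ?x (join n c (join 1 (\<lambda>_. 0) e))" "expansion q ?x (join n c (join 1 (\<lambda>_. 1) f))"
    unfolding expansion_iff[OF q] m[symmetric] using b v e f m1 by auto
  then have "join n c (join 1 (\<lambda>_. 0) e) = join n c (join 1 (\<lambda>_. 1) f)"
    using u unfolding univoque_set_def by blast
  then have "join n c (join 1 (\<lambda>_. 0) e) n = join n c (join 1 (\<lambda>_. 1) f) n" by simp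
  then show False by (simp add: join_def)
qed

text \<open>The left end \<open>z = 1\<close> of the switch region with empty prefix.\<close>

lemma inverse_not_univoque:
  assumes q: "1 < q"
  shows "1 / q \<notin> univoque_set q"
proof -
  have "1 \<le> real (top_digit q) / (q - 1)" using top_digit_bounds[OF q] q by (simp add: field_simps)
  then show ?thesis
    using switch_region_not_univoque[OF q refl, of "\<lambda>_. 0" 1 0] by simp
qed

text \<open>At a non-integer base \<open>m / (q - 1) > 1\<close> for the largest digit
  \<open>m\<close>, so switch regions contain open intervals. A small copy lies near every univoque
  point and, being open, misses the closure as well.\<close>

lemma interior_closure_univoque:
  assumes q: "1 < q" "q \<noteq> real (top_digit q) + 1"
  shows "interior (closure (univoque_set q)) = {}"
proof (rule ccontr)
  let ?m = "top_digit q" and ?U = "univoque_set q"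
  assume "interior (closure ?U) \<noteq> {}"
  then have "interior (closure ?U) \<inter> closure ?U \<noteq> {}" using interior_subset by blast
  then have "interior (closure ?U) \<inter> ?U \<noteq> {}"
    using open_Int_closure_eq_empty[of "interior (closure ?U)" ?U] by simp
  then obtain x where x: "x \<in> interior (closure ?U)" "x \<in> ?U" by blast
  obtain c where c: "\<forall>i. c i \<le> ?m" "val q c = x"
    using x(2) unfolding univoque_set_def expansion_iff[OF q(1)] by blast
  obtain e where e: "e > 0" "ball x e \<subseteq> closure ?U"
    using x(1) by (meson mem_interior)
  let ?B = "real ?m / (q - 1)"
  have B: "1 < ?B" using top_digit_bounds[OF q(1)] q by (simp add: field_simps)
  obtain n where n: "?B / q ^ n < e" using small_tail[OF q(1) e(1)] .
  let ?s = "\<Sum>i<n. real (c i) / q ^ Suc i"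
  \<comment> \<open>The open switch region behind the first \<open>n\<close> digits of
    \<open>c\<close>; these digits put it within \<open>?B / q ^ n\<close> of
    \<open>x\<close>.\<close>
  define J where "J = {?s + 1 / q ^ Suc n<..<?s + ?B / q ^ Suc n}"
  have J: "y = ?s + z / q ^ Suc n \<and> 1 < z \<and> z < ?B" if "y \<in> J" "z = (y - ?s) * q ^ Suc n" for y z
  proof -
    have p: "0 < q ^ Suc n" using q by simp
    have "1 / q ^ Suc n < y - ?s" "y - ?s < ?B / q ^ Suc n" using that by (auto simp: J_def)
    then have "1 < z" "z < ?B" unfolding that(2) using p by (simp_all only: pos_divide_less_eq pos_less_divide_eq)
    moreover have "z / q ^ Suc n = y - ?s" using q that(2) by (simp del: power_Suc)
    ultimately show ?thesis by simp
  qed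
  have "J \<subseteq> ball x e"
  proof
    fix y assume y: "y \<in> J"
    define z where "z = (y - ?s) * q ^ Suc n"
    have z: "y = ?s + z / q ^ Suc n" "1 < z" "z < ?B" using J[OF y z_def] by auto
    have xs: "x = ?s + val q (shift n c) / q ^ n" using val_split[OF q(1) c(1), of n] c(2) by simp
    have sc: "0 \<le> val q (shift n c)" "val q (shift n c) \<le> ?B"
      using c(1) q by (auto intro!: val_nonneg val_le)
    have zq: "0 \<le> z / q" "z / q \<le> ?B"
    proof -
      show "0 \<le> z / q" using z q by simp
      have "z / q \<le> z" using z q by (simp add: pos_divide_le_eq)
      then show "z / q \<le> ?B" using z by simp
    qed
    have "\<bar>val q (shift n c) - z / q\<bar> \<le> ?B" using sc zq by (simp add: abs_le_iff)
    then have "\<bar>val q (shift n c) - z / q\<bar> / q ^ n \<le> ?B / q ^ n"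
      using q by (intro divide_right_mono) auto
    moreover have "x - y = (val q (shift n c) - z / q) / q ^ n"
      using xs z(1) by (simp add: diff_divide_distrib)
    then have "\<bar>x - y\<bar> = \<bar>val q (shift n c) - z / q\<bar> / q ^ n" using q by simp
    ultimately show "y \<in> ball x e" using n by (simp add: dist_real_def)
  qed
  then have "J \<subseteq> closure ?U" using e by blast
  moreover have "y \<notin> ?U" if "y \<in> J" for y
  proof -
    define z where "z = (y - ?s) * q ^ Suc n"
    have z: "y = ?s + z / q ^ Suc n" "1 < z" "z < ?B" using J[OF that z_def] by auto
    show ?thesis
      unfolding z(1) by (rule switch_region_not_univoque[OF q(1) refl c(1)]) (use z in auto)
  qed
  then have "J \<inter> ?U = {}" by blast
  then have "J \<inter> closure ?U = {}" using open_Int_closure_eq_empty[of J ?U] by (simp add: J_def)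
  moreover have "1 / q ^ Suc n < ?B / q ^ Suc n"
    by (rule divide_strict_right_mono[OF B]) (use q in simp)
  then have "J \<noteq> {}" unfolding J_def by simp
  ultimately show False by blast
qed

text \<open>The sequence \<open>c\<^sub>0 \<dots> c\<^sub>n\<^sub>-\<^sub>1 (c\<^sub>n - 1) t\<close> stays below the upper bounds satisfied by \<open>c\<close>, and meets
  the lower bounds as soon as the mirror image of \<open>t\<close> is below all tails of \<open>a\<close>.\<close>

lemma decrement_approx:
  assumes a: "\<And>k. shift k a \<sqsubseteq> a" "a 0 \<le> m" and c: "\<And>i. c i \<le> m"
    and lo: "\<And>k. 0 < c k \<Longrightarrow> mirror m (shift (Suc k) c) \<sqsubset> a" and ex: "0 < c i0"
  obtains n where "n \<ge> N" "0 < c n"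
    "\<And>t k. \<lbrakk>k < n; 0 < c k\<rbrakk> \<Longrightarrow>
       mirror m (shift (Suc k) (join (Suc n) (c(n := c n - 1)) t)) \<sqsubset> a \<or>
       (\<exists>j\<le>n. 1 \<le> j \<and>
         (\<forall>i<j. mirror m (shift (Suc k) (join (Suc n) (c(n := c n - 1)) t)) i = a i) \<and>
         shift j (mirror m (shift (Suc k) (join (Suc n) (c(n := c n - 1)) t))) = mirror m t)"
proof -
  \<comment> \<open>Reflected bounds are imposed after nonzero digits only, so dominance is sought
    from the first of them on.\<close>
  define k0 where "k0 = (LEAST i. 0 < c i)"
  have k0: "0 < c k0" unfolding k0_def using ex by (rule LeastI)
  have k0_le: "k0 \<le> k" if "0 < c k" for k unfolding k0_def using that by (rule Least_le)
  have m: "mirror m c k < m \<longleftrightarrow> 0 < c k" for k using c[of k] by simp linarith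
  have "shift k (mirror m c) \<sqsubset> a" if "k \<ge> Suc k0" for k
  proof (rule active_less[OF a])
    show "shift (Suc k) (mirror m c) \<sqsubset> a" if "mirror m c k < m" for k
      using lo that unfolding m by (simp add: shift_mirror)
    show "mirror m c k0 < m" unfolding m by (rule k0)
    show "k0 < k" using that by simp
  qed
  then obtain n where n: "n \<ge> max N (Suc k0)" "dominated (Suc k0) (mirror m c) a n"
    using dominated_frequently[OF a(1)] by metis
  have cn: "0 < c n"
  proof -
    obtain e where "n + e \<le> n" "mirror m c (n + e) < a e"
      using n unfolding dominated_def by (metis max.bounded_iff order_refl)
    then have "mirror m c n < m" using a(2) by simp
    then show ?thesis unfolding m .
  qed
  have "mirror m (shift (Suc k) (join (Suc n) (c(n := c n - 1)) t)) \<sqsubset> a \<or>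
       (\<exists>j\<le>n. 1 \<le> j \<and>
         (\<forall>i<j. mirror m (shift (Suc k) (join (Suc n) (c(n := c n - 1)) t)) i = a i) \<and>
         shift j (mirror m (shift (Suc k) (join (Suc n) (c(n := c n - 1)) t))) = mirror m t)"
    if k: "k < n" "0 < c k" for t k
  proof -
    define d where "d = join (Suc n) (c(n := c n - 1)) t"
    define u where "u = mirror m (shift (Suc k) d)"
    have dj: "d j = c j" if "j < n" for j using that by (simp add: d_def)
    have dn: "d n = c n - 1" by (simp add: d_def)
    obtain e where e: "Suc k + e \<le> n" "m - c (Suc k + e) < a e" "\<forall>j<e. m - c (Suc k + j) = a j"
      using n(2)[unfolded dominated_def, rule_format, of "Suc k"] k0_le[OF k(2)] k(1) by auto
    have uj: "u j = a j" if "j < e" for j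
    proof -
      have "d (Suc k + j) = c (Suc k + j)" using that e(1) by (intro dj) simp
      then show ?thesis using e(3) that by (simp add: u_def)
    qed
    have ue: "u e \<le> a e"
    proof (cases "Suc k + e = n")
      case True
      then have "u e = m - (c n - 1)" using dn by (simp add: u_def)
      then show ?thesis using e(2) True cn c[of n] by auto
    next
      case False
      then have "d (Suc k + e) = c (Suc k + e)" using e(1) by (intro dj) simp
      then show ?thesis using e(2) by (simp add: u_def)
    qed
    show ?thesis
      unfolding d_def[symmetric] u_def[symmetric]
    proof (cases "u e < a e")
      case True
      then have "u \<sqsubset> a" using uj by (rule lex_lessI)
      then show "u \<sqsubset> a \<or> (\<exists>j\<le>n. 1 \<le> j \<and> (\<forall>i<j. u i = a i) \<and> shift j u = mirror m t)" by blast
    next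
      case False
      then have eq: "u e = a e" using ue by simp
      have "Suc k + e = n"
      proof (rule ccontr)
        assume "Suc k + e \<noteq> n"
        then have "d (Suc k + e) = c (Suc k + e)" using e(1) by (intro dj) simp
        then show False using eq e(2) by (simp add: u_def)
      qed
      then have "shift (Suc e) u = mirror m t"
        using shift_join_ge[of "Suc n" 0 "c(n := c n - 1)" t] unfolding u_def d_def
        by (simp add: shift_mirror)
      moreover have "\<forall>i<Suc e. u i = a i" using uj eq by (simp add: less_Suc_eq)
      moreover have "Suc e \<le> n" using e(1) by simp
      ultimately show "u \<sqsubset> a \<or> (\<exists>j\<le>n. 1 \<le> j \<and> (\<forall>i<j. u i = a i) \<and> shift j u = mirror m t)"
        by (intro disjI2 exI[of _ "Suc e"]) simp
    qed
  qed
  then show ?thesis using that[of n] n(1) cn by simp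
qed

lemma decrement_shift_less:
  assumes "k < n" "0 < c n"
  shows "shift (Suc k) (join (Suc n) (c(n := c n - 1)) t) \<sqsubset> shift (Suc k) c"
  by (rule lex_lessI[of _ "n - Suc k"]) (use assms in auto)

section \<open>Approximation by unique expansions\<close>

text \<open>Non-strict bounds by \<open>a = \<alpha>(q\<^sub>1)\<close> over the alphabet of the
  bases in the component; at an integer \<open>q\<^sub>1\<close> the largest digit \<open>m\<close>
  exceeds \<open>a 0\<close>.\<close>

definition weak_seq :: "nat \<Rightarrow> (nat \<Rightarrow> nat) \<Rightarrow> (nat \<Rightarrow> nat) \<Rightarrow> bool" where
  "weak_seq m a c \<longleftrightarrow> (\<forall>i. c i \<le> m) \<and> (\<forall>k. c k < m \<longrightarrow> shift (Suc k) c \<sqsubseteq> a) \<and>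
     (\<forall>k. 0 < c k \<longrightarrow> mirror m (shift (Suc k) c) \<sqsubseteq> a)"

lemma weak_seq_mirror: "weak_seq m a c \<Longrightarrow> weak_seq m a (mirror m c)"
  unfolding weak_seq_def by (auto simp: shift_mirror)

text \<open>Against non-strict bounds a violation is a strict inequality, which shows in a finite
  prefix. This is what makes the univoque sets over a component closed.\<close>

lemma closed_weak_seq: "closed {c. weak_seq m a c}"
proof (rule closed_seqI)
  fix c assume "c \<notin> {c. weak_seq m a c}"
  then consider i where "c i > m" | k where "c k < m" "a \<sqsubset> shift (Suc k) c"
    | k where "0 < c k" "a \<sqsubset> mirror m (shift (Suc k) c)"
    unfolding weak_seq_def by (auto simp: not_le lex.not_le)
  then show "\<exists>n. \<forall>d. (\<forall>j<n. d j = c j) \<longrightarrow> d \<notin> {c. weak_seq m a c}"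
  proof cases
    case 1
    have "\<not> weak_seq m a d" if "\<forall>j<Suc i. d j = c j" for d
      using that 1 unfolding weak_seq_def by (metis lessI not_le)
    then show ?thesis by blast
  next
    case 2
    obtain i where i: "a i < c (Suc k + i)" "\<forall>j<i. c (Suc k + j) = a j"
      using 2(2) by (rule shift_greaterE)
    have "\<not> weak_seq m a d" if d: "\<forall>j<Suc (Suc k + i). d j = c j" for d
    proof -
      have "a \<sqsubset> shift (Suc k) d" by (rule lex_lessI[of _ i]) (use i d in auto)
      moreover have "d k < m" using 2(1) d by simp
      ultimately show ?thesis unfolding weak_seq_def by (meson lex.not_le)
    qed
    then show ?thesis by blast
  next
    case 3
    obtain i where i: "a i < m - c (Suc k + i)" "\<forall>j<i. m - c (Suc k + j) = a j"
      using 3(2) by (rule mirror_shift_greaterE)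
    have "\<not> weak_seq m a d" if d: "\<forall>j<Suc (Suc k + i). d j = c j" for d
    proof -
      have "a \<sqsubset> mirror m (shift (Suc k) d)" by (rule lex_lessI[of _ i]) (use i d in auto)
      moreover have "0 < d k" using 3(1) d by simp
      ultimately show ?thesis unfolding weak_seq_def by (meson lex.not_le)
    qed
    then show ?thesis by blast
  qed
qed

text \<open>Decrement far out and continue with \<open>a\<close> itself: its tails meet all bounds,
  and its reflection is at most every tail of \<open>a\<close>. A constrained reflected tail equal
  to \<open>a\<close> leaves no room for a decrement, hence the second condition on
  \<open>c\<close>.\<close>

lemma weak_approx:
  assumes a: "\<And>k. shift k a \<sqsubseteq> a" "\<And>k. mirror m (shift k a) \<sqsubseteq> a" "a 0 \<le> m"
    and c: "weak_seq m a c" "\<And>k. 0 < c k \<Longrightarrow> mirror m (shift (Suc k) c) \<noteq> a" "0 < c i0"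
  obtains d n where "weak_seq m a d" "\<forall>j<N. d j = c j" "d \<noteq> c" "d n < m" "shift (Suc n) d = a"
proof -
  have cm: "c i \<le> m" for i using c(1) by (simp add: weak_seq_def)
  have am: "\<forall>i. a i \<le> m" using le_first_digit[OF a(1)] a(3) le_trans by blast
  have "mirror m (shift (Suc k) c) \<sqsubset> a" if "0 < c k" for k
    using c(1,2) that unfolding weak_seq_def by (simp add: lex.less_le)
  from decrement_approx[OF a(1,3) cm this c(3), of N]
  obtain n where n: "n \<ge> N" "0 < c n"
    "\<And>t k. \<lbrakk>k < n; 0 < c k\<rbrakk> \<Longrightarrow>
       mirror m (shift (Suc k) (join (Suc n) (c(n := c n - 1)) t)) \<sqsubset> a \<or>
       (\<exists>j\<le>n. 1 \<le> j \<and>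
         (\<forall>i<j. mirror m (shift (Suc k) (join (Suc n) (c(n := c n - 1)) t)) i = a i) \<and>
         shift j (mirror m (shift (Suc k) (join (Suc n) (c(n := c n - 1)) t))) = mirror m t)"
    by metis
  define d where "d = join (Suc n) (c(n := c n - 1)) a"
  have dj: "d j = c j" if "j < n" for j using that by (simp add: d_def)
  have dn: "d n = c n - 1" by (simp add: d_def)
  have sd: "shift (Suc k) d = shift (k - n) a" if "n \<le> k" for k
    using shift_join_ge[of "Suc n" "k - n" "c(n := c n - 1)" a] that by (simp add: d_def)
  have "weak_seq m a d"
    unfolding weak_seq_def
  proof (intro conjI allI impI)
    fix k
    show "d k \<le> m" using cm[of k] cm[of n] am by (auto simp: d_def join_def)
    show "shift (Suc k) d \<sqsubseteq> a" if "d k < m"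
    proof (cases "k < n")
      case True
      then have "shift (Suc k) d \<sqsubset> shift (Suc k) c" unfolding d_def using n(2) by (rule decrement_shift_less)
      moreover have "shift (Suc k) c \<sqsubseteq> a" using c(1) that True dj unfolding weak_seq_def by metis
      ultimately show ?thesis by (meson lex.less_imp_le lex.order_trans)
    qed (use sd a(1) in auto)
    show "mirror m (shift (Suc k) d) \<sqsubseteq> a" if "0 < d k"
    proof (cases "k < n")
      case True
      then have "0 < c k" using that dj by simp
      from n(3)[OF True this, of a, folded d_def] show ?thesis
      proof
        assume "mirror m (shift (Suc k) d) \<sqsubset> a"
        then show ?thesis by (rule lex.less_imp_le)
      next
        assume "\<exists>j\<le>n. 1 \<le> j \<and> (\<forall>i<j. mirror m (shift (Suc k) d) i = a i) \<and>
          shift j (mirror m (shift (Suc k) d)) = mirror m a"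
        then obtain j where j: "\<forall>i<j. mirror m (shift (Suc k) d) i = a i"
          "shift j (mirror m (shift (Suc k) d)) = mirror m a" by blast
        have "mirror m a \<sqsubseteq> shift j a"
          using a(2)[of j] mirror_le_swap[of "shift j a" m a] am by simp
        then show ?thesis
          using lex_le_shift_iff[of j "mirror m (shift (Suc k) d)" a] j by metis
      qed
    qed (use sd a(2) in auto)
  qed
  moreover have "d \<noteq> c" using dn n(2) by auto
  moreover have "d n < m" using dn n(2) cm[of n] by simp
  moreover have "shift (Suc n) d = a" using sd[of n] by simp
  moreover have "\<forall>j<N. d j = c j" using dj n(1) by simp
  ultimately show ?thesis using that by blast
qed

text \<open>With strict bounds \<open>A\<close> itself cannot be the continuation; a sequence of
  \<open>\<V>\<close> below \<open>A\<close> that follows \<open>A\<close> long enough takes its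
  place.\<close>

lemma strict_approx:
  assumes A: "strict_seq A" and c: "univ_seq A c" "0 < c i0"
  obtains d where "univ_seq A d" "\<forall>j<N. d j = c j" "d \<noteq> c"
proof -
  let ?m = "A 0"
  have adm: "admissible A" using A by (simp add: strict_seq_def)
  note As = admissible_shift_le[OF adm]
  have Am: "A i \<le> ?m" for i using admissible_le_first[OF adm] .
  have cm: "c i \<le> ?m" for i using c(1) by (simp add: univ_seq_def)
  have "mirror ?m (shift (Suc k) c) \<sqsubset> A" if "0 < c k" for k
    using c(1) that unfolding univ_seq_def by simp
  from decrement_approx[OF As order_refl cm this c(2), of N]
  obtain n where n: "n \<ge> N" "0 < c n"
    "\<And>t k. \<lbrakk>k < n; 0 < c k\<rbrakk> \<Longrightarrow>
       mirror ?m (shift (Suc k) (join (Suc n) (c(n := c n - 1)) t)) \<sqsubset> A \<or>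
       (\<exists>j\<le>n. 1 \<le> j \<and>
         (\<forall>i<j. mirror ?m (shift (Suc k) (join (Suc n) (c(n := c n - 1)) t)) i = A i) \<and>
         shift j (mirror ?m (shift (Suc k) (join (Suc n) (c(n := c n - 1)) t))) = mirror ?m t)"
    by metis
  have "\<exists>e. ?m - A (j + e) < A e \<and> (\<forall>i<e. ?m - A (j + i) = A i)" for j
  proof -
    have "mirror ?m (shift j A) \<sqsubset> A" using A by (simp add: strict_seq_def)
    then obtain e where "?m - A (j + e) < A e" "\<forall>i<e. ?m - A (j + i) = A i"
      by (auto elim: lex_lessE)
    then show ?thesis by blast
  qed
  then obtain e where e: "\<And>j. ?m - A (j + e j) < A (e j) \<and> (\<forall>i<e j. ?m - A (j + i) = A i)"
    by metis
  \<comment> \<open>Long enough to decide that the reflection of \<open>A\<close> is below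
    \<open>shift j A\<close> for every \<open>j \<le> n\<close>, the lengths of prefix that a
    degraded comparison can have used up.\<close>
  obtain t where t: "V_seq t" "t \<sqsubset> A" "\<forall>i<Suc (Max (e ` {..n})). t i = A i"
    using strict_left_limit[OF A] by blast
  have t0: "t 0 = ?m" using t(3) by simp
  have mt: "mirror ?m t \<sqsubset> shift j A" if "j \<le> n" for j
  proof -
    have "e j \<le> Max (e ` {..n})" using that by simp
    then have te: "t i = A i" if "i \<le> e j" for i using t(3) that by simp
    show ?thesis
    proof (rule lex_lessI[of _ "e j"])
      show "mirror ?m t (e j) < shift j A (e j)"
        using e[of j] te[of "e j"] Am[of "e j"] Am[of "j + e j"] by auto
      fix i assume i: "i < e j"
      then have "?m - A (j + i) = A i" using e by blast
      then show "mirror ?m t i = shift j A i"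
        using te[of i] i Am[of i] Am[of "j + i"] by auto
    qed
  qed
  have ts: "shift k t \<sqsubset> A" for k
    using t(1,2) unfolding V_seq_def admissible_def by (meson lex.le_less_trans)
  have tm: "mirror ?m (shift k t) \<sqsubset> A" for k
    using t(1,2) t0 unfolding V_seq_def by (metis lex.le_less_trans)
  define d where "d = join (Suc n) (c(n := c n - 1)) t"
  have dj: "d j = c j" if "j < n" for j using that by (simp add: d_def)
  have dn: "d n = c n - 1" by (simp add: d_def)
  have sd: "shift (Suc k) d = shift (k - n) t" if "n \<le> k" for k
    using shift_join_ge[of "Suc n" "k - n" "c(n := c n - 1)" t] that by (simp add: d_def)
  have tA: "t i \<le> ?m" for i
    using admissible_le_first[of t i] t(1) t0 by (simp add: V_seq_def)
  have "univ_seq A d"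
    unfolding univ_seq_def
  proof (intro conjI allI impI)
    fix k
    show "d k \<le> ?m" using cm[of k] cm[of n] tA by (auto simp: d_def join_def)
    show "shift (Suc k) d \<sqsubset> A" if "d k < ?m"
    proof (cases "k < n")
      case True
      then have "shift (Suc k) d \<sqsubset> shift (Suc k) c" unfolding d_def using n(2) by (rule decrement_shift_less)
      moreover have "shift (Suc k) c \<sqsubset> A" using c(1) that True dj unfolding univ_seq_def by metis
      ultimately show ?thesis by (rule lex.less_trans)
    qed (use sd ts in auto)
    show "mirror ?m (shift (Suc k) d) \<sqsubset> A" if "0 < d k"
    proof (cases "k < n")
      case True
      then have "0 < c k" using that dj by simp
      from n(3)[OF True this, of t, folded d_def] show ?thesis
      proof
        assume "\<exists>j\<le>n. 1 \<le> j \<and> (\<forall>i<j. mirror ?m (shift (Suc k) d) i = A i) \<and>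
          shift j (mirror ?m (shift (Suc k) d)) = mirror ?m t"
        then obtain j where j: "j \<le> n" "\<forall>i<j. mirror ?m (shift (Suc k) d) i = A i"
          "shift j (mirror ?m (shift (Suc k) d)) = mirror ?m t" by blast
        then show ?thesis
          using lex_less_shift_iff[of j "mirror ?m (shift (Suc k) d)" A] mt[OF j(1)] by metis
      qed
    qed (use sd tm in auto)
  qed
  moreover have "d \<noteq> c" using dn n(2) by auto
  moreover have "\<forall>j<N. d j = c j" using dj n(1) by simp
  ultimately show ?thesis using that by blast
qed

section \<open>Unique expansions over one component\<close>

text \<open>Move a first excess over the periodic \<open>lower n A\<close> to the start of its
  block. As the tail there stays below \<open>A\<close>, the block is that of \<open>A\<close>. The
  tail after it is then below the reflection of \<open>A\<close>, although it follows the positive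
  digit \<open>A n\<close>; this breaks the reflected bound.\<close>

lemma univ_seq_le_lower:
  assumes A: "shift (Suc n) A = mirror (A 0) A" "A n > 0" "\<forall>i. A i \<le> A 0"
    and \<alpha>: "shift (Suc 0) \<alpha> \<sqsubseteq> \<alpha>" "\<alpha> \<sqsubseteq> A" "\<alpha> 0 = A 0"
    and c: "univ_seq \<alpha> c" "c k < A 0"
  shows "shift (Suc k) c \<sqsubseteq> lower n A"
proof (rule ccontr)
  let ?m = "A 0" and ?a = "lower n A"
  assume "\<not> shift (Suc k) c \<sqsubseteq> ?a"
  then have "?a \<sqsubset> shift (Suc k) c" by simp
  then obtain i where i: "?a i < c (Suc k + i)" "\<forall>j<i. c (Suc k + j) = ?a j" by (rule shift_greaterE)
  \<comment> \<open>The first excess sits at place \<open>f\<close> of the block starting at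
    \<open>K\<close>.\<close>
  define f where "f = i mod Suc n"
  define K where "K = Suc k + Suc n * (i div Suc n)"
  have per: "?a (Suc n * l + j) = ?a j" for l j
    using fun_cong[OF shift_mult_period[OF lower_period[of n A], of l], of j] by simp
  have i_eq: "i = Suc n * (i div Suc n) + f" unfolding f_def by (rule mult_div_mod_eq[symmetric])
  have s: "?a f < shift K c f" "\<forall>j<f. ?a j = shift K c j"
  proof -
    have "?a i = ?a f" "Suc k + i = K + f" using per i_eq by (metis, simp add: K_def f_def)
    then show "?a f < shift K c f" using i(1) by simp
    show "\<forall>j<f. ?a j = shift K c j"
    proof (intro allI impI)
      fix j assume "j < f"
      then have "Suc n * (i div Suc n) + j < i" using i_eq by linarith
      then have "c (Suc k + (Suc n * (i div Suc n) + j)) = ?a (Suc n * (i div Suc n) + j)" using i(2) by blast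
      then show "?a j = shift K c j" using per by (simp add: K_def add.assoc)
    qed
  qed
  have cm: "c i \<le> ?m" for i using c(1) \<alpha>(3) by (simp add: univ_seq_def)
  have less: "shift K c \<sqsubset> \<alpha>"
    using c \<alpha> by (intro active_less[of \<alpha> ?m c k K]) (auto simp: univ_seq_def K_def)
  then have lessA: "shift K c \<sqsubset> A" using \<alpha>(2) by (rule lex.less_le_trans)
  have "f \<le> n" by (simp add: f_def less_Suc_eq_le)
  then have agree: "shift K c j = A j" if "j < Suc n" for j
    using agree_if_above_lower[OF _ s lex.less_imp_le[OF lessA]] that by simp
  have "shift (Suc n) (shift K c) \<sqsubset> mirror ?m A"
    using lex_less_shift_iff[of "Suc n" "shift K c" A, OF agree] lessA A(1) by simp
  then have "A \<sqsubset> mirror ?m (shift (Suc n) (shift K c))"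
    using mirror_less_iff[of "mirror ?m A" ?m "shift (Suc n) (shift K c)"] A(3) cm by simp
  moreover have "mirror ?m (shift (Suc (K + n)) c) \<sqsubset> \<alpha>"
    using c(1) agree[of n] A(2) \<alpha>(3) unfolding univ_seq_def by simp
  ultimately show False using \<alpha>(2) by (simp add: add.commute)
qed

text \<open>The right-hand side involves \<open>A\<close> and \<open>n\<close> only: all bases in
  \<open>(q\<^sub>1, q\<^sub>2]\<close> have the same unique expansions.\<close>

lemma univ_seq_component_iff:
  assumes A: "shift (Suc n) A = mirror (A 0) A" "A n > 0" "\<forall>i. A i \<le> A 0"
    and \<alpha>: "shift (Suc 0) \<alpha> \<sqsubseteq> \<alpha>" "\<alpha> \<sqsubseteq> A" "\<alpha> 0 = A 0" "lower n A \<sqsubset> \<alpha>"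
  shows "univ_seq \<alpha> c \<longleftrightarrow> weak_seq (A 0) (lower n A) c"
proof
  assume c: "univ_seq \<alpha> c"
  have "mirror (A 0) (shift (Suc k) c) \<sqsubseteq> lower n A" if "0 < c k" for k
    using univ_seq_le_lower[OF A \<alpha>(1-3) univ_seq_mirror[OF c], of k] \<alpha>(3) A that
    by (cases "A 0 = 0") (auto simp: shift_mirror)
  then show "weak_seq (A 0) (lower n A) c"
    unfolding weak_seq_def
    using univ_seq_le_lower[OF A \<alpha>(1-3) c] c \<alpha>(3) by (simp add: univ_seq_def)
next
  assume c: "weak_seq (A 0) (lower n A) c"
  then show "univ_seq \<alpha> c"
    unfolding weak_seq_def univ_seq_def using \<alpha>(3,4) by (auto intro: lex.le_less_trans)
qed

text \<open>The tail of \<open>d\<close> after \<open>p\<close> is at most \<open>a\<close>. The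
  reflected bound \<open>j\<close> places later says that its rest is at least
  \<open>shift j a\<close>, whose reflection is \<open>a\<close>. As the first \<open>j\<close>
  digits agree with \<open>a\<close>, the tail is pinched to \<open>a\<close>.\<close>

lemma weak_seq_isolated:
  assumes a: "\<And>k. shift k a \<sqsubseteq> a" "a 0 \<le> m" "0 < a 0" and j: "j \<ge> 1" "mirror m (shift j a) = a"
    and c: "weak_seq m a c" "c p < m" "shift (Suc p) c = a"
    and d: "weak_seq m a d" "\<And>i. i < Suc p + j \<Longrightarrow> d i = c i"
  shows "d = c"
proof -
  have am: "\<forall>i. a i \<le> m" using le_first_digit[OF a(1)] a(2) le_trans by blast
  have dm: "\<forall>i. d i \<le> m" using d(1) by (simp add: weak_seq_def)
  have up: "shift (Suc p) d \<sqsubseteq> a" using d c(2) unfolding weak_seq_def by simp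
  have agree: "shift (Suc p) d i = a i" if "i < j" for i
    using d(2)[of "Suc p + i"] that fun_cong[OF c(3), of i] by simp
  have "0 < d (Suc p)" using agree[of 0] j a(3) by simp
  have "shift (Suc p + j) (mirror m d) \<sqsubseteq> a"
  proof (rule active_le[OF a(1,2)])
    show "shift (Suc k) (mirror m d) \<sqsubseteq> a" if "mirror m d k < m" for k
    proof -
      have "0 < d k" using that by (cases "d k = 0") auto
      then show ?thesis using d(1) by (simp add: weak_seq_def shift_mirror)
    qed
    show "mirror m d (Suc p) < m" using \<open>0 < d (Suc p)\<close> dm[rule_format, of "Suc p"] by simp
    show "Suc p < Suc p + j" using j by simp
  qed
  then have "mirror m (shift (Suc p + j) d) \<sqsubseteq> mirror m (shift j a)" using j(2) by (simp add: shift_mirror)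
  then have "shift j a \<sqsubseteq> shift j (shift (Suc p) d)"
    using mirror_le_iff[of "shift (Suc p + j) d" m "shift j a"] am dm by simp
  then have "a \<sqsubseteq> shift (Suc p) d" using lex_le_shift_iff[of j a "shift (Suc p) d"] agree by simp
  then have "shift (Suc p) d = shift (Suc p) c" using up c(3) by simp
  then show ?thesis using eq_iff_shift[of "Suc p" d c] d(2) by simp
qed

definition weak_isolated :: "nat \<Rightarrow> (nat \<Rightarrow> nat) \<Rightarrow> (nat \<Rightarrow> nat) \<Rightarrow> bool" where
  "weak_isolated m a c \<longleftrightarrow> weak_seq m a c \<and>
     (\<exists>n. \<forall>d. weak_seq m a d \<longrightarrow> (\<forall>j<n. d j = c j) \<longrightarrow> d = c)"

lemma weak_isolated_mirror:
  assumes c: "weak_isolated m a c"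
  shows "weak_isolated m a (mirror m c)"
proof -
  obtain n where n: "\<And>d. \<lbrakk>weak_seq m a d; \<forall>j<n. d j = c j\<rbrakk> \<Longrightarrow> d = c" and w: "weak_seq m a c"
    using c unfolding weak_isolated_def by blast
  have "d = mirror m c" if d: "weak_seq m a d" "\<forall>j<n. d j = mirror m c j" for d
  proof -
    have "mirror m d = c"
      by (rule n[OF weak_seq_mirror[OF d(1)]]) (use d(2) w in \<open>auto simp: weak_seq_def\<close>)
    then show ?thesis using d(1) by (auto simp: weak_seq_def)
  qed
  then show ?thesis unfolding weak_isolated_def using weak_seq_mirror[OF w] by blast
qed

text \<open>A sequence with a constrained tail equal to \<open>a\<close> is isolated, and so is its
  reflection. Any other nonzero sequence is approximated by sequences ending in \<open>a\<close>;
  the zero sequence is treated through its reflection.\<close>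

lemma weak_isolated_dense:
  assumes a: "\<And>k. shift k a \<sqsubseteq> a" "\<And>k. mirror m (shift k a) \<sqsubseteq> a" "a 0 \<le> m" "0 < a 0"
    and j: "j \<ge> 1" "mirror m (shift j a) = a" and c: "weak_seq m a c"
  shows "\<exists>d. weak_isolated m a d \<and> (\<forall>i<N. d i = c i)"
proof -
  have iso: "weak_isolated m a d" if "weak_seq m a d" "d p < m" "shift (Suc p) d = a" for d p
    unfolding weak_isolated_def using weak_seq_isolated[OF a(1,3,4) j that] that(1) by blast
  have main: "\<exists>d. weak_isolated m a d \<and> (\<forall>i<N. d i = c i)"
    if c: "weak_seq m a c" "0 < c i0" for c i0
  proof (cases "\<exists>p. 0 < c p \<and> mirror m (shift (Suc p) c) = a")
    case True
    then obtain p where p: "0 < c p" "mirror m (shift (Suc p) c) = a" by blast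
    have cm: "\<forall>i. c i \<le> m" using c(1) by (simp add: weak_seq_def)
    have "weak_isolated m a (mirror m c)"
      using weak_seq_mirror[OF c(1)] p cm[rule_format, of p]
      by (intro iso[of _ p]) (auto simp: shift_mirror)
    then show ?thesis using weak_isolated_mirror[of m a "mirror m c"] cm by auto
  next
    case False
    then obtain d n where "weak_seq m a d" "\<forall>j<N. d j = c j" "d n < m" "shift (Suc n) d = a"
      using weak_approx[OF a(1-3) c(1) _ c(2), of N] by metis
    then show ?thesis using iso by blast
  qed
  have cm: "\<forall>i. c i \<le> m" using c by (simp add: weak_seq_def)
  show ?thesis
  proof (cases "\<exists>i. 0 < c i")
    case True
    then show ?thesis using main[OF c] by blast
  next
    case False
    then have "0 < mirror m c 0" using a(3,4) by simp
    then obtain d where d: "weak_isolated m a d" "\<forall>i<N. d i = mirror m c i"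
      using main[OF weak_seq_mirror[OF c]] by blast
    have "\<forall>i<N. mirror m d i = c i" using d(2) cm by simp
    then show ?thesis using weak_isolated_mirror[OF d(1)] by blast
  qed
qed

text \<open>A decrement can be blocked only for zero and for a sequence ending in the reflection of
  \<open>a\<close>. The latter cannot also end in \<open>a\<close>, as one of these tails would
  contain the other and some tail of \<open>a\<close> would reflect to \<open>a\<close>. So the
  reflected sequence can be decremented instead.\<close>

lemma weak_seq_not_isolated:
  assumes a: "\<And>k. shift k a \<sqsubseteq> a" "\<And>k. mirror m (shift k a) \<sqsubseteq> a" "a 0 \<le> m" "0 < a 0"
    and ne: "\<And>j. mirror m (shift j a) \<noteq> a" and c: "weak_seq m a c"
  shows "\<exists>d. weak_seq m a d \<and> d \<noteq> c \<and> (\<forall>i<N. d i = c i)"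
proof -
  have main: "\<exists>d. weak_seq m a d \<and> d \<noteq> c \<and> (\<forall>i<N. d i = c i)"
    if c: "weak_seq m a c" "0 < c i0" "\<And>p. 0 < c p \<Longrightarrow> mirror m (shift (Suc p) c) \<noteq> a" for c i0
    using weak_approx[OF a(1-3) c(1,3,2), of N] by metis
  have cm: "\<forall>i. c i \<le> m" using c by (simp add: weak_seq_def)
  have am: "\<forall>i. a i \<le> m" using le_first_digit[OF a(1)] a(3) le_trans by blast
  show ?thesis
  proof (cases "(\<exists>i. 0 < c i) \<and> (\<forall>p. 0 < c p \<longrightarrow> mirror m (shift (Suc p) c) \<noteq> a)")
    case True
    then show ?thesis using main[OF c] by blast
  next
    case F: False
    have "(\<exists>i. c i < m) \<and> (\<forall>p. c p < m \<longrightarrow> shift (Suc p) c \<noteq> a)"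
    proof (cases "\<exists>i. 0 < c i")
      case False
      then have "c i = 0" for i by simp
      then have "shift (Suc p) c 0 \<noteq> a 0" for p using a(4) by simp
      then have "shift (Suc p) c \<noteq> a" for p by metis
      then show ?thesis using \<open>\<And>i. c i = 0\<close> a(3,4) by (metis less_le_trans)
    next
      case True
      then obtain p where p: "0 < c p" "mirror m (shift (Suc p) c) = a" using F by blast
      have "\<exists>i. c i < m"
      proof (rule ccontr)
        assume "\<nexists>i. c i < m"
        then have "c i = m" for i using cm by (metis le_neq_implies_less)
        then have "mirror m (shift (Suc p) c) 0 = 0" by simp
        then show False using p(2) a(4) by simp
      qed
      moreover have "shift (Suc p') c \<noteq> a" for p'
      proof
        assume p': "shift (Suc p') c = a"
        show False
        proof (cases "p' \<le> p")
          case True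
          have "shift (Suc p) c = shift (p - p') (shift (Suc p') c)" using True by simp
          then have "mirror m (shift (p - p') a) = a" using p(2) p' by metis
          then show False using ne by blast
        next
          case False
          have "shift (Suc p') c = shift (p' - p) (shift (Suc p) c)" using False by simp
          then have "mirror m a = shift (p' - p) a" using p(2) p' by (metis shift_mirror)
          then have "mirror m (shift (p' - p) a) = a" using am by (metis mirror_mirror)
          then show False using ne by blast
        qed
      qed
      ultimately show ?thesis by blast
    qed
    then obtain i where i: "c i < m" and np: "\<forall>p. c p < m \<longrightarrow> shift (Suc p) c \<noteq> a" by blast
    obtain d where d: "weak_seq m a d" "d \<noteq> mirror m c" "\<forall>i<N. d i = mirror m c i"
    proof -
      have "0 < mirror m c i" using i by simp
      moreover have "mirror m (shift (Suc p) (mirror m c)) \<noteq> a" if "0 < mirror m c p" for p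
        using np that cm by (simp add: shift_mirror)
      ultimately show ?thesis using main[OF weak_seq_mirror[OF c]] that by metis
    qed
    have "\<forall>i<N. mirror m d i = c i" using d(3) cm by simp
    moreover have "mirror m d \<noteq> c" using d(1,2) by (auto simp: weak_seq_def)
    ultimately show ?thesis using weak_seq_mirror[OF d(1)] by blast
  qed
qed

section \<open>Isolated points and the Cantor property\<close>

lemma isolated_dense:
  assumes q: "1 < q" and U: "\<And>c. univ_seq (quasi_greedy q) c \<longleftrightarrow> weak_seq m a c"
    and dense: "\<And>c N. weak_seq m a c \<Longrightarrow> \<exists>d. weak_isolated m a d \<and> (\<forall>i<N. d i = c i)"
  shows "univoque_set q \<subseteq> closure {x. x isolated_in univoque_set q}"
proof
  fix x assume "x \<in> univoque_set q"
  then obtain c where c: "weak_seq m a c" "x = val q c"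
    unfolding univoque_set_eq[OF q refl] U by blast
  have "val q c \<in> closure (val q ` {d. weak_isolated m a d})"
  proof (rule val_closure[OF q])
    show "c i \<le> m" for i using c by (simp add: weak_seq_def)
    fix n
    obtain d where "weak_isolated m a d" "\<forall>i<n. d i = c i" using dense[OF c(1)] by blast
    then show "\<exists>d. d \<in> {d. weak_isolated m a d} \<and> (\<forall>i. d i \<le> m) \<and> (\<forall>j<n. d j = c j)"
      by (auto simp: weak_isolated_def weak_seq_def)
  qed
  moreover have "val q d isolated_in univoque_set q" if iso: "weak_isolated m a d" for d
  proof -
    obtain n where n: "weak_seq m a d" "\<And>e. \<lbrakk>weak_seq m a e; \<forall>j<n. e j = d j\<rbrakk> \<Longrightarrow> e = d"
      using iso unfolding weak_isolated_def by blast
    show ?thesis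
      by (rule isolated_val[OF q refl, of _ n]) (use n in \<open>auto simp: U\<close>)
  qed
  then have "val q ` {d. weak_isolated m a d} \<subseteq> {x. x isolated_in univoque_set q}" by blast
  ultimately show "x \<in> closure {x. x isolated_in univoque_set q}"
    using c(2) closure_mono by blast
qed

text \<open>Four kinds of \<open>p\<close>: the base \<open>1\<close>; an integer above
  \<open>1\<close>, where \<open>n = 0\<close>; and for \<open>n \<ge> 1\<close> a base of
  \<open>\<V>\<close> outside \<open>bases_U\<close>, whose sequence \<open>lower n A\<close> is
  strict or not. For \<open>p > 1\<close> all turns on whether the reflection of some tail of
  \<open>lower n A\<close>, taken in the alphabet of \<open>r\<close>, is
  \<open>lower n A\<close>.\<close>

lemma component_case:
  assumes C: "component_V p r" and q: "q \<in> {p<..r}"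
  shows "closed (univoque_set q)"
    and "cantor_set (univoque_set q) \<longleftrightarrow> p \<in> real ` {3..} \<union> (closure bases_U - bases_U)"
    and "p \<in> {1, 2} \<union> (bases_V - closure bases_U) \<Longrightarrow>
      univoque_set q \<subseteq> closure {x. x isolated_in univoque_set q}"
proof -
  define A where "A = quasi_greedy r"
  define m where "m = A 0"
  let ?\<alpha> = "quasi_greedy q"
  have p1: "1 \<le> p" and rV: "r \<in> bases_V" and r1: "1 < r" using C by (auto simp: component_V_iff)
  have q1: "1 < q" using q p1 by simp
  have nsA: "\<not> strict_seq A" unfolding A_def by (rule component_right_not_strict[OF C])
  obtain n p' where n: "component_V p' r" "dominated 0 (mirror (A 0) A) A n"
    "shift (Suc n) A = mirror (A 0) A"
    "n = 0 \<and> A 0 = 1 \<and> p' = 1 \<or> (n \<ge> 1 \<or> A 0 \<ge> 2) \<and> p' \<in> bases_V \<and> quasi_greedy p' = lower n A"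
    using component_of_not_strict[OF rV A_def nsA] by metis
  have pp: "p' = p" using component_V_left_unique[OF n(1) C] .
  define a where "a = lower n A"
  have admA: "admissible A" unfolding A_def by (rule admissible_quasi_greedy[OF r1])
  have Am: "\<forall>i. A i \<le> A 0" using admissible_le_first[OF admA] by simp
  have An: "A n > 0" using dominated_last_pos[OF n(2)] Am by simp
  have adm\<alpha>: "admissible ?\<alpha>" by (rule admissible_quasi_greedy[OF q1])
  have \<alpha>A: "?\<alpha> \<sqsubseteq> A"
    using q quasi_greedy_strict_mono[OF q1, of r] by (cases "q = r") (auto simp: A_def lex.less_imp_le)
  have a\<alpha>: "a \<sqsubset> ?\<alpha>"
    using n(4)
  proof
    assume *: "n = 0 \<and> A 0 = 1 \<and> p' = 1"
    then have "a 0 = 0" by (simp add: a_def lower_last)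
    then show ?thesis using admissible_first_pos[OF adm\<alpha>] by (intro lex_lessI[of _ 0]) auto
  next
    assume *: "(n \<ge> 1 \<or> A 0 \<ge> 2) \<and> p' \<in> bases_V \<and> quasi_greedy p' = lower n A"
    then have "1 < p" "quasi_greedy p = a" using pp by (auto simp: mem_V_iff a_def)
    then show ?thesis using quasi_greedy_strict_mono[of p q] q by simp
  qed
  \<comment> \<open>All bases in \<open>(p, r]\<close> have the same largest digit.\<close>
  have \<alpha>0: "?\<alpha> 0 = A 0"
  proof -
    have "1 \<le> Suc n" by simp
    from first_diff_less_period[OF lower_period this admissible_shift_le[OF adm\<alpha>] a\<alpha>[unfolded a_def]]
    obtain i where "i < Suc n" "lower n A i < ?\<alpha> i" "\<forall>j<i. lower n A j = ?\<alpha> j" by metis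
    then show ?thesis using agree_if_above_lower[of i n A ?\<alpha> 0] \<alpha>A by simp
  qed
  have U: "univ_seq ?\<alpha> c \<longleftrightarrow> weak_seq m a c" for c
    unfolding m_def a_def
    using univ_seq_component_iff[OF n(3) An Am admissible_shift_le[OF adm\<alpha>] \<alpha>A \<alpha>0] a\<alpha> by (simp add: a_def)
  have "closed (val q ` {c. weak_seq m a c})"
    by (rule closed_val_image[OF q1 closed_weak_seq, of _ _ m]) (simp add: weak_seq_def)
  then show cl: "closed (univoque_set q)" unfolding univoque_set_eq[OF q1 refl] U .
  have qU: "q \<notin> closure bases_U"
    using C q complement_closure_U by blast
  have "q \<noteq> real (top_digit q) + 1"
  proof
    assume *: "q = real (top_digit q) + 1"
    then have "q = real (top_digit q + 1)" "top_digit q + 1 \<ge> 2" using top_digit_bounds[OF q1] by auto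
    then show False using nat_bases_U[of "top_digit q + 1"] qU closure_subset[of bases_U] by auto
  qed
  then have "interior (univoque_set q) = {}"
    using interior_closure_univoque[OF q1] cl by simp
  then have cantor: "cantor_set (univoque_set q) \<longleftrightarrow> \<not> (\<exists>x. x isolated_in univoque_set q)"
    using cl univoque_set_nonempty[OF q1] by (simp add: cantor_set_def)
  have ne: "\<exists>x. x isolated_in univoque_set q"
    if "univoque_set q \<subseteq> closure {x. x isolated_in univoque_set q}"
    using that univoque_set_nonempty[OF q1] by (cases "\<exists>x. x isolated_in univoque_set q") auto
  have "(cantor_set (univoque_set q) \<longleftrightarrow> p \<in> real ` {3..} \<union> (closure bases_U - bases_U)) \<and>
    (p \<in> {1, 2} \<union> (bases_V - closure bases_U) \<longrightarrow>
      univoque_set q \<subseteq> closure {x. x isolated_in univoque_set q})"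
    using n(4) unfolding pp
  proof
    assume *: "n = 0 \<and> A 0 = 1 \<and> p = 1"
    then have a0: "a = (\<lambda>_. 0)" by (simp add: a_def lower_def cycle_def fun_eq_iff)
    have m1: "m = 1" using * by (simp add: m_def)
    \<comment> \<open>With the bound zero, a digit \<open>0\<close> can be followed by zeros only
      and a digit \<open>1\<close> by ones only.\<close>
    have const: "c i = c 0" if c: "weak_seq 1 (\<lambda>_. 0) c" for c i
    proof (cases i)
      case (Suc k)
      have "c 0 = 0 \<or> c 0 = 1" "c i \<le> 1" using c unfolding weak_seq_def by (auto simp: le_Suc_eq)
      then show ?thesis
      proof (elim disjE)
        assume c0: "c 0 = 0"
        then have "shift (Suc 0) c \<sqsubseteq> (\<lambda>_. 0)" using c unfolding weak_seq_def by auto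
        then have "shift (Suc 0) c = (\<lambda>_. 0)" by (auto simp: lex_le_def less_fun_def)
        from fun_cong[OF this, of k] show ?thesis using Suc c0 by simp
      next
        assume c0: "c 0 = 1"
        then have "mirror 1 (shift (Suc 0) c) \<sqsubseteq> (\<lambda>_. 0)" using c unfolding weak_seq_def by auto
        then have "mirror 1 (shift (Suc 0) c) = (\<lambda>_. 0)" by (auto simp: lex_le_def less_fun_def)
        from fun_cong[OF this, of k] have "1 - c i = 0" using Suc by simp
        then show ?thesis using \<open>c i \<le> 1\<close> c0 by simp
      qed
    qed simp
    have "weak_isolated m a c" if c: "weak_seq m a c" for c
      unfolding weak_isolated_def
    proof (intro conjI c exI allI impI)
      fix d assume d: "weak_seq m a d" "\<forall>j<1. d j = c j"
      show "d = c"
      proof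
        fix i
        show "d i = c i" using const[of c i] const[of d i] c d a0 m1 by simp
      qed
    qed
    then have D: "univoque_set q \<subseteq> closure {x. x isolated_in univoque_set q}"
      by (intro isolated_dense[OF q1 U]) blast
    have "p \<notin> closure bases_U" "p \<notin> real ` {3..}" using * by (auto simp: closure_U_eq)
    then show ?thesis using D ne[OF D] cantor by blast
  next
    assume *: "(n \<ge> 1 \<or> A 0 \<ge> 2) \<and> p \<in> bases_V \<and> quasi_greedy p = lower n A"
    then have p: "1 < p" "quasi_greedy p = a" by (auto simp: mem_V_iff a_def)
    have n': "n \<ge> 1 \<or> A 0 \<ge> 2" using * by blast
    have as: "shift k a \<sqsubseteq> a" for k unfolding a_def by (rule lower_shift_le[OF admA An])
    have am: "mirror m (shift k a) \<sqsubseteq> a" for k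
      unfolding a_def m_def by (rule lower_mirror_le[OF admA n(2) n'])
    have a0: "a 0 \<le> m" unfolding a_def m_def by (rule lower_le_digit) (use Am in simp)
    have apos: "0 < a 0" using admissible_first_pos[OF admissible_quasi_greedy[OF p(1)]] p(2) by simp
    have dense: "univoque_set q \<subseteq> closure {x. x isolated_in univoque_set q}"
      if "j \<ge> 1" "mirror m (shift j a) = a" for j
      using weak_isolated_dense[OF as am a0 apos that] by (intro isolated_dense[OF q1 U])
    have no_iso: "\<not> (\<exists>x. x isolated_in univoque_set q)" if nj: "\<And>j. mirror m (shift j a) \<noteq> a"
    proof
      assume "\<exists>x. x isolated_in univoque_set q"
      then obtain x where x: "x isolated_in univoque_set q" ..
      then have "x \<in> univoque_set q" by (auto simp: isolated_in_def)
      then obtain c where c: "univ_seq ?\<alpha> c" "x = val q c" unfolding univoque_set_eq[OF q1 refl] by blast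
      have "\<not> val q c isolated_in univoque_set q"
        using weak_seq_not_isolated[OF as am a0 apos nj] c(1) unfolding U
        by (intro not_isolated_val[OF q1 refl]) (auto simp: U)
      then show False using x c(2) by simp
    qed
    show ?thesis
    proof (cases "n \<ge> 1")
      case True
      then have am0: "a 0 = m" by (simp add: a_def m_def lower_agree)
      \<comment> \<open>The decremented last digit is below the first one, so the periodic
        \<open>a\<close> is not constant and its base lies outside \<open>bases_U\<close>.\<close>
      have "a n \<noteq> a 0"
        using An Am[rule_format, of n] am0 unfolding a_def m_def by (simp add: lower_last)
      then have nc: "\<not> (\<forall>i. a i = a 0)" by blast
      have "univ_seq a a \<longrightarrow> False"
        using univ_seq_self_iff[of a] admissible_quasi_greedy[OF p(1)] p(2) nc lower_period[of n A]
        unfolding a_def by (metis le_add1 plus_1_eq_Suc)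
      then have pU: "p \<notin> bases_U" using p by (simp add: mem_U_iff)
      have pnat: "p \<notin> real ` {2..}" using pU nat_bases_U by auto
      then have p3: "p \<notin> real ` {3..}" "p \<noteq> 2" by (auto simp: image_iff)
      show ?thesis
      proof (cases "strict_seq a")
        case True
        then have "mirror m (shift j a) \<noteq> a" for j
          unfolding strict_seq_def am0 by (metis lex.less_irrefl)
        then have "\<not> (\<exists>x. x isolated_in univoque_set q)" by (rule no_iso)
        moreover have "p \<in> closure bases_U" using True p by (simp add: closure_U_eq)
        ultimately show ?thesis using cantor pU p p3 by auto
      next
        case False
        have "p \<in> bases_V" using * by blast
        then have V: "V_seq a" using p(2) by (simp add: mem_V_iff)
        obtain j where "j \<ge> 1" "mirror m (shift j a) = a" using V_not_strict[OF V False] am0 by metis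
        then have D: "univoque_set q \<subseteq> closure {x. x isolated_in univoque_set q}" by (rule dense)
        have "p \<notin> closure bases_U" using False p by (simp add: closure_U_eq)
        then show ?thesis using D ne[OF D] cantor p3 by blast
      qed
    next
      case False
      then have n0: "n = 0" "m \<ge> 2" using n' by (auto simp: m_def)
      have ac: "a = (\<lambda>_. m - 1)" using n0(1) by (simp add: a_def m_def lower_def cycle_def fun_eq_iff)
      have "p = real (m - 1) + 1" using quasi_greedy_const(2)[OF p(1), of "m - 1"] p(2) ac by simp
      then have pm: "p = real m" using n0 by simp
      have pU: "p \<in> bases_U" using nat_bases_U n0 pm by simp
      then have pcl: "p \<in> closure bases_U" using closure_subset by blast
      have mir: "mirror m (shift j a) = (\<lambda>_. 1)" for j using n0 ac by (simp add: fun_eq_iff)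
      show ?thesis
      proof (cases "m = 2")
        case True
        then have "mirror m (shift 1 a) = a" using mir[of 1] ac by simp
        then have D: "univoque_set q \<subseteq> closure {x. x isolated_in univoque_set q}" by (intro dense[of 1]) simp
        have "p \<notin> real ` {3..}" using pm True by auto
        then show ?thesis using D ne[OF D] cantor pU by blast
      next
        case False
        have "mirror m (shift j a) \<noteq> a" for j
          unfolding mir ac using False n0 by (auto simp: fun_eq_iff)
        then have "\<not> (\<exists>x. x isolated_in univoque_set q)" by (rule no_iso)
        moreover have "p \<in> real ` {3..}" using pm False n0 by auto
        moreover have "p \<notin> {1, 2} \<union> (bases_V - closure bases_U)" using pm False n0 pcl by auto
        ultimately show ?thesis using cantor by blast
      qed
    qed
  qed
  then show "cantor_set (univoque_set q) \<longleftrightarrow> p \<in> real ` {3..} \<union> (closure bases_U - bases_U)"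
    and "p \<in> {1, 2} \<union> (bases_V - closure bases_U) \<Longrightarrow>
      univoque_set q \<subseteq> closure {x. x isolated_in univoque_set q}"
    by blast+
qed

text \<open>The number \<open>1 / q\<close> has the expansion \<open>0 \<alpha>(q)\<close>, a limit
  of unique expansions \<open>0 b\<close> with \<open>b\<close> in \<open>\<V>\<close> below
  \<open>\<alpha>(q)\<close>. It is not univoque, so the set is not closed. Its closure has no
  isolated points by \<open>strict_approx\<close>.\<close>

lemma closure_U_case:
  assumes "q \<in> closure bases_U - real ` {1..}"
  shows "\<not> cantor_set (univoque_set q)" "cantor_set (closure (univoque_set q))"
proof -
  let ?A = "quasi_greedy q"
  have q1: "1 < q" and A: "strict_seq ?A" using assms by (auto simp: closure_U_eq)
  have adm: "admissible ?A" by (rule admissible_quasi_greedy[OF q1])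
  have A0: "?A 0 > 0" by (rule admissible_first_pos[OF adm])
  have Am: "?A i \<le> ?A 0" for i by (rule admissible_le_first[OF adm])
  have "1 / q \<in> closure (univoque_set q)"
  proof -
    have "val q (join 1 (\<lambda>_. 0) ?A) \<in> closure (val q ` {c. univ_seq ?A c})"
    proof (rule val_closure[OF q1])
      show "join 1 (\<lambda>_. 0) ?A i \<le> ?A 0" for i using Am by (simp add: join_def)
      fix n
      obtain b where b: "V_seq b" "b \<sqsubset> ?A" "\<forall>j<Suc n. b j = ?A j" using strict_left_limit[OF A] by blast
      let ?d = "join 1 (\<lambda>_. 0) b"
      have b0: "b 0 = ?A 0" using b(3) by simp
      have bm: "b i \<le> ?A 0" for i using admissible_le_first[of b i] b(1) b0 by (simp add: V_seq_def)
      have sd: "shift (Suc k) ?d = shift k b" for k using shift_join_ge[of 1 k] by simp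
      have "shift k b \<sqsubset> ?A" for k
        using b(1,2) unfolding V_seq_def admissible_def by (meson lex.le_less_trans)
      moreover have "mirror (?A 0) (shift k b) \<sqsubset> ?A" for k
        using b(1,2) b0 unfolding V_seq_def by (metis lex.le_less_trans)
      ultimately have "univ_seq ?A ?d"
        unfolding univ_seq_def sd using bm by (auto simp: join_def)
      moreover have "\<forall>j<n. ?d j = join 1 (\<lambda>_. 0) ?A j" using b(3) by (auto simp: join_def)
      ultimately show "\<exists>d. d \<in> {c. univ_seq ?A c} \<and> (\<forall>i. d i \<le> ?A 0) \<and>
          (\<forall>j<n. d j = join 1 (\<lambda>_. 0) ?A j)"
        using bm by (intro exI[of _ ?d]) (auto simp: join_def)
    qed
    moreover have "val q (join 1 (\<lambda>_. 0) ?A) = 1 / q"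
      using val_join[OF q1, of "\<lambda>_. 0" "?A 0" ?A 1] Am quasi_greedy_tails(2)[OF q1] by simp
    ultimately show ?thesis unfolding univoque_set_eq[OF q1 refl] by simp
  qed
  then have "\<not> closed (univoque_set q)" using inverse_not_univoque[OF q1] by auto
  then show "\<not> cantor_set (univoque_set q)" by (simp add: cantor_set_def)
  have "q \<noteq> real (top_digit q) + 1"
  proof
    assume "q = real (top_digit q) + 1"
    then have "q = real (top_digit q + 1)" by simp
    then have "q \<in> real ` {1..}" by (rule image_eqI) simp
    then show False using assms by blast
  qed
  then have int: "interior (closure (univoque_set q)) = {}" by (rule interior_closure_univoque[OF q1])
  have lim: "\<exists>d. univ_seq ?A d \<and> d \<noteq> c \<and> (\<forall>j<n. d j = c j)" if c: "univ_seq ?A c" for c n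
  proof (cases "\<exists>i. 0 < c i")
    case True
    then show ?thesis using strict_approx[OF A c] by metis
  next
    case False
    then have "0 < mirror (?A 0) c 0" using A0 by simp
    then obtain d where d: "univ_seq ?A d" "\<forall>j<n. d j = mirror (?A 0) c j" "d \<noteq> mirror (?A 0) c"
      using strict_approx[OF A univ_seq_mirror[OF c]] by metis
    have cm: "\<forall>i. c i \<le> ?A 0" using c by (simp add: univ_seq_def)
    have "mirror (?A 0) d \<noteq> c" using d by (auto simp: univ_seq_def)
    then show ?thesis using univ_seq_mirror[OF d(1)] d(2) cm by (intro exI[of _ "mirror (?A 0) d"]) simp
  qed
  have "\<not> x isolated_in closure (univoque_set q)" for x
  proof
    assume "x isolated_in closure (univoque_set q)"
    then have x: "x isolated_in univoque_set q" by (rule isolated_in_closure)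
    then have "x \<in> univoque_set q" by (auto simp: isolated_in_def)
    then obtain c where c: "univ_seq ?A c" "x = val q c" unfolding univoque_set_eq[OF q1 refl] by blast
    then show False using not_isolated_val[OF q1 refl c(1) lim[OF c(1)]] x by simp
  qed
  then show "cantor_set (closure (univoque_set q))"
    using int univoque_set_nonempty[OF q1] by (simp add: cantor_set_def)
qed

text \<open>Sequences ending in \<open>golden_seq\<close> are unique expansions and approximate
  every number of \<open>(0, 1)\<close>. Hence the closure has interior points, and it contains the
  non-univoque point \<open>1 / q\<close>.\<close>

lemma integer_case:
  assumes "q \<in> real ` {2..}"
  shows "\<not> cantor_set (univoque_set q)" "\<not> cantor_set (closure (univoque_set q))"
proof -
  obtain m where "q = real m" "m \<ge> 2" using assms by auto
  then obtain k where k: "q = real k + 1" "k \<ge> 1" by (intro that[of "m - 1"]) auto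
  have q1: "1 < q" using k by simp
  have A: "quasi_greedy q = (\<lambda>_. k)" using quasi_greedy_of_nat[OF k(2)] k(1) by simp
  have less: "e \<sqsubset> (\<lambda>_. k)" if e: "\<forall>i. e i \<le> k" "e j < k" for e :: "nat \<Rightarrow> nat" and j
  proof -
    define i where "i = (LEAST i. e i < k)"
    have "e i < k" unfolding i_def by (rule LeastI[of "\<lambda>i. e i < k" j, OF e(2)])
    moreover have "e i' = k" if "i' < i" for i'
      using not_less_Least[of i' "\<lambda>i. e i < k"] that e(1) unfolding i_def by (metis le_neq_implies_less)
    ultimately show ?thesis by (intro lex_lessI[of _ i]) auto
  qed
  have sub: "{0<..<1} \<subseteq> closure (univoque_set q)"
  proof
    fix x :: real assume "x \<in> {0<..<1}"
    then obtain c where c: "\<forall>i. c i \<le> k" "val q c = x"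
      using exists_expansion[OF q1, of k x] k by auto
    have "val q c \<in> closure (val q ` {c. univ_seq (quasi_greedy q) c})"
    proof (rule val_closure[OF q1])
      show "c i \<le> k" for i using c by simp
      fix n
      \<comment> \<open>Recurring zeros and ones make every tail and every reflected tail smaller
        than the constant sequence \<open>k\<close>.\<close>
      define d where "d = join n c golden_seq"
      have dk: "\<forall>i. d i \<le> k" using c(1) k(2) by (simp add: d_def join_def golden_seq_def)
      have d0: "\<exists>i\<ge>N. d i = 0" "\<exists>i\<ge>N. d i = 1" for N
        by (rule exI[of _ "n + (2 * N + 1)"], simp add: d_def join_def golden_seq_def,
            rule exI[of _ "n + 2 * N"], simp add: d_def join_def golden_seq_def)
      have "shift (Suc j) d \<sqsubset> (\<lambda>_. k)" for j
      proof -
        obtain i where "i \<ge> Suc j" "d i = 0" using d0 by blast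
        then show ?thesis using dk k(2) by (intro less[of _ "i - Suc j"]) auto
      qed
      moreover have "mirror k (shift (Suc j) d) \<sqsubset> (\<lambda>_. k)" for j
      proof -
        obtain i where "i \<ge> Suc j" "d i = 1" using d0 by blast
        then show ?thesis using dk k(2) by (intro less[of _ "i - Suc j"]) auto
      qed
      ultimately have "univ_seq (quasi_greedy q) d" unfolding univ_seq_def A using dk by simp
      then show "\<exists>d. d \<in> {c. univ_seq (quasi_greedy q) c} \<and> (\<forall>i. d i \<le> k) \<and> (\<forall>j<n. d j = c j)"
        using dk by (intro exI[of _ d]) (simp add: d_def)
    qed
    then show "x \<in> closure (univoque_set q)" unfolding univoque_set_eq[OF q1 refl] c(2) .
  qed
  have "1 / q \<in> {0<..<1}" using q1 by simp
  then have "1 / q \<in> closure (univoque_set q)" using sub by blast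
  then have "\<not> closed (univoque_set q)" using inverse_not_univoque[OF q1] by auto
  then show "\<not> cantor_set (univoque_set q)" by (simp add: cantor_set_def)
  have "{0<..<1} \<subseteq> interior (closure (univoque_set q))" using sub by (intro interior_maximal) auto
  then have "interior (closure (univoque_set q)) \<noteq> {}"
    using \<open>1 / q \<in> {0<..<1}\<close> by blast
  then show "\<not> cantor_set (closure (univoque_set q))" by (simp add: cantor_set_def)
qed

theorem theorem1p6:
  shows
   "(left_endpoints = real ` {1..} \<union> (bases_V - bases_U)
      \<and> right_endpoints = bases_V - closure bases_U
      \<and> right_endpoints \<subseteq> left_endpoints
      \<and> {1<..} - closure bases_U = \<Union> {{q\<^sub>1<..q\<^sub>2} | q\<^sub>1 q\<^sub>2. component_V q\<^sub>1 q\<^sub>2})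
    \<and> (\<forall>q \<in> real ` {2..}.
          \<not> cantor_set (univoque_set q) \<and> \<not> cantor_set (closure (univoque_set q)))
    \<and> (\<forall>q \<in> closure bases_U - real ` {1..}.
          \<not> cantor_set (univoque_set q) \<and> cantor_set (closure (univoque_set q)))
    \<and> (\<forall>q\<^sub>1 q\<^sub>2 q. component_V q\<^sub>1 q\<^sub>2 \<and> q \<in> {q\<^sub>1<..q\<^sub>2} \<longrightarrow>
          closed (univoque_set q)
        \<and> (cantor_set (univoque_set q) \<longleftrightarrow>
             q\<^sub>1 \<in> real ` {3..} \<union> (closure bases_U - bases_U))
        \<and> (q\<^sub>1 \<in> {1, 2} \<union> (bases_V - closure bases_U) \<longrightarrow>
             univoque_set q \<subseteq> closure {x. x isolated_in univoque_set q}))"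
proof (intro conjI ballI allI impI)
  show "left_endpoints = real ` {1..} \<union> (bases_V - bases_U)" by (rule left_endpoints_eq)
  show "right_endpoints = bases_V - closure bases_U" by (rule right_endpoints_eq)
  show "right_endpoints \<subseteq> left_endpoints"
    unfolding left_endpoints_eq right_endpoints_eq using closure_subset[of bases_U] by blast
  show "{1<..} - closure bases_U = \<Union> {{q\<^sub>1<..q\<^sub>2} | q\<^sub>1 q\<^sub>2. component_V q\<^sub>1 q\<^sub>2}"
    by (rule complement_closure_U)
next
  fix q assume "q \<in> real ` {2..}"
  then show "\<not> cantor_set (univoque_set q)" "\<not> cantor_set (closure (univoque_set q))"
    by (rule integer_case)+
next
  fix q assume "q \<in> closure bases_U - real ` {1..}"
  then show "\<not> cantor_set (univoque_set q)" "cantor_set (closure (univoque_set q))"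
    by (rule closure_U_case)+
next
  fix q\<^sub>1 q\<^sub>2 q assume "component_V q\<^sub>1 q\<^sub>2 \<and> q \<in> {q\<^sub>1<..q\<^sub>2}"
  then have C: "component_V q\<^sub>1 q\<^sub>2" "q \<in> {q\<^sub>1<..q\<^sub>2}" by simp_all
  show "closed (univoque_set q)" by (rule component_case(1)[OF C])
  show "cantor_set (univoque_set q) \<longleftrightarrow> q\<^sub>1 \<in> real ` {3..} \<union> (closure bases_U - bases_U)"
    by (rule component_case(2)[OF C])
  show "univoque_set q \<subseteq> closure {x. x isolated_in univoque_set q}"
    if "q\<^sub>1 \<in> {1, 2} \<union> (bases_V - closure bases_U)"
    using that by (rule component_case(3)[OF C])
qed

end
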